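(* Let $\tilde u$ be a normal extremal control which is a regular point of $F_1$, with normal extremal $\tilde\lambda_t$, $0\le t\le1$, that is regular and satisfies $H_t<0$ for all $t\in[0,1]$. Assume that $H_t$ and $Z_t$ are piecewise real analytic with respect to $t$. Let $K$ be the compact symmetric operator on $\mathcal V$ associated with the second variation (see context), and for $\alpha\in\mathrm{Sp}(K)\setminus\{0\}$ let $m_\alpha$ be its multiplicity. Then the families of real numbers, depending on $\varepsilon>0$, $$\sum_{\alpha\in\mathrm{Sp}(K),\ |\alpha|\ge\varepsilon}m_\alpha\alpha,\qquad \prod_{\alpha\in\mathrm{Sp}(K),\ |\alpha|\ge\varepsilon}(1+\alpha)^{m_\alpha}$$ have finite limits as $\varepsilon\to0$.
   Context: Control system. $M,U$ are smooth manifolds without boundary, $q_0\in M$ is fixed; $\dot q=f^t_u(q)$, $q\in M$, $u\in U$, where $f^t_u(q)\in T_qM$ depends smoothly on $(q,u)$ and is measurable and bounded in $t\in[0,1]$. $\mathcal U$ is the set of admissible controls: measurable $u:[0,1]\to U$ with values in a compact subset of $U$ such that the solution $q(t;u)$ of $\dot q=f^t_{u(t)}(q)$, $q(0)=q_0$, exists on $[0,1]$; it is a Banach manifold (open in $L^\infty([0,1];U)$). $F_t:\mathcal U\to M$, $F_t(u)=q(t;u)$. For a smooth $\ell:M\times U\to\mathbb R$, $\varphi_t(u)=\int_0^t\ell(q(\tau;u),u(\tau))\,d\tau$. Extremals. $u$ is a normal extremal control if there is $\lambda_1\in T^*_{F_1(u)}M$ with $\lambda_1 D_uF_1=d_u\varphi_1$.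 Let $\sigma=ds$ be the canonical symplectic form on $T^*M$ ($s$ the Liouville 1-form), $\pi:T^*M\to M$ the projection, and let $\vec h$ be the Hamiltonian field of $h$, defined by $dh=\sigma(\cdot,\vec h)$. Put $h^t_u(\lambda)=\langle\lambda,f^t_u(q)\rangle-\ell(q,u)$ for $\lambda\in T_q^*M$. Given a normal extremal control $\tilde u$ with trajectory $\tilde q(t)=q(t;\tilde u)$, a normal extremal is a Lipschitz curve $\tilde\lambda_t\in T^*_{\tilde q(t)}M$ with $\dot{\tilde\lambda}_t=\vec h^t_{\tilde u(t)}(\tilde\lambda_t)$ and $\frac{\partial h^t_u(\tilde\lambda_t)}{\partial u}\big|_{u=\tilde u(t)}=0$. Both $\tilde u$ and $\tilde\lambda_t$ are fixed. Linear data. $\tilde\Phi^t$ is the flow on $T^*M$ (from time $0$ to time $t$) of $\dot\lambda=\vec h^t_{\tilde u(t)}(\lambda)$, and $g^t_u=(h^t_u-h^t_{\tilde u(t)})\circ\tilde\Phi^t$. Define $H_t=\frac{\partial^2h^t_{u}}{\partial u^2}(\tilde\lambda_t)\big|_{u=\tilde u(t)}:T_{\tilde u(t)}U\to T^*_{\tilde u(t)}U$ (self-adjoint), $Z_t=\frac{\partial\vec g^t_{u}}{\partial u}(\tilde\lambda_0)\big|_{u=\tilde u(t)}:T_{\tilde u(t)}U\to T_{\tilde\lambda_0}(T^*M)$, $X_t=\pi_*Z_t:T_{\tilde u(t)}U\to T_{q_0}M$, and $J:T_{\tilde\lambda_0}(T^*M)\to T^*_{\tilde\lambda_0}(T^*M)$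 by $\sigma_{\tilde\lambda_0}(\cdot,\cdot)=\langle J\cdot,\cdot\rangle$. The extremal is regular if $H_t$ is invertible for all $t\in[0,1]$ with uniformly bounded inverse; $H_t<0$ means the quadratic form is negative definite. "Piecewise real analytic in $t$" refers to $H_t,Z_t$ written as matrices in a trivialization of the family of spaces $T_{\tilde u(t)}U\cong\mathbb R^{\dim U}$: there is a finite subdivision of $[0,1]$ such that on each piece they are real analytic up to the endpoints. A regular point of $F_1$ is a $u$ for which $D_uF_1$ is surjective. Second variation. $\mathcal V$ is the $L^2$-closure of $\ker D_{\tilde u}F_1$, i.e. the space of $L^2$ maps $t\mapsto v(t)\in T_{\tilde u(t)}U$ with $\int_0^1X_tv(t)\,dt=0$, with the inner product $<v_1|v_2>=\int_0^1\langle -H_tv_1(t),v_2(t)\rangle\,dt$. The second variation (Hessian of $\varphi_1|_{F_1^{-1}(\tilde q(1))}$ at $\tilde u$) is $D^2_{\tilde u}\varphi_1(v)=<(I+K)v|v>$, where $K$ is the compact symmetric operator on $\mathcal V$ determined by $$<Kv|v>=-\int_0^1\left\langle J\int_0^tZ_\tau v(\tau)\,d\tau,\,Z_tv(t)\right\rangle dt,\quad v\in\mathcal V.$$ *)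

theory Defs
  imports "HOL-Analysis.Analysis"
begin

section \<open>Smooth maps between Euclidean spaces\<close>

primrec iter_deriv :: "'a::real_normed_vector list \<Rightarrow> ('a \<Rightarrow> 'b::real_normed_vector) \<Rightarrow> 'a \<Rightarrow> 'b"
  where
    "iter_deriv [] f = f"
  | "iter_deriv (v # vs) f = (\<lambda>x. frechet_derivative (iter_deriv vs f) (at x) v)"

text \<open>For open \<open>S\<close> in a finite-dimensional space this is \<open>C\<^sup>\<infinity>\<close>: all iterated directional derivatives
  exist and are differentiable, hence continuous.\<close>

definition smooth_on :: "'a::real_normed_vector set \<Rightarrow> ('a \<Rightarrow> 'b::real_normed_vector) \<Rightarrow> bool" where
  "smooth_on S f \<longleftrightarrow> (\<forall>vs. \<forall>x\<in>S. iter_deriv vs f differentiable (at x))"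

section \<open>Smooth manifolds\<close>

text \<open>A chart is a domain together with a coordinate map, whose values outside the domain are
  irrelevant. A manifold is given by an atlas; its points are those covered by a chart.\<close>

type_synonym ('a, 'e) chart = "'a set \<times> ('a \<Rightarrow> 'e)"

abbreviation cdom :: "('a, 'e) chart \<Rightarrow> 'a set" where "cdom c \<equiv> fst c"
abbreviation cmap :: "('a, 'e) chart \<Rightarrow> 'a \<Rightarrow> 'e" where "cmap c \<equiv> snd c"

definition cimg :: "('a, 'e) chart \<Rightarrow> 'e set" where "cimg c = cmap c ` cdom c"
definition cinv :: "('a, 'e) chart \<Rightarrow> 'e \<Rightarrow> 'a" where "cinv c = inv_into (cdom c) (cmap c)"

definition points :: "('a, 'e) chart set \<Rightarrow> 'a set" where
  "points A = (\<Union>c\<in>A. cdom c)"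

definition mtop :: "('a, 'e::euclidean_space) chart set \<Rightarrow> 'a topology" where
  "mtop A = topology_generated_by {{x \<in> cdom c. cmap c x \<in> W} |c W. c \<in> A \<and> open W}"

definition smooth_manifold :: "('a, 'e::euclidean_space) chart set \<Rightarrow> bool" where
  "smooth_manifold A \<longleftrightarrow>
     (\<forall>c\<in>A. inj_on (cmap c) (cdom c) \<and> open (cimg c)) \<and>
     (\<forall>c\<in>A. \<forall>d\<in>A. open (cmap c ` (cdom c \<inter> cdom d)) \<and>
        smooth_on (cmap c ` (cdom c \<inter> cdom d)) (cmap d \<circ> cinv c)) \<and>
     Hausdorff_space (mtop A) \<and> second_countable (mtop A)"

text \<open>A tangent vector is the family of its coordinate vectors in all charts around the foot point,
  transforming by the differentials of the coordinate changes; a covector is such a family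
  transforming contragrediently (covectors of the coordinate space being identified with vectors
  by the Euclidean inner product). Components in charts not containing the foot point are
  set to 0.\<close>

definition dtrans ::
  "('a, 'e::euclidean_space) chart \<Rightarrow> ('a, 'e) chart \<Rightarrow> 'a \<Rightarrow> 'e \<Rightarrow> 'e" where
  "dtrans c d q = frechet_derivative (cmap d \<circ> cinv c) (at (cmap c q))"

definition tangent_space ::
  "('a, 'e::euclidean_space) chart set \<Rightarrow> 'a \<Rightarrow> (('a, 'e) chart \<Rightarrow> 'e) set" where
  "tangent_space A q = {v.
     (\<forall>c\<in>A. \<forall>d\<in>A. q \<in> cdom c \<inter> cdom d \<longrightarrow> v d = dtrans c d q (v c)) \<and>
     (\<forall>c. \<not> (c \<in> A \<and> q \<in> cdom c) \<longrightarrow> v c = 0)}"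

definition cotangent_space ::
  "('a, 'e::euclidean_space) chart set \<Rightarrow> 'a \<Rightarrow> (('a, 'e) chart \<Rightarrow> 'e) set" where
  "cotangent_space A q = {p.
     (\<forall>c\<in>A. \<forall>d\<in>A. q \<in> cdom c \<inter> cdom d \<longrightarrow> (\<forall>w. p c \<bullet> w = p d \<bullet> dtrans c d q w)) \<and>
     (\<forall>c. \<not> (c \<in> A \<and> q \<in> cdom c) \<longrightarrow> p c = 0)}"

text \<open>The pairing does not depend on the chart in which it is evaluated.\<close>

definition pairing ::
  "('a, 'e::euclidean_space) chart set \<Rightarrow> 'a \<Rightarrow> (('a, 'e) chart \<Rightarrow> 'e) \<Rightarrow> (('a, 'e) chart \<Rightarrow> 'e) \<Rightarrow> real"
  where
  "pairing A q p v = (let c = (SOME c. c \<in> A \<and> q \<in> cdom c) in p c \<bullet> v c)"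

text \<open>Points of the cotangent bundle are pairs of a foot point and a covector there. A chart of the
  base induces canonical coordinates \<open>(x, p)\<close>.\<close>

type_synonym ('a, 'e) cobundle = "'a \<times> (('a, 'e) chart \<Rightarrow> 'e)"

definition cochart ::
  "('a, 'e::euclidean_space) chart set \<Rightarrow> ('a, 'e) chart \<Rightarrow> (('a, 'e) cobundle, 'e \<times> 'e) chart" where
  "cochart A c = ({(q, p). q \<in> cdom c \<and> p \<in> cotangent_space A q}, (\<lambda>(q, p). (cmap c q, p c)))"

definition coatlas ::
  "('a, 'e::euclidean_space) chart set \<Rightarrow> (('a, 'e) cobundle, 'e \<times> 'e) chart set" where
  "coatlas A = cochart A ` A"

section \<open>Symplectic structure in canonical coordinates\<close>

definition liouville :: "'e::euclidean_space \<times> 'e \<Rightarrow> 'e \<times> 'e \<Rightarrow> real" where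
  "liouville z a = snd z \<bullet> fst a"

text \<open>The exterior derivative of the Liouville form (of which \<open>a\<close>, \<open>b\<close> are constant fields).\<close>

definition sigma :: "'e::euclidean_space \<times> 'e \<Rightarrow> 'e \<times> 'e \<Rightarrow> 'e \<times> 'e \<Rightarrow> real" where
  "sigma z a b = frechet_derivative (\<lambda>z. liouville z b) (at z) a
               - frechet_derivative (\<lambda>z. liouville z a) (at z) b"

lemma sigma_eq: "sigma z a b = snd a \<bullet> fst b - snd b \<bullet> fst a"
proof -
  have "((\<lambda>z::'a \<times> 'a. liouville z c) has_derivative (\<lambda>a. snd a \<bullet> fst c)) (at z)" for c
    unfolding liouville_def by (auto intro!: derivative_eq_intros)
  then have "frechet_derivative (\<lambda>z::'a \<times> 'a. liouville z c) (at z) = (\<lambda>a. snd a \<bullet> fst c)" for c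
    using frechet_derivative_at by metis
  then show ?thesis by (simp add: sigma_def)
qed

text \<open>Hamiltonian field of \<open>g\<close>, with the sign convention \<open>dg = \<sigma>(\<cdot>, w)\<close>.\<close>

definition symp_grad ::
  "('e::euclidean_space \<times> 'e \<Rightarrow> real) \<Rightarrow> 'e \<times> 'e \<Rightarrow> 'e \<times> 'e" where
  "symp_grad g z = (THE w. \<forall>a. frechet_derivative g (at z) a = sigma z a w)"

lemma symp_grad_eq:
  fixes g :: "'e::euclidean_space \<times> 'e \<Rightarrow> real"
  assumes "(g has_derivative (\<lambda>a. gx \<bullet> fst a + gp \<bullet> snd a)) (at z)"
  shows "symp_grad g z = (gp, - gx)"
proof -
  have "frechet_derivative g (at z) = (\<lambda>a. gx \<bullet> fst a + gp \<bullet> snd a)"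
    using frechet_derivative_at[OF assms] by simp
  moreover have "w = (gp, - gx)"
    if w: "\<And>a. gx \<bullet> fst a + gp \<bullet> snd a = snd a \<bullet> fst w - snd w \<bullet> fst a" for w :: "'e \<times> 'e"
  proof -
    have "(gp - fst w) \<bullet> b = 0" for b
      using w[of "(0, b)"] by (simp add: inner_diff_left inner_commute[of b])
    moreover have "(gx + snd w) \<bullet> b = 0" for b
      using w[of "(b, 0)"] by (simp add: inner_add_left)
    ultimately show ?thesis
      by (metis add_eq_0_iff all_zero_iff eq_iff_diff_eq_0 prod.collapse)
  qed
  ultimately show ?thesis
    unfolding symp_grad_def sigma_eq
    by (intro the_equality) (simp_all add: inner_commute[of gp] inner_commute[of gx])
qed

section \<open>Ordinary differential equations on manifolds\<close>

text \<open>Lipschitz solutions on \<open>[0,T]\<close>, satisfying the equation almost everywhere. A time-dependent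
  vector field is given by its coordinate vectors \<open>F t x c\<close>.\<close>

definition trajectory ::
  "('a, 'e::euclidean_space) chart set \<Rightarrow> (real \<Rightarrow> 'a \<Rightarrow> ('a, 'e) chart \<Rightarrow> 'e)
    \<Rightarrow> real \<Rightarrow> (real \<Rightarrow> 'a) \<Rightarrow> bool" where
  "trajectory A F T \<gamma> \<longleftrightarrow>
     continuous_map (top_of_set {0..T}) (mtop A) \<gamma> \<and>
     (\<forall>c\<in>A. \<forall>a b. 0 \<le> a \<and> a \<le> b \<and> b \<le> T \<and> \<gamma> ` {a..b} \<subseteq> cdom c \<longrightarrow>
        (\<exists>L. L-lipschitz_on {a..b} (cmap c \<circ> \<gamma>)) \<and>
        (AE t in lebesgue_on {a..b}. (cmap c \<circ> \<gamma> has_vector_derivative F t (\<gamma> t) c) (at t)))"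

section \<open>Control systems\<close>

record ('m, 'e, 'u, 'k) control_system =
  state_atlas :: "('m, 'e) chart set"
  control_atlas :: "('u, 'k) chart set"
  start :: 'm
  dyn :: "real \<Rightarrow> 'u \<Rightarrow> 'm \<Rightarrow> ('m, 'e) chart \<Rightarrow> 'e"
  cost :: "'m \<Rightarrow> 'u \<Rightarrow> real"

definition local_dyn ::
  "('m, 'e::euclidean_space, 'u, 'k::euclidean_space) control_system
    \<Rightarrow> ('m, 'e) chart \<Rightarrow> ('u, 'k) chart \<Rightarrow> real \<Rightarrow> 'e \<times> 'k \<Rightarrow> 'e" where
  "local_dyn S c d t = (\<lambda>(x, y). dyn S t (cinv d y) (cinv c x) c)"

text \<open>Boundedness in \<open>t\<close> is meant, as usual for smooth time-dependent fields, locally uniformly in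
  \<open>(q, u)\<close> and for the derivatives of all orders with respect to \<open>(q, u)\<close>.\<close>

definition smooth_control_system ::
  "('m, 'e::euclidean_space, 'u, 'k::euclidean_space) control_system \<Rightarrow> bool" where
  "smooth_control_system S \<longleftrightarrow>
     smooth_manifold (state_atlas S) \<and> smooth_manifold (control_atlas S) \<and>
     start S \<in> points (state_atlas S) \<and>
     (\<forall>t\<in>{0..1}. \<forall>u\<in>points (control_atlas S). \<forall>q\<in>points (state_atlas S).
        dyn S t u q \<in> tangent_space (state_atlas S) q) \<and>
     (\<forall>c\<in>state_atlas S. \<forall>d\<in>control_atlas S.
        (\<forall>t\<in>{0..1}. smooth_on (cimg c \<times> cimg d) (local_dyn S c d t)) \<and>
        (\<forall>z\<in>cimg c \<times> cimg d. (\<lambda>t. local_dyn S c d t z) \<in> borel_measurable (lebesgue_on {0..1})) \<and>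
        (\<forall>C vs. compact C \<and> C \<subseteq> cimg c \<times> cimg d \<longrightarrow>
           (\<exists>B. \<forall>t\<in>{0..1}. \<forall>z\<in>C. norm (iter_deriv vs (local_dyn S c d t) z) \<le> B)) \<and>
        smooth_on (cimg c \<times> cimg d) (\<lambda>(x, y). cost S (cinv c x) (cinv d y)))"

definition solution ::
  "('m, 'e::euclidean_space, 'u, 'k::euclidean_space) control_system
    \<Rightarrow> (real \<Rightarrow> 'u) \<Rightarrow> (real \<Rightarrow> 'm) \<Rightarrow> bool" where
  "solution S u \<gamma> \<longleftrightarrow> \<gamma> 0 = start S \<and> trajectory (state_atlas S) (\<lambda>t. dyn S t (u t)) 1 \<gamma>"

definition admissible_controls ::
  "('m, 'e::euclidean_space, 'u, 'k::euclidean_space) control_system \<Rightarrow> (real \<Rightarrow> 'u) set" where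
  "admissible_controls S = {u.
     (\<forall>W. openin (mtop (control_atlas S)) W \<longrightarrow> {t \<in> {0..1}. u t \<in> W} \<in> sets lebesgue) \<and>
     (\<exists>C. compactin (mtop (control_atlas S)) C \<and> u ` {0..1} \<subseteq> C) \<and>
     (\<exists>\<gamma>. solution S u \<gamma>)}"

text \<open>The trajectory \<open>q(t;u)\<close>, i.e. \<open>F\<^sub>t(u)\<close> as a function of \<open>u\<close> and \<open>t\<close>; it is unique on \<open>[0,1]\<close>.\<close>

definition state ::
  "('m, 'e::euclidean_space, 'u, 'k::euclidean_space) control_system
    \<Rightarrow> (real \<Rightarrow> 'u) \<Rightarrow> real \<Rightarrow> 'm" where
  "state S u = (SOME \<gamma>. solution S u \<gamma>)"

definition total_cost ::
  "('m, 'e::euclidean_space, 'u, 'k::euclidean_space) control_system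
    \<Rightarrow> real \<Rightarrow> (real \<Rightarrow> 'u) \<Rightarrow> real" where
  "total_cost S t u = (LINT \<tau>|lebesgue_on {0..t}. cost S (state S u \<tau>) (u \<tau>))"

section \<open>Differential calculus on the Banach manifold of controls\<close>

text \<open>A measurable field of charts along a control with values in a compact set: finitely many charts
  are used, each on a measurable set of times and for control values in a compact part of its
  domain. It identifies the tangent spaces along the control with \<open>'k\<close> (by a measurable
  trivialization, bounded with bounded inverse), and induces a chart of the Banach manifold of
  controls, \<open>\<xi> \<mapsto> displace \<kappa> u \<xi>\<close> being its inverse.\<close>

definition chart_field :: "('u, 'k::euclidean_space) chart set \<Rightarrow> (real \<Rightarrow> 'u)
    \<Rightarrow> (real \<Rightarrow> ('u, 'k) chart) \<Rightarrow> bool" where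
  "chart_field A u \<kappa> \<longleftrightarrow>
     \<kappa> ` {0..1} \<subseteq> A \<and> finite (\<kappa> ` {0..1}) \<and>
     (\<forall>d. {t \<in> {0..1}. \<kappa> t = d} \<in> sets lebesgue) \<and>
     (\<forall>d\<in>A. \<exists>C. compact C \<and> C \<subseteq> cimg d \<and>
        (\<forall>t\<in>{0..1}. \<kappa> t = d \<longrightarrow> u t \<in> cdom d \<and> cmap d (u t) \<in> C))"

definition displace :: "(real \<Rightarrow> ('u, 'k::euclidean_space) chart) \<Rightarrow> (real \<Rightarrow> 'u)
    \<Rightarrow> (real \<Rightarrow> 'k) \<Rightarrow> real \<Rightarrow> 'u" where
  "displace \<kappa> u \<xi> t = cinv (\<kappa> t) (cmap (\<kappa> t) (u t) + \<xi> t)"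

definition bounded_measurable :: "(real \<Rightarrow> 'k::euclidean_space) set" where
  "bounded_measurable = {\<xi> \<in> borel_measurable (lebesgue_on {0..1}). bounded (\<xi> ` {0..1})}"

definition sup_norm :: "(real \<Rightarrow> 'k::euclidean_space) \<Rightarrow> real" where
  "sup_norm \<xi> = (SUP t\<in>{0..1}. norm (\<xi> t))"

text \<open>\<open>L\<close> is the Frechet derivative at \<open>u\<close> of a map \<open>G\<close> defined on the admissible controls, read in the
  chart given by \<open>\<kappa>\<close>.\<close>

definition has_control_derivative ::
  "('m, 'e::euclidean_space, 'u, 'k::euclidean_space) control_system
    \<Rightarrow> (real \<Rightarrow> ('u, 'k) chart) \<Rightarrow> (real \<Rightarrow> 'u) \<Rightarrow> ((real \<Rightarrow> 'u) \<Rightarrow> 'b::real_normed_vector)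
    \<Rightarrow> ((real \<Rightarrow> 'k) \<Rightarrow> 'b) \<Rightarrow> bool" where
  "has_control_derivative S \<kappa> u G L \<longleftrightarrow>
     (\<forall>\<xi>\<in>bounded_measurable. \<forall>\<eta>\<in>bounded_measurable. L (\<lambda>t. \<xi> t + \<eta> t) = L \<xi> + L \<eta>) \<and>
     (\<forall>r. \<forall>\<xi>\<in>bounded_measurable. L (\<lambda>t. r *\<^sub>R \<xi> t) = r *\<^sub>R L \<xi>) \<and>
     (\<exists>B. \<forall>\<xi>\<in>bounded_measurable. norm (L \<xi>) \<le> B * sup_norm \<xi>) \<and>
     (\<forall>e>0. \<exists>\<delta>>0. \<forall>\<xi>\<in>bounded_measurable. sup_norm \<xi> < \<delta> \<longrightarrow>
        displace \<kappa> u \<xi> \<in> admissible_controls S \<and>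
        norm (G (displace \<kappa> u \<xi>) - G u - L \<xi>) \<le> e * sup_norm \<xi>)"

definition regular_point ::
  "('m, 'e::euclidean_space, 'u, 'k::euclidean_space) control_system \<Rightarrow> (real \<Rightarrow> 'u) \<Rightarrow> bool" where
  "regular_point S u \<longleftrightarrow> u \<in> admissible_controls S \<and>
     (\<exists>\<kappa> c L. chart_field (control_atlas S) u \<kappa> \<and> c \<in> state_atlas S \<and> state S u 1 \<in> cdom c \<and>
        has_control_derivative S \<kappa> u (\<lambda>w. cmap c (state S w 1)) L \<and>
        L ` bounded_measurable = UNIV)"

definition normal_extremal_control ::
  "('m, 'e::euclidean_space, 'u, 'k::euclidean_space) control_system \<Rightarrow> (real \<Rightarrow> 'u) \<Rightarrow> bool" where
  "normal_extremal_control S u \<longleftrightarrow> u \<in> admissible_controls S \<and>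
     (\<exists>p \<in> cotangent_space (state_atlas S) (state S u 1). \<exists>\<kappa> c L N.
        chart_field (control_atlas S) u \<kappa> \<and> c \<in> state_atlas S \<and> state S u 1 \<in> cdom c \<and>
        has_control_derivative S \<kappa> u (\<lambda>w. cmap c (state S w 1)) L \<and>
        has_control_derivative S \<kappa> u (total_cost S 1) N \<and>
        (\<forall>\<xi>\<in>bounded_measurable. p c \<bullet> L \<xi> = N \<xi>))"

section \<open>Extremals\<close>

definition ham ::
  "('m, 'e::euclidean_space, 'u, 'k::euclidean_space) control_system
    \<Rightarrow> real \<Rightarrow> 'u \<Rightarrow> ('m, 'e) cobundle \<Rightarrow> real" where
  "ham S t u = (\<lambda>(q, p). pairing (state_atlas S) q p (dyn S t u q) - cost S q u)"

definition ham_field ::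
  "('m, 'e::euclidean_space, 'u, 'k::euclidean_space) control_system
    \<Rightarrow> (real \<Rightarrow> 'u) \<Rightarrow> real \<Rightarrow> ('m, 'e) cobundle \<Rightarrow> (('m, 'e) cobundle, 'e \<times> 'e) chart \<Rightarrow> 'e \<times> 'e"
  where
  "ham_field S u t l C = symp_grad (ham S t (u t) \<circ> cinv C) (cmap C l)"

definition normal_extremal ::
  "('m, 'e::euclidean_space, 'u, 'k::euclidean_space) control_system
    \<Rightarrow> (real \<Rightarrow> 'u) \<Rightarrow> (real \<Rightarrow> ('m, 'e) cobundle) \<Rightarrow> bool" where
  "normal_extremal S u lam \<longleftrightarrow>
     (\<forall>t\<in>{0..1}. fst (lam t) = state S u t \<and>
        snd (lam t) \<in> cotangent_space (state_atlas S) (state S u t)) \<and>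
     trajectory (coatlas (state_atlas S)) (ham_field S u) 1 lam \<and>
     (\<forall>t\<in>{0..1}. \<forall>d\<in>control_atlas S. u t \<in> cdom d \<longrightarrow>
        ((\<lambda>y. ham S t (cinv d y) (lam t)) has_derivative (\<lambda>_. 0)) (at (cmap d (u t))))"

text \<open>The flow from time 0 to time \<open>t\<close> of the Hamiltonian field along the control \<open>u\<close>
  (the solution is unique).\<close>

definition flow ::
  "('m, 'e::euclidean_space, 'u, 'k::euclidean_space) control_system
    \<Rightarrow> (real \<Rightarrow> 'u) \<Rightarrow> real \<Rightarrow> ('m, 'e) cobundle \<Rightarrow> ('m, 'e) cobundle" where
  "flow S u t l =
     (SOME \<gamma>. trajectory (coatlas (state_atlas S)) (ham_field S u) t \<gamma> \<and> \<gamma> 0 = l) t"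

definition gham ::
  "('m, 'e::euclidean_space, 'u, 'k::euclidean_space) control_system
    \<Rightarrow> (real \<Rightarrow> 'u) \<Rightarrow> real \<Rightarrow> 'u \<Rightarrow> ('m, 'e) cobundle \<Rightarrow> real" where
  "gham S u t w l = ham S t w (flow S u t l) - ham S t (u t) (flow S u t l)"

text \<open>The linear data are read in the chart field \<open>\<kappa>\<close> along the control and in the canonical
  coordinates of the cotangent bundle given by a chart \<open>c\<close> around the initial point. The operator
  of second derivatives at the critical point is \<open>Hop\<close>; covectors are again identified with
  vectors, so that \<open>\<langle>H\<^sub>t v, w\<rangle>\<close> is \<open>Hop S u lam \<kappa> t v \<bullet> w\<close>.\<close>

definition Hop ::
  "('m, 'e::euclidean_space, 'u, 'k::euclidean_space) control_system
    \<Rightarrow> (real \<Rightarrow> 'u) \<Rightarrow> (real \<Rightarrow> ('m, 'e) cobundle) \<Rightarrow> (real \<Rightarrow> ('u, 'k) chart)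
    \<Rightarrow> real \<Rightarrow> 'k \<Rightarrow> 'k" where
  "Hop S u lam \<kappa> t v =
     (\<Sum>b\<in>Basis. iter_deriv [v, b] (\<lambda>y. ham S t (cinv (\<kappa> t) y) (lam t)) (cmap (\<kappa> t) (u t)) *\<^sub>R b)"

definition Zop ::
  "('m, 'e::euclidean_space, 'u, 'k::euclidean_space) control_system
    \<Rightarrow> (real \<Rightarrow> 'u) \<Rightarrow> (real \<Rightarrow> ('m, 'e) cobundle) \<Rightarrow> (real \<Rightarrow> ('u, 'k) chart) \<Rightarrow> ('m, 'e) chart
    \<Rightarrow> real \<Rightarrow> 'k \<Rightarrow> 'e \<times> 'e" where
  "Zop S u lam \<kappa> c t = (let C = cochart (state_atlas S) c in
     frechet_derivative
       (\<lambda>y. symp_grad (gham S u t (cinv (\<kappa> t) y) \<circ> cinv C) (cmap C (lam 0)))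
       (at (cmap (\<kappa> t) (u t))))"

text \<open>In canonical coordinates the bundle projection is \<open>fst\<close>, and so is its differential.\<close>

definition Xop ::
  "('m, 'e::euclidean_space, 'u, 'k::euclidean_space) control_system
    \<Rightarrow> (real \<Rightarrow> 'u) \<Rightarrow> (real \<Rightarrow> ('m, 'e) cobundle) \<Rightarrow> (real \<Rightarrow> ('u, 'k) chart) \<Rightarrow> ('m, 'e) chart
    \<Rightarrow> real \<Rightarrow> 'k \<Rightarrow> 'e" where
  "Xop S u lam \<kappa> c t v = fst (Zop S u lam \<kappa> c t v)"

definition regular_extremal ::
  "('m, 'e::euclidean_space, 'u, 'k::euclidean_space) control_system
    \<Rightarrow> (real \<Rightarrow> 'u) \<Rightarrow> (real \<Rightarrow> ('m, 'e) cobundle) \<Rightarrow> (real \<Rightarrow> ('u, 'k) chart) \<Rightarrow> bool" where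
  "regular_extremal S u lam \<kappa> \<longleftrightarrow>
     (\<forall>t\<in>{0..1}. bij (Hop S u lam \<kappa> t)) \<and>
     (\<exists>B. \<forall>t\<in>{0..1}. \<forall>w. norm (inv (Hop S u lam \<kappa> t) w) \<le> B * norm w)"

section \<open>Piecewise real analytic families of linear maps\<close>

definition real_analytic_on :: "real set \<Rightarrow> (real \<Rightarrow> 'b::real_normed_vector) \<Rightarrow> bool" where
  "real_analytic_on S f \<longleftrightarrow>
     (\<forall>x\<in>S. \<exists>r>0. \<exists>a. \<forall>y. \<bar>y - x\<bar> < r \<longrightarrow> (\<lambda>n. (y - x) ^ n *\<^sub>R a n) sums f y)"

text \<open>At the finitely many points of the subdivision nothing is required of \<open>f\<close> itself; analyticity
  up to the endpoints is expressed by the analytic function \<open>g\<close> on the closed piece.\<close>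

definition piecewise_analytic :: "(real \<Rightarrow> 'b::real_normed_vector) \<Rightarrow> bool" where
  "piecewise_analytic f \<longleftrightarrow>
     (\<exists>(n::nat) s. s 0 = 0 \<and> s n = 1 \<and>
        (\<forall>i<n. s i < s (Suc i) \<and>
           (\<exists>g. real_analytic_on {s i..s (Suc i)} g \<and> (\<forall>t\<in>{s i<..<s (Suc i)}. f t = g t))))"

text \<open>The columns of the matrix are the \<open>a b\<close>.\<close>

definition piecewise_analytic_matrix ::
  "(real \<Rightarrow> 'k::euclidean_space \<Rightarrow> 'b::real_normed_vector) \<Rightarrow> bool" where
  "piecewise_analytic_matrix T \<longleftrightarrow>
     (\<exists>a. (\<forall>b\<in>Basis. piecewise_analytic (a b)) \<and>
        (\<forall>t\<in>{0..1}. \<forall>w. T t w = (\<Sum>b\<in>Basis. (w \<bullet> b) *\<^sub>R a b t)))"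

text \<open>A change of trivialization of the tangent spaces along the control, relative to the one given
  by a chart field.\<close>

definition trivialization :: "(real \<Rightarrow> 'k::euclidean_space \<Rightarrow> 'k) \<Rightarrow> bool" where
  "trivialization \<Psi> \<longleftrightarrow>
     (\<forall>t\<in>{0..1}. linear (\<Psi> t) \<and> bij (\<Psi> t)) \<and>
     (\<forall>w. (\<lambda>t. \<Psi> t w) \<in> borel_measurable (lebesgue_on {0..1})) \<and>
     (\<exists>B. \<forall>t\<in>{0..1}. \<forall>w. norm (\<Psi> t w) \<le> B * norm w \<and> norm (inv (\<Psi> t) w) \<le> B * norm w)"

definition piecewise_analytic_data ::
  "('m, 'e::euclidean_space, 'u, 'k::euclidean_space) control_system
    \<Rightarrow> (real \<Rightarrow> 'u) \<Rightarrow> (real \<Rightarrow> ('m, 'e) cobundle) \<Rightarrow> (real \<Rightarrow> ('u, 'k) chart) \<Rightarrow> ('m, 'e) chart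
    \<Rightarrow> bool" where
  "piecewise_analytic_data S u lam \<kappa> c \<longleftrightarrow>
     (\<exists>\<Psi>. trivialization \<Psi> \<and>
        piecewise_analytic_matrix (\<lambda>t w. adjoint (\<Psi> t) (Hop S u lam \<kappa> t (\<Psi> t w))) \<and>
        piecewise_analytic_matrix (\<lambda>t w. Zop S u lam \<kappa> c t (\<Psi> t w)))"

section \<open>The space of square integrable maps on the unit interval\<close>

definition sq_int :: "(real \<Rightarrow> 'k::euclidean_space) set" where
  "sq_int = {f \<in> borel_measurable (lebesgue_on {0..1}).
     integrable (lebesgue_on {0..1}) (\<lambda>t. (norm (f t))\<^sup>2)}"

lemma sq_int_zero: "(\<lambda>t. 0) \<in> sq_int"
  by (simp add: sq_int_def)

lemma sq_int_scaleR: "f \<in> sq_int \<Longrightarrow> (\<lambda>t. r *\<^sub>R f t) \<in> sq_int"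
  by (auto simp: sq_int_def power_mult_distrib)

lemma sq_int_minus: "f \<in> sq_int \<Longrightarrow> (\<lambda>t. - f t) \<in> sq_int"
  by (auto simp: sq_int_def)

lemma sq_int_add:
  assumes "f \<in> sq_int" "g \<in> sq_int"
  shows "(\<lambda>t. f t + g t) \<in> sq_int"
proof -
  have "(norm (f t + g t))\<^sup>2 \<le> 2 * (norm (f t))\<^sup>2 + 2 * (norm (g t))\<^sup>2" for t
    using zero_le_power2[of "norm (f t - g t)"]
    by (simp add: power2_norm_eq_inner inner_add inner_diff inner_commute)
  then have bound: "norm ((norm (f t + g t))\<^sup>2) \<le> norm (2 * (norm (f t))\<^sup>2 + 2 * (norm (g t))\<^sup>2)" for t
    by simp
  have "integrable (lebesgue_on {0..1}) (\<lambda>t. (norm (f t + g t))\<^sup>2)"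
    using assms unfolding sq_int_def
    by (intro Bochner_Integration.integrable_bound[OF _ _ AE_I2[OF bound]]) auto
  with assms show ?thesis by (auto simp: sq_int_def)
qed

lemma sq_int_inner:
  assumes "f \<in> sq_int" "g \<in> sq_int"
  shows "integrable (lebesgue_on {0..1}) (\<lambda>t. f t \<bullet> g t)"
proof -
  have "\<bar>f t \<bullet> g t\<bar> \<le> (norm (f t))\<^sup>2 + (norm (g t))\<^sup>2" for t
    using Cauchy_Schwarz_ineq2[of "f t" "g t"] sum_squares_bound[of "norm (f t)" "norm (g t)"]
      zero_le_power2[of "norm (f t)"] zero_le_power2[of "norm (g t)"] by linarith
  then have bound: "norm (f t \<bullet> g t) \<le> norm ((norm (f t))\<^sup>2 + (norm (g t))\<^sup>2)" for t
    by simp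
  show ?thesis
    using assms unfolding sq_int_def
    by (intro Bochner_Integration.integrable_bound[OF _ _ AE_I2[OF bound]]) auto
qed

definition sq_int_rel :: "(real \<Rightarrow> 'k::euclidean_space) \<Rightarrow> (real \<Rightarrow> 'k) \<Rightarrow> bool" where
  "sq_int_rel f g \<longleftrightarrow> f \<in> sq_int \<and> g \<in> sq_int \<and> (AE t in lebesgue_on {0..1}. f t = g t)"

quotient_type (overloaded) 'k L2 = "real \<Rightarrow> 'k::euclidean_space" / partial: sq_int_rel
  morphisms rep_L2 abs_L2
proof (rule part_equivpI)
  show "\<exists>f. sq_int_rel f (f :: real \<Rightarrow> 'k)"
    using sq_int_zero unfolding sq_int_rel_def by auto
  show "symp (sq_int_rel :: (real \<Rightarrow> 'k) \<Rightarrow> _)"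
    unfolding sq_int_rel_def symp_def by (auto simp: eq_commute)
  show "transp (sq_int_rel :: (real \<Rightarrow> 'k) \<Rightarrow> _)"
  proof (rule transpI)
    fix f g h :: "real \<Rightarrow> 'k"
    assume fg: "sq_int_rel f g" and gh: "sq_int_rel g h"
    then have "AE t in lebesgue_on {0..1}. f t = g t" "AE t in lebesgue_on {0..1}. g t = h t"
      by (simp_all add: sq_int_rel_def)
    then have "AE t in lebesgue_on {0..1}. f t = h t"
      by eventually_elim simp
    with fg gh show "sq_int_rel f h"
      by (simp add: sq_int_rel_def)
  qed
qed

instantiation L2 :: (euclidean_space) real_vector
begin

lift_definition zero_L2 :: "'a L2" is "\<lambda>t. 0"
  by (simp add: sq_int_rel_def sq_int_zero)

lift_definition plus_L2 :: "'a L2 \<Rightarrow> 'a L2 \<Rightarrow> 'a L2" is "\<lambda>f g t. f t + g t"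
  unfolding sq_int_rel_def by (auto intro: sq_int_add)

lift_definition uminus_L2 :: "'a L2 \<Rightarrow> 'a L2" is "\<lambda>f t. - f t"
  unfolding sq_int_rel_def by (auto intro: sq_int_minus)

lift_definition scaleR_L2 :: "real \<Rightarrow> 'a L2 \<Rightarrow> 'a L2" is "\<lambda>r f t. r *\<^sub>R f t"
  unfolding sq_int_rel_def by (auto intro: sq_int_scaleR)

definition minus_L2 :: "'a L2 \<Rightarrow> 'a L2 \<Rightarrow> 'a L2" where "minus_L2 x y = x + - y"

instance
proof
  fix x y z :: "'a L2" and r s :: real
  show "x + y + z = x + (y + z)"
    by transfer (auto simp: sq_int_rel_def add.assoc intro!: sq_int_add)
  show "x + y = y + x"
    by transfer (auto simp: sq_int_rel_def add.commute intro!: sq_int_add)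
  show "0 + x = x"
    by transfer (auto simp: sq_int_rel_def)
  show "- x + x = 0"
    by transfer (auto simp: sq_int_rel_def sq_int_zero)
  show "x - y = x + - y"
    by (simp add: minus_L2_def)
  show "r *\<^sub>R (x + y) = r *\<^sub>R x + r *\<^sub>R y"
    by transfer (auto simp: sq_int_rel_def scaleR_add_right intro!: sq_int_add sq_int_scaleR)
  show "(r + s) *\<^sub>R x = r *\<^sub>R x + s *\<^sub>R x"
    by transfer (auto simp: sq_int_rel_def scaleR_add_left intro!: sq_int_add sq_int_scaleR)
  show "r *\<^sub>R s *\<^sub>R x = (r * s) *\<^sub>R x"
    by transfer (auto simp: sq_int_rel_def intro!: sq_int_scaleR)
  show "1 *\<^sub>R x = x"
    by transfer (auto simp: sq_int_rel_def)
qed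

end

instantiation L2 :: (euclidean_space) real_inner
begin

lift_definition inner_L2 :: "'a L2 \<Rightarrow> 'a L2 \<Rightarrow> real"
  is "\<lambda>f g. LINT t|lebesgue_on {0..1}. f t \<bullet> g t"
  unfolding sq_int_rel_def by (auto intro!: integral_cong_AE simp: sq_int_def)

definition norm_L2 :: "'a L2 \<Rightarrow> real" where "norm_L2 x = sqrt (x \<bullet> x)"

definition sgn_L2 :: "'a L2 \<Rightarrow> 'a L2" where "sgn_L2 x = x /\<^sub>R norm x"

definition dist_L2 :: "'a L2 \<Rightarrow> 'a L2 \<Rightarrow> real" where "dist_L2 x y = norm (x - y)"

definition uniformity_L2 :: "('a L2 \<times> 'a L2) filter" where
  "uniformity_L2 = (INF e\<in>{0<..}. principal {(x, y). dist x y < e})"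

definition open_L2 :: "'a L2 set \<Rightarrow> bool" where
  "open_L2 U = (\<forall>x\<in>U. \<forall>\<^sub>F (x', y) in uniformity. x' = x \<longrightarrow> y \<in> U)"

instance
proof
  fix x y z :: "'a L2" and r :: real
  show "sgn x = x /\<^sub>R norm x"
    by (simp add: sgn_L2_def)
  show "dist x y = norm (x - y)"
    by (simp add: dist_L2_def)
  show "uniformity = (INF e\<in>{0<..}. principal {(x, y :: 'a L2). dist x y < e})"
    by (simp add: uniformity_L2_def)
  show "open U \<longleftrightarrow> (\<forall>x\<in>U. \<forall>\<^sub>F (x', y) in uniformity. x' = x \<longrightarrow> y \<in> U)" for U :: "'a L2 set"
    by (simp add: open_L2_def)
  show "x \<bullet> y = y \<bullet> x"
    by transfer (simp add: inner_commute)
  show "(x + y) \<bullet> z = x \<bullet> z + y \<bullet> z"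
    by transfer (auto simp: sq_int_rel_def inner_add_left sq_int_inner)
  show "(r *\<^sub>R x) \<bullet> y = r * (x \<bullet> y)"
    by transfer (auto simp: sq_int_rel_def sq_int_inner)
  show "0 \<le> x \<bullet> x"
    by transfer auto
  show "x \<bullet> x = 0 \<longleftrightarrow> x = 0"
  proof transfer
    fix f :: "real \<Rightarrow> 'a" assume "sq_int_rel f f"
    then have f: "f \<in> sq_int" by (simp add: sq_int_rel_def)
    have "(LINT t|lebesgue_on {0..1}. f t \<bullet> f t) = 0 \<longleftrightarrow> (AE t in lebesgue_on {0..1}. f t \<bullet> f t = 0)"
      using sq_int_inner[OF f f] by (intro integral_nonneg_eq_0_iff_AE) auto
    then show "(LINT t|lebesgue_on {0..1}. f t \<bullet> f t) = 0 \<longleftrightarrow> sq_int_rel f (\<lambda>t. 0)"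
      using f by (simp add: sq_int_rel_def sq_int_zero)
  qed
  show "norm x = sqrt (x \<bullet> x)"
    by (simp add: norm_L2_def)
qed

end

section \<open>The second variation\<close>

text \<open>Here \<open>rep_L2 v\<close> is a representative of \<open>v\<close>; the integrals do not depend on the choice.\<close>

definition variations ::
  "('m, 'e::euclidean_space, 'u, 'k::euclidean_space) control_system
    \<Rightarrow> (real \<Rightarrow> 'u) \<Rightarrow> (real \<Rightarrow> ('m, 'e) cobundle) \<Rightarrow> (real \<Rightarrow> ('u, 'k) chart) \<Rightarrow> ('m, 'e) chart
    \<Rightarrow> 'k L2 set" where
  "variations S u lam \<kappa> c =
     {v. (LINT t|lebesgue_on {0..1}. Xop S u lam \<kappa> c t (rep_L2 v t)) = 0}"

definition variation_inner ::
  "('m, 'e::euclidean_space, 'u, 'k::euclidean_space) control_system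
    \<Rightarrow> (real \<Rightarrow> 'u) \<Rightarrow> (real \<Rightarrow> ('m, 'e) cobundle) \<Rightarrow> (real \<Rightarrow> ('u, 'k) chart)
    \<Rightarrow> 'k L2 \<Rightarrow> 'k L2 \<Rightarrow> real" where
  "variation_inner S u lam \<kappa> v w =
     (LINT t|lebesgue_on {0..1}. (- Hop S u lam \<kappa> t (rep_L2 v t)) \<bullet> rep_L2 w t)"

text \<open>Boundedness and compactness refer to the \<open>L\<^sup>2\<close> norm, which on \<open>V\<close> is equivalent to the norm of
  \<open>variation_inner\<close> for a regular extremal with negative definite \<open>H\<^sub>t\<close>.\<close>

definition linear_operator_on :: "'h::real_normed_vector set \<Rightarrow> ('h \<Rightarrow> 'h) \<Rightarrow> bool" where
  "linear_operator_on V K \<longleftrightarrow> K ` V \<subseteq> V \<and>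
     (\<forall>v\<in>V. \<forall>w\<in>V. K (v + w) = K v + K w) \<and> (\<forall>r. \<forall>v\<in>V. K (r *\<^sub>R v) = r *\<^sub>R K v)"

definition compact_operator_on :: "'h::real_normed_vector set \<Rightarrow> ('h \<Rightarrow> 'h) \<Rightarrow> bool" where
  "compact_operator_on V K \<longleftrightarrow>
     linear_operator_on V K \<and> compact (closure (K ` (V \<inter> cball 0 1)))"

definition spectrum_on :: "'h::real_normed_vector set \<Rightarrow> ('h \<Rightarrow> 'h) \<Rightarrow> real set" where
  "spectrum_on V K = {\<alpha>. \<not> (\<exists>R. linear_operator_on V R \<and> (\<exists>B. \<forall>v\<in>V. norm (R v) \<le> B * norm v) \<and>
     (\<forall>v\<in>V. R (K v - \<alpha> *\<^sub>R v) = v \<and> K (R v) - \<alpha> *\<^sub>R R v = v))}"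

definition multiplicity_on :: "'h::real_normed_vector set \<Rightarrow> ('h \<Rightarrow> 'h) \<Rightarrow> real \<Rightarrow> nat" where
  "multiplicity_on V K \<alpha> = dim {v \<in> V. K v = \<alpha> *\<^sub>R v}"

text \<open>Since \<open>\<langle>J a, b\<rangle> = \<sigma>(a, b)\<close>, the integrand is the value of the symplectic form at the initial
  point of the extremal.\<close>

definition second_variation_operator ::
  "('m, 'e::euclidean_space, 'u, 'k::euclidean_space) control_system
    \<Rightarrow> (real \<Rightarrow> 'u) \<Rightarrow> (real \<Rightarrow> ('m, 'e) cobundle) \<Rightarrow> (real \<Rightarrow> ('u, 'k) chart) \<Rightarrow> ('m, 'e) chart
    \<Rightarrow> ('k L2 \<Rightarrow> 'k L2) \<Rightarrow> bool" where
  "second_variation_operator S u lam \<kappa> c K \<longleftrightarrow>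
     (let V = variations S u lam \<kappa> c; ip = variation_inner S u lam \<kappa>; Z = Zop S u lam \<kappa> c in
      compact_operator_on V K \<and>
      (\<forall>v\<in>V. \<forall>w\<in>V. ip (K v) w = ip v (K w)) \<and>
      (\<forall>v\<in>V. ip (K v) v =
         - (LINT t|lebesgue_on {0..1}.
              sigma (cmap (cochart (state_atlas S) c) (lam 0))
                (LINT \<tau>|lebesgue_on {0..t}. Z \<tau> (rep_L2 v \<tau>)) (Z t (rep_L2 v t)))))"

end

theory Submission
  imports Defs
begin

text \<open>For \<open>s > 0\<close> let \<open>N\<^sub>+(s)\<close> and \<open>N\<^sub>-(s)\<close> be the numbers of eigenvalues of \<open>K\<close> in \<open>[s, \<infinity>)\<close> and \<open>(-\<infinity>, -s]\<close>.
  If \<open>N\<^sub>\<plusminus>(s) = O(1/s)\<close> and \<open>N\<^sub>+(s) - N\<^sub>-(s) = O(s\<^bsup>-2/3\<^esup>)\<close>, both limits exist by summation by parts.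
  By the variational principle \<open>N\<^sub>+(s)\<close> is the largest dimension of a subspace on which \<open>\<langle>Kv|v\<rangle> \<ge> s \<langle>v|v\<rangle>\<close>, so
  it suffices to turn such a subspace into one on which \<open>-\<langle>Kv|v\<rangle> \<ge> s \<langle>v|v\<rangle>\<close>, losing \<open>O(s\<^bsup>-2/3\<^esup>)\<close> dimensions.
  Cut \<open>[0,1]\<close> into blocks of length \<open>h\<close> on which \<open>H\<close> and \<open>Z\<close> are Lipschitz. Asking that \<open>Z v\<close> has mean zero on
  every block costs \<open>O(1/h)\<close> dimensions and decouples the blocks. Freezing \<open>Z\<close> on a block changes the
  form by \<open>O(h\<^sup>2)\<close> in operator norm, and for constant \<open>Z\<close> the time reversal of the block changes its sign.
  The error is absorbed by stretching: a tail of relative length \<open>\<theta> \<sim> h\<^sup>2/s\<close> of each block is discarded,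
  which is harmless if \<open>\<theta> h\<close> is a small multiple of \<open>s\<close>, and the rest is stretched to the whole block, which gains
  a factor \<open>1/(1 - \<theta>)\<close>. Both requirements are met by \<open>h \<sim> s\<^bsup>2/3\<^esup>\<close>.\<close>

section \<open>Limits over a family of numbers balanced around zero\<close>

text \<open>The eigenvalues may decay only like 1/n, so the sum need not converge absolutely; it is
  rescued by the fact that a signed count of order s^(-2/3) is integrable at 0. The exponent results
  from two competing demands on the block length h and the discarded fraction \<theta>. Stretching
  multiplies the double integral of the form by 1/(1 - \<theta>)^2 but the single integral of the
  norm by 1/(1 - \<theta>); the net gain, about s \<theta>, has to beat the freezing error h^2. On
  the tail the form has size \<theta> h, which has to stay below s. Together h^3 is at most of order
  s^2. Without the stretching the reversed form would dominate only s - O(h^2), and comparing counts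
  at two thresholds would require regularity of the counting function. Conditions are imposed on the
  reversed functions as well: vanishing block means decouple their blocks and make them variations
  again. Analyticity enters through Lipschitz bounds on finitely many pieces. Dimensions are
  measured by finite independent sets, because the ambient spaces are infinite dimensional.\<close>

lemma limit_at_right_0_if_Cauchy:
  fixes f :: "real \<Rightarrow> real"
  assumes C: "\<And>e::real. e > 0 \<Longrightarrow> \<exists>d>0. \<forall>x y. 0 < x \<and> x < y \<and> y < d \<longrightarrow> \<bar>f x - f y\<bar> < e"
  shows "\<exists>l. (f \<longlongrightarrow> l) (at_right 0)"
proof -
  have C': "\<exists>d>0. \<forall>x y. 0 < x \<and> 0 < y \<and> x < d \<and> y < d \<longrightarrow> \<bar>f x - f y\<bar> < e" if e: "e > 0" for e :: real
  proof -
    obtain d where "d > 0" and d: "\<And>x y. 0 < x \<and> x < y \<and> y < d \<Longrightarrow> \<bar>f x - f y\<bar> < e"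
      using C[OF e] by blast
    have "\<bar>f x - f y\<bar> < e" if "0 < x" "0 < y" "x < d" "y < d" for x y
      using d[of x y] d[of y x] that \<open>e > 0\<close> by (cases x y rule: linorder_cases) auto
    with \<open>d > 0\<close> show ?thesis by blast
  qed
  define X where "X n = f (1 / real (Suc n))" for n
  have small: "\<exists>N. \<forall>n\<ge>N. 1 / real (Suc n) < d" if d: "d > 0" for d
  proof -
    obtain N where "1 / real (Suc N) < d" using nat_approx_posE[OF d] by blast
    moreover have "1 / real (Suc n) \<le> 1 / real (Suc N)" if "n \<ge> N" for n
      using that by (simp add: frac_le)
    ultimately show ?thesis by (meson le_less_trans)
  qed
  have "Cauchy X"
  proof (rule CauchyI)
    fix e :: real assume "e > 0"
    then obtain d where "d > 0" and d: "\<And>x y. 0 < x \<and> 0 < y \<and> x < d \<and> y < d \<Longrightarrow> \<bar>f x - f y\<bar> < e"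
      using C' by blast
    obtain N where N: "\<And>n. n \<ge> N \<Longrightarrow> 1 / real (Suc n) < d" using small[OF \<open>d > 0\<close>] by blast
    have "norm (X m - X n) < e" if "m \<ge> N" "n \<ge> N" for m n
      unfolding X_def real_norm_def by (rule d) (use N that in auto)
    then show "\<exists>M. \<forall>m\<ge>M. \<forall>n\<ge>M. norm (X m - X n) < e" by blast
  qed
  then obtain l where l: "X \<longlonglongrightarrow> l" using real_Cauchy_convergent convergent_def by blast
  have "(f \<longlongrightarrow> l) (at_right 0)"
  proof (rule tendstoI)
    fix e :: real assume "e > 0"
    then obtain d where "d > 0" and d: "\<And>x y. 0 < x \<and> 0 < y \<and> x < d \<and> y < d \<Longrightarrow> \<bar>f x - f y\<bar> < e/2"
      using C'[of "e/2"] by auto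
    obtain N where N: "\<And>n. n \<ge> N \<Longrightarrow> 1 / real (Suc n) < d" using small[OF \<open>d > 0\<close>] by blast
    obtain M where M: "\<And>n. n \<ge> M \<Longrightarrow> \<bar>X n - l\<bar> < e/2"
      using LIMSEQ_D[OF l, of "e/2"] \<open>e > 0\<close> by auto
    have "dist (f x) l < e" if "0 < x" "x < d" for x
    proof -
      have "\<bar>f x - X (max M N)\<bar> < e/2" unfolding X_def by (rule d) (use that N in auto)
      then show ?thesis using M[of "max M N"] unfolding dist_real_def by linarith
    qed
    then show "\<forall>\<^sub>F x in at_right 0. dist (f x) l < e"
      unfolding eventually_at_right_field using \<open>d > 0\<close> by blast
  qed
  then show ?thesis by blast
qed

text \<open>Summation by parts in integral form: writing \<open>f (y x)\<close> as
  \<open>f a\<close> plus the integral of \<open>f'\<close> up to \<open>y x\<close> and exchanging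
  sum and integral leaves only the partial counts over \<open>s \<le> y x\<close>. The weights may
  have either sign, so cancellation inside the counts is preserved.\<close>

lemma layer_cake_bound:
  fixes f f' B :: "real \<Rightarrow> real"
  assumes F: "finite F" and le: "a \<le> b" and y: "\<And>x. x \<in> F \<Longrightarrow> a \<le> y x \<and> y x \<le> b"
    and f: "\<And>s. s \<in> {a..b} \<Longrightarrow> (f has_real_derivative f' s) (at s)"
    and f0: "f a \<ge> 0" and f': "\<And>s. s \<in> {a..b} \<Longrightarrow> f' s \<ge> 0"
    and B: "\<And>s. s \<in> {a..b} \<Longrightarrow> \<bar>\<Sum>x | x \<in> F \<and> s \<le> y x. w x\<bar> \<le> B s"
    and I: "((\<lambda>s. f' s * B s) has_integral I) {a..b}"
  shows "\<bar>\<Sum>x\<in>F. w x * f (y x)\<bar> \<le> f a * B a + I"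
proof -
  let ?g = "\<lambda>x s. w x * (if s \<le> y x then f' s else 0)"
  have 1: "(?g x has_integral w x * (f (y x) - f a)) {a..b}" if x: "x \<in> F" for x
  proof (rule has_integral_mult_right)
    have "(f' has_integral f (y x) - f a) {a..y x}"
    proof (rule fundamental_theorem_of_calculus)
      show "a \<le> y x" using y[OF x] by simp
      fix s assume "s \<in> {a..y x}"
      then have "(f has_real_derivative f' s) (at s)" using y[OF x] f by auto
      then show "(f has_vector_derivative f' s) (at s within {a..y x})"
        by (simp add: has_real_derivative_iff_has_vector_derivative has_vector_derivative_at_within)
    qed
    then have "((\<lambda>s. if s \<in> {a..y x} then f' s else 0) has_integral f (y x) - f a) {a..b}"
      using y[OF x] by (subst has_integral_restrict) auto
    then show "((\<lambda>s. if s \<le> y x then f' s else 0) has_integral f (y x) - f a) {a..b}"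
      by (rule has_integral_eq[rotated]) auto
  qed
  have 2: "((\<lambda>s. \<Sum>x\<in>F. ?g x s) has_integral (\<Sum>x\<in>F. w x * (f (y x) - f a))) {a..b}"
    by (rule has_integral_sum[OF F 1])
  have 3: "norm (\<Sum>x\<in>F. ?g x s) \<le> f' s * B s" if s: "s \<in> {a..b}" for s
  proof -
    have "(\<Sum>x\<in>F. ?g x s) = (\<Sum>x\<in>F. if s \<le> y x then w x * f' s else 0)"
      by (rule sum.cong) auto
    also have "\<dots> = f' s * (\<Sum>x | x \<in> F \<and> s \<le> y x. w x)"
      using F by (simp add: sum.inter_filter[symmetric] sum_distrib_left mult.commute)
    finally show ?thesis using f'[OF s] B[OF s] by (simp add: abs_mult mult_left_mono)
  qed
  have 4: "\<bar>\<Sum>x\<in>F. w x * (f (y x) - f a)\<bar> \<le> I"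
    using integral_norm_bound_integral[OF has_integral_integrable[OF 2] has_integral_integrable[OF I] 3]
      integral_unique[OF 2] integral_unique[OF I] by simp
  have "{x. x \<in> F \<and> a \<le> y x} = F" using y by auto
  then have "\<bar>\<Sum>x\<in>F. w x\<bar> \<le> B a" using B[of a] le by simp
  then have 5: "\<bar>\<Sum>x\<in>F. w x * f a\<bar> \<le> f a * B a"
    using f0 by (simp add: sum_distrib_right[symmetric] abs_mult mult_right_mono mult.commute[of "f a"])
  have "(\<Sum>x\<in>F. w x * f (y x)) = (\<Sum>x\<in>F. w x * (f (y x) - f a)) + (\<Sum>x\<in>F. w x * f a)"
    by (simp add: sum.distrib[symmetric] algebra_simps)
  then show ?thesis using 4 5 by linarith
qed

text \<open>In the application \<open>A\<close> is the spectrum and \<open>m\<close> the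
  multiplicity, so the two sums are N_+ + N_- and N_+ - N_-. The bound 1/2 on
  \<open>s\<^sub>0\<close> keeps \<open>1 + x\<close> positive below the threshold and lets its
  logarithm be replaced by \<open>x\<close> up to \<open>2 * x\<^sup>2\<close>.\<close>

locale balanced_family =
  fixes A :: "real set" and m :: "real \<Rightarrow> nat" and C s\<^sub>0 :: real
  assumes fin: "\<And>e. e > 0 \<Longrightarrow> finite {x \<in> A. \<bar>x\<bar> \<ge> e}"
    and s0: "0 < s\<^sub>0" "s\<^sub>0 \<le> 1/2" and C0: "C \<ge> 0"
    and count: "\<And>s. 0 < s \<Longrightarrow> s \<le> s\<^sub>0 \<Longrightarrow> (\<Sum>x | x \<in> A \<and> \<bar>x\<bar> \<ge> s. real (m x)) \<le> C / s"
    and balance: "\<And>s. 0 < s \<Longrightarrow> s \<le> s\<^sub>0 \<Longrightarrow>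
      \<bar>(\<Sum>x | x \<in> A \<and> \<bar>x\<bar> \<ge> s. real (m x) * sgn x)\<bar> \<le> C * s powr (-2/3)"
begin

abbreviation window :: "real \<Rightarrow> real \<Rightarrow> real set" where
  "window a b \<equiv> {x \<in> A. a \<le> \<bar>x\<bar> \<and> \<bar>x\<bar> < b}"

lemma finite_window: "a > 0 \<Longrightarrow> finite (window a b)"
  by (rule finite_subset[OF _ fin[of a]]) auto

lemma sum_window_split:
  fixes g :: "real \<Rightarrow> real"
  assumes "0 < a" "a \<le> b"
  shows "(\<Sum>x | x \<in> A \<and> \<bar>x\<bar> \<ge> a. g x) = (\<Sum>x\<in>window a b. g x) + (\<Sum>x | x \<in> A \<and> \<bar>x\<bar> \<ge> b. g x)"
proof -
  have "{x. x \<in> A \<and> \<bar>x\<bar> \<ge> a} = window a b \<union> {x \<in> A. \<bar>x\<bar> \<ge> b}" using assms by auto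
  then show ?thesis using assms finite_window[of a b] fin[of b]
    by (simp add: sum.union_disjoint disjoint_iff)
qed

lemma prod_window_split:
  fixes g :: "real \<Rightarrow> real"
  assumes "0 < a" "a \<le> b"
  shows "(\<Prod>x | x \<in> A \<and> \<bar>x\<bar> \<ge> a. g x) = (\<Prod>x\<in>window a b. g x) * (\<Prod>x | x \<in> A \<and> \<bar>x\<bar> \<ge> b. g x)"
proof -
  have "{x. x \<in> A \<and> \<bar>x\<bar> \<ge> a} = window a b \<union> {x \<in> A. \<bar>x\<bar> \<ge> b}" using assms by auto
  then show ?thesis using assms finite_window[of a b] fin[of b]
    by (simp add: prod.union_disjoint disjoint_iff)
qed

lemma window_above:
  fixes g :: "real \<Rightarrow> real"
  assumes "0 < a" "a \<le> s" "s \<le> b"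
  shows "(\<Sum>x | x \<in> window a b \<and> s \<le> \<bar>x\<bar>. g x)
    = (\<Sum>x | x \<in> A \<and> \<bar>x\<bar> \<ge> s. g x) - (\<Sum>x | x \<in> A \<and> \<bar>x\<bar> \<ge> b. g x)"
proof -
  have "{x. x \<in> window a b \<and> s \<le> \<bar>x\<bar>} = window s b" using assms by auto
  then show ?thesis using sum_window_split[of s b g] assms by simp
qed

text \<open>Layer cake with \<open>f\<close> the identity and signed weights. A count inside a
  window is a difference of two signed counts, whence the factor 2 in \<open>?B\<close>; the
  primitive 3 s^(1/3) of s^(-2/3) tends to 0 at 0, which is where the exponent below 1 is
  used.\<close>

lemma window_sum_small:
  assumes "0 < a" "a \<le> b" "b \<le> s\<^sub>0"
  shows "\<bar>\<Sum>x\<in>window a b. real (m x) * x\<bar> \<le> 8 * C * b powr (1/3)"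
proof -
  let ?B = "\<lambda>s. 2 * C * s powr (-2/3)"
  have "(\<Sum>x\<in>window a b. real (m x) * x) = (\<Sum>x\<in>window a b. (real (m x) * sgn x) * \<bar>x\<bar>)"
    by (rule sum.cong) (auto simp: sgn_if)
  also have "\<bar>\<dots>\<bar> \<le> a * ?B a + (6 * C * b powr (1/3) - 6 * C * a powr (1/3))"
  proof (rule layer_cake_bound[where f = "\<lambda>x. x" and f' = "\<lambda>_. 1" and b = b])
    fix s assume s: "s \<in> {a..b}"
    have "b powr (-2/3) \<le> s powr (-2/3)" using s assms by (intro powr_mono2') auto
    then have "C * b powr (-2/3) \<le> C * s powr (-2/3)" using C0 by (rule mult_left_mono)
    moreover have "(\<Sum>x | x \<in> window a b \<and> s \<le> \<bar>x\<bar>. real (m x) * sgn x)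
      = (\<Sum>x | x \<in> A \<and> \<bar>x\<bar> \<ge> s. real (m x) * sgn x) - (\<Sum>x | x \<in> A \<and> \<bar>x\<bar> \<ge> b. real (m x) * sgn x)"
      by (rule window_above) (use s assms in auto)
    moreover have "s > 0" "s \<le> s\<^sub>0" using s assms by auto
    ultimately show "\<bar>\<Sum>x | x \<in> window a b \<and> s \<le> \<bar>x\<bar>. real (m x) * sgn x\<bar> \<le> ?B s"
      using balance[of s] balance[of b] assms by linarith
  next
    have "((\<lambda>s. ?B s) has_integral (6 * C * b powr (1/3) - 6 * C * a powr (1/3))) {a..b}"
    proof (rule fundamental_theorem_of_calculus[OF assms(2)])
      fix s assume "s \<in> {a..b}"
      then have "s > 0" using assms by auto
      then have "((\<lambda>s. 6 * C * s powr (1/3)) has_real_derivative ?B s) (at s within {a..b})"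
        by (auto intro!: derivative_eq_intros)
      then show "((\<lambda>s. 6 * C * s powr (1/3)) has_vector_derivative ?B s) (at s within {a..b})"
        by (simp add: has_real_derivative_iff_has_vector_derivative)
    qed
    then show "((\<lambda>s. 1 * ?B s) has_integral (6 * C * b powr (1/3) - 6 * C * a powr (1/3))) {a..b}" by simp
  qed (use assms finite_window in \<open>auto\<close>)
  also have "a * ?B a = 2 * C * a powr (1/3)"
    using assms powr_add[of a 1 "-2/3"] by simp
  also have "2 * C * a powr (1/3) + (6 * C * b powr (1/3) - 6 * C * a powr (1/3)) \<le> 8 * C * b powr (1/3)"
  proof -
    have "0 \<le> C * a powr (1/3)" "0 \<le> C * b powr (1/3)" using C0 by auto
    then show ?thesis by linarith
  qed
  finally show ?thesis .
qed

text \<open>Signs are lost here, but the derivative \<open>2 * s\<close> of the square cancels the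
  singularity of the total count, so the bound \<open>C / s\<close> suffices.\<close>

lemma window_square_sum_small:
  assumes "0 < a" "a \<le> b" "b \<le> s\<^sub>0"
  shows "(\<Sum>x\<in>window a b. real (m x) * x\<^sup>2) \<le> 4 * C * b"
proof -
  have "\<bar>\<Sum>x\<in>window a b. real (m x) * (\<bar>x\<bar>)\<^sup>2\<bar> \<le> a\<^sup>2 * (2 * C / a) + (4 * C * b - 4 * C * a)"
  proof (rule layer_cake_bound[where f = "\<lambda>x. x\<^sup>2" and f' = "\<lambda>x. 2 * x" and b = b])
    fix s assume s: "s \<in> {a..b}"
    have "0 \<le> (\<Sum>x | x \<in> A \<and> \<bar>x\<bar> \<ge> b. real (m x))" by (intro sum_nonneg) auto
    moreover have "0 \<le> (\<Sum>x | x \<in> window a b \<and> s \<le> \<bar>x\<bar>. real (m x))" by (intro sum_nonneg) auto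
    moreover have "C / s \<ge> 0" using C0 s assms by auto
    ultimately show "\<bar>\<Sum>x | x \<in> window a b \<and> s \<le> \<bar>x\<bar>. real (m x)\<bar> \<le> 2 * C / s"
      using window_above[of a s b "\<lambda>x. real (m x)"] count[of s] s assms by auto
  next
    have "((\<lambda>s. 4 * C) has_integral (4 * C * b - 4 * C * a)) {a..b}"
      using has_integral_const_real[of "4 * C" a b] assms by (simp add: algebra_simps)
    then show "((\<lambda>s. 2 * s * (2 * C / s)) has_integral (4 * C * b - 4 * C * a)) {a..b}"
      by (rule has_integral_eq[rotated]) (use assms in auto)
  qed (use assms finite_window in \<open>auto intro!: derivative_eq_intros\<close>)
  also have "a\<^sup>2 * (2 * C / a) = 2 * (C * a)" using assms by (simp add: power2_eq_square)
  finally have "\<bar>\<Sum>x\<in>window a b. real (m x) * \<bar>x\<bar>\<^sup>2\<bar> \<le> 2 * (C * a) + (4 * C * b - 4 * C * a)" .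
  moreover have "0 \<le> C * a" using C0 assms by simp
  ultimately show ?thesis by simp
qed

lemma small_window:
  assumes "e > 0" "D \<ge> 0"
  obtains d where "d > 0" "d \<le> s\<^sub>0" "\<And>b. 0 < b \<Longrightarrow> b < d \<Longrightarrow> 8 * C * b powr (1/3) + D * b < e"
proof -
  have "((\<lambda>b. 8 * C * b powr (1/3) + D * b) \<longlongrightarrow> 8 * C * 0 powr (1/3) + D * 0) (at_right 0)"
    by (intro tendsto_intros tendsto_powr') (auto simp: eventually_at_right_field intro!: exI[of _ 1])
  then have "\<forall>\<^sub>F b in at_right 0. 8 * C * b powr (1/3) + D * b < e"
    using assms by (intro order_tendstoD) auto
  then obtain d where "d > 0" "\<And>b. 0 < b \<Longrightarrow> b < d \<Longrightarrow> 8 * C * b powr (1/3) + D * b < e"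
    unfolding eventually_at_right_field by auto
  then show ?thesis using s0 by (intro that[of "min d s\<^sub>0"]) auto
qed

lemma sum_converges:
  "\<exists>l. ((\<lambda>\<epsilon>. \<Sum>x | x \<in> A \<and> \<bar>x\<bar> \<ge> \<epsilon>. real (m x) * x) \<longlongrightarrow> l) (at_right 0)"
proof (rule limit_at_right_0_if_Cauchy)
  fix e :: real assume "e > 0"
  then obtain d where d: "d > 0" "d \<le> s\<^sub>0" "\<And>b. 0 < b \<Longrightarrow> b < d \<Longrightarrow> 8 * C * b powr (1/3) + 0 * b < e"
    by (rule small_window[of e 0]) auto
  have "\<bar>(\<Sum>x | x \<in> A \<and> \<bar>x\<bar> \<ge> a. real (m x) * x) - (\<Sum>x | x \<in> A \<and> \<bar>x\<bar> \<ge> b. real (m x) * x)\<bar> < e"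
    if "0 < a" "a < b" "b < d" for a b
    using sum_window_split[of a b "\<lambda>x. real (m x) * x"] window_sum_small[of a b] d(3)[of b] d(2) that by auto
  then show "\<exists>d>0. \<forall>a b. 0 < a \<and> a < b \<and> b < d \<longrightarrow>
    \<bar>(\<Sum>x | x \<in> A \<and> \<bar>x\<bar> \<ge> a. real (m x) * x) - (\<Sum>x | x \<in> A \<and> \<bar>x\<bar> \<ge> b. real (m x) * x)\<bar> < e"
    using d(1) by (intro exI[of _ d]) simp
qed

text \<open>The logarithm of \<open>1 + x\<close> differs from \<open>x\<close> by at most
  \<open>2 * x\<^sup>2\<close>: the linear part is controlled by the balance, the remainder by the
  total count.\<close>

lemma window_ln_small:
  assumes "0 < a" "a \<le> b" "b \<le> s\<^sub>0"
  shows "\<bar>\<Sum>x\<in>window a b. real (m x) * ln (1 + x)\<bar> \<le> 8 * C * b powr (1/3) + 8 * C * b"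
proof -
  have "\<bar>(\<Sum>x\<in>window a b. real (m x) * ln (1 + x)) - (\<Sum>x\<in>window a b. real (m x) * x)\<bar>
      = \<bar>\<Sum>x\<in>window a b. real (m x) * (ln (1 + x) - x)\<bar>"
    by (simp add: sum_subtractf algebra_simps)
  also have "\<dots> \<le> (\<Sum>x\<in>window a b. real (m x) * (2 * x\<^sup>2))"
  proof (intro order_trans[OF sum_abs] sum_mono)
    fix x assume "x \<in> window a b"
    then have "\<bar>x\<bar> \<le> 1/2" using assms s0 by auto
    then show "\<bar>real (m x) * (ln (1 + x) - x)\<bar> \<le> real (m x) * (2 * x\<^sup>2)"
      using abs_ln_one_plus_x_minus_x_bound[of x] by (simp add: abs_mult mult_left_mono)
  qed
  also have "\<dots> = 2 * (\<Sum>x\<in>window a b. real (m x) * x\<^sup>2)"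
    by (simp add: sum_distrib_left algebra_simps)
  also have "\<dots> \<le> 8 * C * b" using window_square_sum_small[OF assms] by simp
  finally show ?thesis using window_sum_small[OF assms] by linarith
qed

text \<open>Factors with \<open>\<bar>x\<bar> \<ge> s\<^sub>0\<close> may be zero or negative; they
  are collected in the fixed finite product \<open>?P\<close>, and logarithms are taken only below
  the threshold.\<close>

lemma prod_converges:
  "\<exists>l. ((\<lambda>\<epsilon>. \<Prod>x | x \<in> A \<and> \<bar>x\<bar> \<ge> \<epsilon>. (1 + x) ^ m x) \<longlongrightarrow> l) (at_right 0)"
proof -
  let ?L = "\<lambda>\<epsilon>. \<Sum>x\<in>window \<epsilon> s\<^sub>0. real (m x) * ln (1 + x)"
  let ?P = "\<Prod>x | x \<in> A \<and> \<bar>x\<bar> \<ge> s\<^sub>0. (1 + x) ^ m x"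
  have "\<exists>l. (?L \<longlongrightarrow> l) (at_right 0)"
  proof (rule limit_at_right_0_if_Cauchy)
    fix e :: real assume "e > 0"
    then obtain d where d: "d > 0" "d \<le> s\<^sub>0" "\<And>b. 0 < b \<Longrightarrow> b < d \<Longrightarrow> 8 * C * b powr (1/3) + 8 * C * b < e"
      by (rule small_window[of e "8 * C"]) (use C0 in auto)
    have "\<bar>?L a - ?L b\<bar> < e" if "0 < a" "a < b" "b < d" for a b
    proof -
      have "window a s\<^sub>0 = window a b \<union> window b s\<^sub>0" using that d by auto
      then have "?L a = (\<Sum>x\<in>window a b. real (m x) * ln (1 + x)) + ?L b"
        using that finite_window by (simp add: sum.union_disjoint disjoint_iff)
      then show ?thesis using window_ln_small[of a b] d(2) d(3)[of b] that by auto
    qed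
    then show "\<exists>d>0. \<forall>a b. 0 < a \<and> a < b \<and> b < d \<longrightarrow> \<bar>?L a - ?L b\<bar> < e"
      using d(1) by (intro exI[of _ d]) simp
  qed
  then obtain l where l: "(?L \<longlongrightarrow> l) (at_right 0)" by (rule exE)
  have "((\<lambda>\<epsilon>. exp (?L \<epsilon>) * ?P) \<longlongrightarrow> exp l * ?P) (at_right 0)" by (intro tendsto_intros l)
  moreover have "exp (?L \<epsilon>) * ?P = (\<Prod>x | x \<in> A \<and> \<bar>x\<bar> \<ge> \<epsilon>. (1 + x) ^ m x)" if "0 < \<epsilon>" "\<epsilon> < s\<^sub>0" for \<epsilon>
  proof -
    have "exp (?L \<epsilon>) = (\<Prod>x\<in>window \<epsilon> s\<^sub>0. exp (real (m x) * ln (1 + x)))"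
      using finite_window[OF that(1)] by (rule exp_sum)
    also have "\<dots> = (\<Prod>x\<in>window \<epsilon> s\<^sub>0. (1 + x) ^ m x)"
    proof (rule prod.cong)
      fix x assume "x \<in> window \<epsilon> s\<^sub>0"
      then have "1 + x > 0" using s0 by auto
      then show "exp (real (m x) * ln (1 + x)) = (1 + x) ^ m x"
        by (simp add: exp_of_nat_mult)
    qed simp
    finally show ?thesis using prod_window_split[of \<epsilon> s\<^sub>0 "\<lambda>x. (1 + x) ^ m x"] that by simp
  qed
  then have "\<forall>\<^sub>F \<epsilon> in at_right 0. exp (?L \<epsilon>) * ?P = (\<Prod>x | x \<in> A \<and> \<bar>x\<bar> \<ge> \<epsilon>. (1 + x) ^ m x)"
    unfolding eventually_at_right_field using s0 by (intro exI[of _ s\<^sub>0]) simp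
  ultimately have "((\<lambda>\<epsilon>. \<Prod>x | x \<in> A \<and> \<bar>x\<bar> \<ge> \<epsilon>. (1 + x) ^ m x) \<longlongrightarrow> exp l * ?P) (at_right 0)"
    by (rule Lim_transform_eventually)
  then show ?thesis by (rule exI)
qed

end

section \<open>Compact symmetric operators\<close>

text \<open>Cauchy-Schwarz for forms that are only semidefinite, read off from the discriminant; for
  \<open>d = 0\<close> a nonzero \<open>b\<close> would make the affine function of \<open>t\<close>
  negative somewhere.\<close>

lemma quadratic_nonneg_discriminant:
  fixes a b d :: real
  assumes "\<And>t. 0 \<le> a + 2 * t * b + t\<^sup>2 * d" "d \<ge> 0"
  shows "b\<^sup>2 \<le> a * d"
proof (cases "d = 0")
  case True
  have "b = 0"
  proof (rule ccontr)
    assume "b \<noteq> 0"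
    have "0 \<le> a + 2 * (- (a + 1) / (2 * b)) * b" using assms(1)[of "- (a + 1) / (2 * b)"] True by simp
    then show False using \<open>b \<noteq> 0\<close> by (simp add: field_simps)
  qed
  then show ?thesis using True by simp
next
  case False
  then have "d > 0" using assms by simp
  have "0 \<le> a + 2 * (- b / d) * b + (- b / d)\<^sup>2 * d" by (rule assms)
  also have "\<dots> = a - b\<^sup>2 / d" using \<open>d > 0\<close> by (simp add: field_simps power2_eq_square)
  finally show ?thesis using \<open>d > 0\<close> by (simp add: field_simps)
qed

text \<open>Gaussian elimination with pivot \<open>b\<close>: \<open>T\<close> projects onto the
  kernel of \<open>f\<close> along \<open>b\<close> and is injective on the span of the remaining
  vectors, so a linear condition costs at most one vector.\<close>

lemma independent_in_kernel_one:
  fixes f :: "'h::real_vector \<Rightarrow> real"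
  assumes "linear f" "independent B" "finite B"
  shows "\<exists>B'\<subseteq>span B. independent B' \<and> finite B' \<and> card B \<le> card B' + 1 \<and> (\<forall>b\<in>B'. f b = 0)"
proof (cases "\<forall>b\<in>B. f b = 0")
  case True
  then show ?thesis using assms span_superset by (intro exI[of _ B]) auto
next
  case False
  then obtain b where b: "b \<in> B" "f b \<noteq> 0" by blast
  define T where "T x = x - (f x / f b) *\<^sub>R b" for x
  interpret f: linear f by fact
  have T: "linear T"
    by (rule linearI) (simp_all add: T_def f.add f.scaleR algebra_simps add_divide_distrib)
  have ind: "independent (B - {b})" using assms(2) independent_mono by blast
  have inj: "inj_on T (span (B - {b}))"
  proof (rule linear_inj_on_iff_eq_0[THEN iffD2, OF T subspace_span], intro ballI impI)
    fix x assume x: "x \<in> span (B - {b})" "T x = 0"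
    then have x': "x = (f x / f b) *\<^sub>R b" by (simp add: T_def)
    show "x = 0"
    proof (rule ccontr)
      assume "x \<noteq> 0"
      then have nz: "f x / f b \<noteq> 0" using x' by auto
      have "b = inverse (f x / f b) *\<^sub>R x" by (subst x') (use nz in auto)
      then have "b \<in> span (B - {b})" using x(1) by (metis span_scale)
      then show False using assms(2) b(1) dependent_def by blast
    qed
  qed
  show ?thesis
  proof (intro exI[of _ "T ` (B - {b})"] conjI)
    have "T x \<in> span B" if "x \<in> B" for x
      unfolding T_def using that b by (intro span_diff span_scale span_base)
    then show "T ` (B - {b}) \<subseteq> span B" by blast
    show "independent (T ` (B - {b}))" by (rule linear_independent_injective_image[OF T ind inj])
    show "finite (T ` (B - {b}))" using assms by simp
    have "card (T ` (B - {b})) = card (B - {b})"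
      using inj inj_on_subset span_superset by (blast intro: card_image)
    then show "card B \<le> card (T ` (B - {b})) + 1" using b assms by (simp add: card_Diff_singleton_if)
    show "\<forall>b\<in>T ` (B - {b}). f b = 0"
      using b by (auto simp: T_def f.diff f.scaleR)
  qed
qed

lemma independent_in_kernel:
  fixes f :: "'i \<Rightarrow> 'h::real_vector \<Rightarrow> real"
  assumes "finite I" "\<And>i. i \<in> I \<Longrightarrow> linear (f i)" "independent B" "finite B"
  shows "\<exists>B'\<subseteq>span B. independent B' \<and> finite B' \<and> card B \<le> card B' + card I \<and>
    (\<forall>v\<in>span B'. \<forall>i\<in>I. f i v = 0)"
proof -
  have "\<exists>B'\<subseteq>span B. independent B' \<and> finite B' \<and> card B \<le> card B' + card I \<and>
    (\<forall>v\<in>span B'. \<forall>i\<in>I. f i v = 0)"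
    using assms(1,2)
  proof (induction I rule: finite_induct)
    case empty
    then show ?case using assms(3,4) span_superset by (intro exI[of _ B]) auto
  next
    case (insert j I)
    then obtain B' where B': "B' \<subseteq> span B" "independent B'" "finite B'" "card B \<le> card B' + card I"
      "\<forall>v\<in>span B'. \<forall>i\<in>I. f i v = 0" by auto
    have "linear (f j)" using insert by simp
    then obtain B'' where B'': "B'' \<subseteq> span B'" "independent B''" "finite B''" "card B' \<le> card B'' + 1"
      "\<forall>b\<in>B''. f j b = 0" using independent_in_kernel_one[of "f j" B'] B' by blast
    have s: "span B'' \<subseteq> span B'" "span B' \<subseteq> span B"
      using B''(1) B'(1) by (simp_all add: span_minimal)
    have "f j v = 0" if "v \<in> span B''" for v
      using linear_eq_0_on_span[OF \<open>linear (f j)\<close> _ that] B''(5) by blast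
    then show ?case using B' B'' s insert by (intro exI[of _ B'']) auto
  qed
  then show ?thesis .
qed

lemma independent_Un:
  fixes A B :: "'h::real_vector set"
  assumes A: "independent A" and B: "independent B" and I: "span A \<inter> span B \<subseteq> {0}"
  shows "independent (A \<union> B)"
proof
  assume "dependent (A \<union> B)"
  then obtain t u v where t: "finite t" "t \<subseteq> A \<union> B" "(\<Sum>v\<in>t. u v *\<^sub>R v) = 0" "v \<in> t" "u v \<noteq> 0"
    unfolding dependent_explicit by blast
  let ?x = "\<Sum>v\<in>t \<inter> A. u v *\<^sub>R v" and ?y = "\<Sum>v\<in>t - A. u v *\<^sub>R v"
  have xy: "?x + ?y = 0" using sum.Int_Diff[OF t(1), of "\<lambda>v. u v *\<^sub>R v" A] t(3) by simp
  have x: "?x \<in> span A" by (intro span_sum span_scale span_base) auto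
  have y: "?y \<in> span B" using t(2) by (intro span_sum span_scale span_base) auto
  have "?x = - ?y" using xy by (simp add: eq_neg_iff_add_eq_0)
  then have "?x \<in> span B" using y span_neg by metis
  then have "?x = 0" using x I by blast
  moreover from this have "?y = 0" using xy by simp
  moreover have "u v = 0" if "?x = 0" "v \<in> t \<inter> A" for v
    using independentD[OF A _ _ that(1) that(2)] t(1) by blast
  moreover have "u v = 0" if "?y = 0" "v \<in> t - A" for v
    using independentD[OF B _ _ that(1) that(2)] t(1,2) by blast
  ultimately show False using t(4,5) by blast
qed

text \<open>Two norms are in play: compactness of \<open>K\<close> refers to the ambient norm,
  symmetry to the form \<open>g\<close>. The two bounds make them equivalent, and closedness of
  \<open>V\<close> keeps limits inside.\<close>

locale compact_symmetric =
  fixes V :: "'h::real_normed_vector set" and g :: "'h \<Rightarrow> 'h \<Rightarrow> real" and K :: "'h \<Rightarrow> 'h"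
    and c C :: real
  assumes subV: "subspace V" and closedV: "closed V"
    and g: "bounded_bilinear g" and g_sym: "\<And>v w. g v w = g w v"
    and c0: "c > 0" and g_lower: "\<And>v. c * (norm v)\<^sup>2 \<le> g v v"
    and C0: "C > 0" and g_upper: "\<And>v w. \<bar>g v w\<bar> \<le> C * norm v * norm w"
    and K: "compact_operator_on V K"
    and K_sym: "\<And>v w. v \<in> V \<Longrightarrow> w \<in> V \<Longrightarrow> g (K v) w = g v (K w)"
begin

sublocale g: bounded_bilinear g by (fact g)

lemma KV: "v \<in> V \<Longrightarrow> K v \<in> V"
  and K_add: "v \<in> V \<Longrightarrow> w \<in> V \<Longrightarrow> K (v + w) = K v + K w"
  and K_scale: "v \<in> V \<Longrightarrow> K (r *\<^sub>R v) = r *\<^sub>R K v"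
  using K unfolding compact_operator_on_def linear_operator_on_def by auto

lemma K_zero: "K 0 = 0"
  using K_scale[of 0 0] subspace_0[OF subV] by simp

lemma K_diff: "v \<in> V \<Longrightarrow> w \<in> V \<Longrightarrow> K (v - w) = K v - K w"
  using K_add[of v "- w"] K_scale[of w "-1"] subspace_neg[OF subV, of w] by simp

lemma K_sum: "finite F \<Longrightarrow> (\<And>i. i \<in> F \<Longrightarrow> x i \<in> V) \<Longrightarrow> K (\<Sum>i\<in>F. x i) = (\<Sum>i\<in>F. K (x i))"
  by (induction F rule: finite_induct) (simp_all add: K_zero K_add subspace_sum[OF subV])

lemma g_zero_iff: "g v v = 0 \<longleftrightarrow> v = 0"
proof
  assume "g v v = 0"
  then have "c * (norm v)\<^sup>2 \<le> 0" using g_lower[of v] by simp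
  then show "v = 0" using c0 by (simp add: mult_le_0_iff)
qed (simp add: g.zero_left)

lemma g_nonneg: "0 \<le> g v v"
  using g_lower[of v] c0 by (meson mult_nonneg_nonneg less_imp_le order_trans zero_le_power2)

lemma g_self_upper: "g v v \<le> C * (norm v)\<^sup>2"
  using g_upper[of v v] by (simp add: power2_eq_square)

lemma K_bounded: obtains B where "B > 0" "\<And>v. v \<in> V \<Longrightarrow> norm (K v) \<le> B * norm v"
proof -
  have "bounded (K ` (V \<inter> cball 0 1))"
    using K unfolding compact_operator_on_def
    by (meson bounded_closure bounded_subset closure_subset compact_imp_bounded)
  then obtain B where B: "B > 0" "\<And>v. v \<in> V \<Longrightarrow> norm v \<le> 1 \<Longrightarrow> norm (K v) \<le> B"
    unfolding bounded_pos by auto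
  have "norm (K v) \<le> B * norm v" if v: "v \<in> V" for v
  proof (cases "v = 0")
    case True
    then show ?thesis by (simp add: K_zero)
  next
    case False
    have "norm (K ((1 / norm v) *\<^sub>R v)) \<le> B"
      using v False by (intro B subspace_scale[OF subV]) auto
    then show ?thesis using False v by (simp add: K_scale field_simps)
  qed
  then show ?thesis using that B(1) by blast
qed

lemma K_convergent_subsequence:
  assumes x: "\<And>n. x n \<in> V" "\<And>n. norm (x n) \<le> B"
  obtains l r where "l \<in> V" "strict_mono (r :: nat \<Rightarrow> nat)" "(\<lambda>n. K (x (r n))) \<longlonglongrightarrow> l"
proof -
  \<comment> \<open>The maximum with 1 prevents the rescaling from dividing by zero.\<close>
  let ?R = "max B 1"
  have y: "K ((1 / ?R) *\<^sub>R x n) \<in> closure (K ` (V \<inter> cball 0 1))" for n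
  proof -
    have "norm (x n) \<le> ?R" using x(2)[of n] by linarith
    then have "(1 / ?R) *\<^sub>R x n \<in> V \<inter> cball 0 1"
      using x subspace_scale[OF subV] by (auto simp: field_simps)
    then show ?thesis by (intro subsetD[OF closure_subset] imageI)
  qed
  have "compact (closure (K ` (V \<inter> cball 0 1)))" using K unfolding compact_operator_on_def by blast
  then obtain l r where l: "strict_mono (r :: nat \<Rightarrow> nat)" "((\<lambda>n. K ((1 / ?R) *\<^sub>R x n)) \<circ> r) \<longlonglongrightarrow> l"
    using y unfolding compact_def by (metis (no_types, lifting))
  have "(\<lambda>n. ?R *\<^sub>R K ((1 / ?R) *\<^sub>R x (r n))) \<longlonglongrightarrow> ?R *\<^sub>R l"
    using l(2) by (intro tendsto_intros) (simp add: o_def)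
  moreover have "?R *\<^sub>R K ((1 / ?R) *\<^sub>R x (r n)) = K (x (r n))" for n
  proof -
    have "?R \<noteq> 0" by linarith
    then show ?thesis using x(1) by (simp add: K_scale)
  qed
  ultimately have lim: "(\<lambda>n. K (x (r n))) \<longlonglongrightarrow> ?R *\<^sub>R l" by simp
  then have "?R *\<^sub>R l \<in> V"
    by (rule closed_sequentially[OF closedV, rotated]) (use x KV in auto)
  then show ?thesis using that l(1) lim by blast
qed

lemma K_tendsto:
  assumes "\<And>n. x n \<in> V" "l \<in> V" "x \<longlonglongrightarrow> l"
  shows "(\<lambda>n. K (x n)) \<longlonglongrightarrow> K l"
proof -
  obtain B where B: "B > 0" "\<And>v. v \<in> V \<Longrightarrow> norm (K v) \<le> B * norm v" using K_bounded by blast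
  have "(\<lambda>n. K (x n) - K l) \<longlonglongrightarrow> 0"
  proof (rule Lim_null_comparison)
    have "norm (K (x n) - K l) \<le> B * norm (x n - l)" for n
      using B(2)[of "x n - l"] K_diff[of "x n" l] assms subspace_diff[OF subV] by auto
    then show "\<forall>\<^sub>F n in sequentially. norm (K (x n) - K l) \<le> B * norm (x n - l)" by simp
    show "(\<lambda>n. B * norm (x n - l)) \<longlonglongrightarrow> 0"
      using assms(3) by (intro tendsto_mult_right_zero tendsto_norm_zero) (simp add: LIM_zero)
  qed
  then show ?thesis by (rule LIM_zero_cancel)
qed

text \<open>Compactness makes a subsequence of \<open>K (x n)\<close> converge; since
  \<open>\<mu>\<close> is nonzero, the vectors themselves then converge. The limit thus comes from
  \<open>K\<close> rather than from completeness.\<close>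

lemma approximate_eigenvector:
  assumes U: "U \<subseteq> V" "closed U" "subspace U" and x: "\<And>n. x n \<in> U" "\<And>n. norm (x n) = 1"
    and lim: "(\<lambda>n. K (x n) - \<mu> *\<^sub>R x n) \<longlonglongrightarrow> 0" and \<mu>: "\<mu> \<noteq> 0"
  shows "\<exists>v\<in>U. v \<noteq> 0 \<and> K v = \<mu> *\<^sub>R v"
proof -
  have xV: "x n \<in> V" for n using x U by blast
  obtain l r where l: "l \<in> V" "strict_mono (r :: nat \<Rightarrow> nat)" "(\<lambda>n. K (x (r n))) \<longlonglongrightarrow> l"
    using K_convergent_subsequence[of x 1] x xV by auto
  have "(\<lambda>n. K (x (r n)) - \<mu> *\<^sub>R x (r n)) \<longlonglongrightarrow> 0"
    using LIMSEQ_subseq_LIMSEQ[OF lim l(2)] by (simp add: o_def)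
  from tendsto_diff[OF l(3) this] have "(\<lambda>n. \<mu> *\<^sub>R x (r n)) \<longlonglongrightarrow> l" by simp
  then have "(\<lambda>n. inverse \<mu> *\<^sub>R (\<mu> *\<^sub>R x (r n))) \<longlonglongrightarrow> inverse \<mu> *\<^sub>R l" by (intro tendsto_intros)
  then have v: "(\<lambda>n. x (r n)) \<longlonglongrightarrow> inverse \<mu> *\<^sub>R l" using \<mu> by simp
  let ?v = "inverse \<mu> *\<^sub>R l"
  have vU: "?v \<in> U" by (rule closed_sequentially[OF U(2) _ v]) (use x in auto)
  have "(\<lambda>n. norm (x (r n))) \<longlonglongrightarrow> norm ?v" by (intro tendsto_intros v)
  then have "norm ?v = 1" using x(2) by (simp add: LIMSEQ_const_iff)
  moreover have "(\<lambda>n. K (x (r n))) \<longlonglongrightarrow> K ?v" using vU U xV v by (intro K_tendsto) auto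
  then have "K ?v = l" using l(3) LIMSEQ_unique by blast
  ultimately show ?thesis using vU \<mu> by (intro bexI[of _ ?v]) auto
qed

text \<open>The supremum \<open>\<mu>\<close> of the Rayleigh quotient over the invariant subspace
  \<open>U\<close> is an eigenvalue: a normalized maximizing sequence consists of approximate
  eigenvectors, because the form \<open>a\<close> is semidefinite on \<open>U\<close> and tends to 0
  along it.\<close>

lemma exists_eigenvector:
  assumes U: "U \<subseteq> V" "closed U" "subspace U" and KU: "\<And>v. v \<in> U \<Longrightarrow> K v \<in> U"
    and \<epsilon>: "\<epsilon> > 0" and w: "w \<in> U" "w \<noteq> 0" "g (K w) w \<ge> \<epsilon> * g w w"
  shows "\<exists>v\<in>U. \<exists>\<mu>\<ge>\<epsilon>. v \<noteq> 0 \<and> K v = \<mu> *\<^sub>R v"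
proof -
  obtain B where B: "B > 0" "\<And>v. v \<in> V \<Longrightarrow> norm (K v) \<le> B * norm v" using K_bounded by blast
  have q_upper: "\<bar>g (K v) v\<bar> \<le> C * B * (norm v)\<^sup>2" if "v \<in> U" for v
  proof -
    have "\<bar>g (K v) v\<bar> \<le> C * norm (K v) * norm v" by (rule g_upper)
    also have "\<dots> \<le> C * (B * norm v) * norm v"
      using B(2)[of v] that U C0 by (intro mult_right_mono mult_left_mono) auto
    finally show ?thesis by (simp add: power2_eq_square mult_ac)
  qed
  define Q where "Q = (\<lambda>v. g (K v) v / g v v) ` {v \<in> U. v \<noteq> 0}"
  have gpos: "g v v > 0" if "v \<noteq> 0" for v using that g_nonneg[of v] g_zero_iff[of v] by linarith
  have bdd: "bdd_above Q"
  proof (rule bdd_aboveI)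
    fix r assume "r \<in> Q"
    then obtain v where v: "v \<in> U" "v \<noteq> 0" "r = g (K v) v / g v v" by (auto simp: Q_def)
    have "g (K v) v \<le> C * B * (norm v)\<^sup>2" using q_upper[OF v(1)] by simp
    also have "\<dots> \<le> C * B * (g v v / c)"
      using g_lower[of v] c0 C0 B by (intro mult_left_mono) (auto simp: field_simps)
    finally have "g (K v) v \<le> (C * B / c) * g v v" by simp
    then show "r \<le> C * B / c" unfolding v(3) using gpos[OF v(2)] by (simp only: pos_divide_le_eq)
  qed
  have nonempty: "Q \<noteq> {}" using w by (auto simp: Q_def)
  define \<mu> where "\<mu> = Sup Q"
  have "\<epsilon> \<le> g (K w) w / g w w" using w gpos by (simp add: field_simps)
  also have "\<dots> \<le> \<mu>" unfolding \<mu>_def using w by (intro cSup_upper bdd) (auto simp: Q_def)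
  finally have \<mu>: "\<mu> \<ge> \<epsilon>" .
  define a where "a v w = \<mu> * g v w - g (K v) w" for v w
  have a_nonneg: "0 \<le> a v v" if "v \<in> U" for v
  proof (cases "v = 0")
    case False
    have "g (K v) v / g v v \<le> \<mu>" unfolding \<mu>_def using False that by (intro cSup_upper bdd) (auto simp: Q_def)
    then show ?thesis using gpos[OF False] by (simp add: a_def field_simps)
  qed (simp add: a_def K_zero g.zero_left)
  have a_CS: "(a v w)\<^sup>2 \<le> a v v * a w w" if vw: "v \<in> U" "w \<in> U" for v w
  proof (rule quadratic_nonneg_discriminant)
    fix t :: real
    have "v + t *\<^sub>R w \<in> U" using vw U(3) by (simp add: subspace_add subspace_scale)
    then have "0 \<le> a (v + t *\<^sub>R w) (v + t *\<^sub>R w)" by (rule a_nonneg)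
    also have "\<dots> = a v v + 2 * t * a v w + t\<^sup>2 * a w w"
    proof -
      have V: "v \<in> V" "w \<in> V" using vw U by auto
      then have "g (K w) v = g (K v) w" using K_sym[of v w] g_sym[of "K w" v] by simp
      moreover have "t *\<^sub>R w \<in> V" using V subspace_scale[OF subV] by auto
      moreover note V
      ultimately show ?thesis using g_sym[of w v]
        by (simp add: a_def K_add K_scale g.add_left g.add_right g.scaleR_left g.scaleR_right
            power2_eq_square algebra_simps)
    qed
    finally show "0 \<le> a v v + 2 * t * a v w + t\<^sup>2 * a w w" .
  qed (use a_nonneg vw in auto)
  have "\<exists>v\<in>U. v \<noteq> 0 \<and> g (K v) v / g v v > \<mu> - 1 / real (Suc n)" for n
  proof -
    have "\<exists>r\<in>Q. \<mu> - 1 / real (Suc n) < r"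
      using less_cSup_iff[OF nonempty bdd, of "\<mu> - 1 / real (Suc n)"] by (simp add: \<mu>_def)
    then show ?thesis by (auto simp: Q_def)
  qed
  then obtain y where y: "\<And>n. y n \<in> U" "\<And>n. y n \<noteq> 0"
    "\<And>n. g (K (y n)) (y n) / g (y n) (y n) > \<mu> - 1 / real (Suc n)" by metis
  define x where "x n = (1 / norm (y n)) *\<^sub>R y n" for n
  have x: "x n \<in> U" "norm (x n) = 1" for n
    using y(1,2) subspace_scale[OF U(3)] by (simp_all add: x_def)
  have ax: "a (x n) (x n) \<le> C / real (Suc n)" for n
  proof -
    have "g (K (x n)) (x n) = (1 / norm (y n))\<^sup>2 * g (K (y n)) (y n)"
      "g (x n) (x n) = (1 / norm (y n))\<^sup>2 * g (y n) (y n)"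
      using y(1)[of n] U unfolding x_def
      by (auto simp: K_scale[of "y n"] subset_eq g.scaleR_left g.scaleR_right power2_eq_square)
    then have "g (K (x n)) (x n) / g (x n) (x n) = g (K (y n)) (y n) / g (y n) (y n)"
      using y(2)[of n] by simp
    then have "\<mu> - 1 / real (Suc n) < g (K (x n)) (x n) / g (x n) (x n)" using y(3)[of n] by simp
    moreover have gx: "g (x n) (x n) > 0" using x(2)[of n] by (intro gpos) auto
    ultimately have "(\<mu> - 1 / real (Suc n)) * g (x n) (x n) < g (K (x n)) (x n)"
      by (simp add: pos_less_divide_eq)
    then have "a (x n) (x n) \<le> (1 / real (Suc n)) * g (x n) (x n)" by (simp add: a_def algebra_simps)
    also have "\<dots> \<le> (1 / real (Suc n)) * C"
      using g_self_upper[of "x n"] x(2)[of n] by (intro mult_left_mono) auto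
    finally show ?thesis by simp
  qed
  \<comment> \<open>For this test vector \<open>a (x n) (?w n)\<close> equals
    \<open>g (?w n) (?w n)\<close>. Since \<open>?M\<close> bounds \<open>a\<close> against
    \<open>g\<close>, Cauchy-Schwarz for \<open>a\<close> bounds \<open>g (?w n) (?w n)\<close> by
    \<open>?M\<close> times \<open>a (x n) (x n)\<close>.\<close>
  let ?w = "\<lambda>n. \<mu> *\<^sub>R x n - K (x n)"
  let ?M = "(\<mu> * C + C * B) / c"
  have wU: "?w n \<in> U" for n using x U KU by (simp add: subspace_diff subspace_scale)
  have bound: "c * (norm (?w n))\<^sup>2 \<le> ?M * C / real (Suc n)" for n
  proof -
    let ?g = "g (?w n) (?w n)"
    have "a (x n) (?w n) = ?g" by (simp add: a_def g.diff_left g.scaleR_left)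
    then have 1: "?g\<^sup>2 \<le> a (x n) (x n) * a (?w n) (?w n)" using a_CS[OF x(1) wU] by metis
    have "a (?w n) (?w n) \<le> \<mu> * (C * (norm (?w n))\<^sup>2) + C * B * (norm (?w n))\<^sup>2"
      using q_upper[OF wU[of n]] mult_left_mono[OF g_self_upper[of "?w n"], of \<mu>] \<mu> \<epsilon> unfolding a_def by linarith
    also have "\<dots> = (\<mu> * C + C * B) * (norm (?w n))\<^sup>2" by (simp add: algebra_simps)
    also have "\<dots> \<le> (\<mu> * C + C * B) * (?g / c)"
      using g_lower[of "?w n"] c0 C0 B \<mu> \<epsilon> by (intro mult_left_mono) (auto simp: field_simps)
    finally have "a (?w n) (?w n) \<le> ?M * ?g" by simp
    then have "?g\<^sup>2 \<le> (C / real (Suc n)) * (?M * ?g)"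
      using 1 ax[of n] a_nonneg[OF wU[of n]] a_nonneg[OF x(1)[of n]] C0
      by (meson mult_mono order_trans divide_nonneg_nonneg less_imp_le of_nat_0_le_iff)
    then have "?g * ?g \<le> (?M * C / real (Suc n)) * ?g" by (simp add: power2_eq_square mult_ac)
    then have "?g \<le> ?M * C / real (Suc n)"
    proof (cases "?g = 0")
      case True
      then show ?thesis using c0 C0 B \<mu> \<epsilon> by simp
    next
      case False
      then have "?g > 0" using g_nonneg[of "?w n"] by linarith
      then show ?thesis using mult_right_le_imp_le[OF \<open>?g * ?g \<le> _\<close>] by simp
    qed
    then show ?thesis using g_lower[of "?w n"] by linarith
  qed
  have "(\<lambda>n. (norm (?w n))\<^sup>2) \<longlonglongrightarrow> 0"
  proof (rule Lim_null_comparison)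
    have "norm ((norm (?w n))\<^sup>2) \<le> (?M * C / c) * (1 / real (Suc n))" for n
    proof -
      have "(norm (?w n))\<^sup>2 \<le> ?M * C / real (Suc n) / c"
        using bound[of n] c0 by (simp only: pos_le_divide_eq mult.commute)
      then show ?thesis by (simp add: divide_divide_eq_left mult_ac)
    qed
    then show "\<forall>\<^sub>F n in sequentially. norm ((norm (?w n))\<^sup>2) \<le> (?M * C / c) * (1 / real (Suc n))" by simp
    show "(\<lambda>n. (?M * C / c) * (1 / real (Suc n))) \<longlonglongrightarrow> 0"
      using LIMSEQ_Suc[OF lim_1_over_n] by (intro tendsto_mult_right_zero) simp
  qed
  then have "(\<lambda>n. sqrt ((norm (?w n))\<^sup>2)) \<longlonglongrightarrow> sqrt 0" by (intro tendsto_intros)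
  then have "(\<lambda>n. norm (?w n)) \<longlonglongrightarrow> 0" by simp
  then have "(\<lambda>n. norm (K (x n) - \<mu> *\<^sub>R x n)) \<longlonglongrightarrow> 0" by (simp add: norm_minus_commute)
  then have "(\<lambda>n. K (x n) - \<mu> *\<^sub>R x n) \<longlonglongrightarrow> 0" by (rule tendsto_norm_zero_cancel)
  then show ?thesis using approximate_eigenvector[OF U x] \<mu> \<epsilon> by fastforce
qed

text \<open>Otherwise there would be unit vectors on which the shifted operator tends to 0, and
  compactness would turn them into an eigenvector.\<close>

lemma shifted_bounded_below:
  assumes \<alpha>: "\<alpha> \<noteq> 0" and inj: "\<And>v. v \<in> V \<Longrightarrow> K v = \<alpha> *\<^sub>R v \<Longrightarrow> v = 0"
  obtains d where "d > 0" "\<And>v. v \<in> V \<Longrightarrow> d * norm v \<le> norm (K v - \<alpha> *\<^sub>R v)"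
proof (rule ccontr)
  assume "\<not> thesis"
  then have "\<exists>v\<in>V. \<not> (1 / real (Suc n)) * norm v \<le> norm (K v - \<alpha> *\<^sub>R v)" for n
    using that[of "1 / real (Suc n)"] by fastforce
  then obtain y where y: "\<And>n. y n \<in> V"
    "\<And>n. norm (K (y n) - \<alpha> *\<^sub>R y n) < (1 / real (Suc n)) * norm (y n)"
    by (metis not_le)
  have nz: "y n \<noteq> 0" for n using y(2)[of n] by auto
  define x where "x n = (1 / norm (y n)) *\<^sub>R y n" for n
  have x: "x n \<in> V" "norm (x n) = 1" for n
    using y(1) nz subspace_scale[OF subV] by (simp_all add: x_def)
  have b: "norm (K (x n) - \<alpha> *\<^sub>R x n) \<le> 1 / real (Suc n)" for n
  proof -
    have "K (x n) - \<alpha> *\<^sub>R x n = (1 / norm (y n)) *\<^sub>R (K (y n) - \<alpha> *\<^sub>R y n)"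
      using K_scale[OF y(1)[of n], of "1 / norm (y n)"] by (simp add: x_def scaleR_diff_right)
    then have "norm (K (x n) - \<alpha> *\<^sub>R x n) = norm (K (y n) - \<alpha> *\<^sub>R y n) / norm (y n)" by simp
    then show ?thesis using y(2)[of n] nz[of n] by (simp add: pos_divide_le_eq)
  qed
  have "(\<lambda>n. K (x n) - \<alpha> *\<^sub>R x n) \<longlonglongrightarrow> 0"
  proof (rule Lim_null_comparison)
    show "\<forall>\<^sub>F n in sequentially. norm (K (x n) - \<alpha> *\<^sub>R x n) \<le> 1 / real (Suc n)" using b by simp
    show "(\<lambda>n. 1 / real (Suc n)) \<longlonglongrightarrow> 0" using LIMSEQ_Suc[OF lim_1_over_n] by simp
  qed
  then have "\<exists>v\<in>V. v \<noteq> 0 \<and> K v = \<alpha> *\<^sub>R v"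
    by (intro approximate_eigenvector[where x = x] closedV subV x \<alpha>) auto
  then show False using inj by blast
qed

text \<open>\<open>V\<close> need not be complete. The equation \<open>(K - \<alpha>)\<^sup>2 x = y\<close> is solved approximately by Richardson
  iteration; compactness of \<open>K\<close> provides the limit.\<close>

lemma shifted_surjective:
  assumes \<alpha>: "\<alpha> \<noteq> 0" and inj: "\<And>v. v \<in> V \<Longrightarrow> K v = \<alpha> *\<^sub>R v \<Longrightarrow> v = 0" and y: "y \<in> V"
  shows "\<exists>z\<in>V. K z - \<alpha> *\<^sub>R z = y"
proof -
  obtain d where d: "d > 0" "\<And>v. v \<in> V \<Longrightarrow> d * norm v \<le> norm (K v - \<alpha> *\<^sub>R v)"
    using shifted_bounded_below[OF \<alpha> inj] by blast
  obtain B where B: "B > 0" "\<And>v. v \<in> V \<Longrightarrow> norm (K v) \<le> B * norm v" using K_bounded by blast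
  define D where "D v = K v - \<alpha> *\<^sub>R v" for v
  define b where "b = B + \<bar>\<alpha>\<bar>"
  have b0: "b > 0" using B by (simp add: b_def)
  have DV: "D v \<in> V" if "v \<in> V" for v
    using that subV by (simp add: D_def KV subspace_diff subspace_scale)
  have D_add: "D (v + w) = D v + D w" if "v \<in> V" "w \<in> V" for v w
    using that by (simp add: D_def K_add algebra_simps)
  have D_scale: "D (r *\<^sub>R v) = r *\<^sub>R D v" if "v \<in> V" for r v
    using that by (simp add: D_def K_scale algebra_simps)
  have D_sym: "g (D v) w = g v (D w)" if "v \<in> V" "w \<in> V" for v w
    using that by (simp add: D_def K_sym g.diff_left g.diff_right g.scaleR_left g.scaleR_right)
  have D_le: "norm (D v) \<le> b * norm v" if "v \<in> V" for v
    using norm_triangle_ineq4[of "K v" "\<alpha> *\<^sub>R v"] B(2)[OF that] by (simp add: D_def b_def algebra_simps)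
  have D_ge: "d * norm v \<le> norm (D v)" if "v \<in> V" for v using d(2)[OF that] by (simp add: D_def)
  \<comment> \<open>With respect to \<open>g\<close>, the operator \<open>D \<circ> D\<close> is
    bounded below by \<open>\<tau>\<close>, and \<open>M\<close> bounds its square. The summand
    \<open>\<tau> ^ 2\<close> in \<open>M\<close> ensures that the contraction factor
    \<open>\<rho>\<close> is nonnegative.\<close>
  define \<tau> where "\<tau> = c * d\<^sup>2 / C"
  define M where "M = C * b ^ 4 / c + \<tau> ^ 2"
  have \<tau>0: "\<tau> > 0" and M0: "M > 0" using c0 C0 d b0 by (simp_all add: \<tau>_def M_def add_pos_nonneg)
  have low: "\<tau> * g v v \<le> g (D (D v)) v" if v: "v \<in> V" for v
  proof -
    have "\<tau> * g v v \<le> \<tau> * (C * (norm v)\<^sup>2)" using g_self_upper \<tau>0 by (intro mult_left_mono) auto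
    also have "\<dots> = c * (d * norm v)\<^sup>2" using C0 by (simp add: \<tau>_def power_mult_distrib)
    also have "\<dots> \<le> c * (norm (D v))\<^sup>2" using D_ge[OF v] c0 d by (intro mult_left_mono power_mono) auto
    also have "\<dots> \<le> g (D v) (D v)" by (rule g_lower)
    also have "\<dots> = g (D (D v)) v" using D_sym DV v by simp
    finally show ?thesis .
  qed
  have up: "g (D (D v)) (D (D v)) \<le> M * g v v" if v: "v \<in> V" for v
  proof -
    have "norm (D (D v)) \<le> b * (b * norm v)"
      using D_le[OF v] D_le[OF DV[OF v]] b0 by (meson mult_left_mono less_imp_le order_trans)
    then have "(norm (D (D v)))\<^sup>2 \<le> (b * (b * norm v))\<^sup>2" by (intro power_mono) auto
    then have "g (D (D v)) (D (D v)) \<le> C * (b * (b * norm v))\<^sup>2"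
      using g_self_upper[of "D (D v)"] C0 by (meson mult_left_mono less_imp_le order_trans)
    also have "\<dots> = C * b ^ 4 * (norm v)\<^sup>2" by (simp add: power_mult_distrib power4_eq_xxxx power2_eq_square)
    also have "\<dots> \<le> C * b ^ 4 * (g v v / c)"
      using g_lower[of v] c0 C0 by (intro mult_left_mono) (auto simp: field_simps)
    also have "\<dots> \<le> M * g v v" using g_nonneg[of v] by (simp add: M_def algebra_simps)
    finally show ?thesis .
  qed
  define \<rho> where "\<rho> = 1 - \<tau>\<^sup>2 / M"
  have \<rho>: "0 \<le> \<rho>" "\<rho> < 1"
  proof -
    have "\<tau>\<^sup>2 \<le> M" using C0 b0 c0 by (simp add: M_def)
    then show "0 \<le> \<rho>" using M0 by (simp add: \<rho>_def)
    show "\<rho> < 1" using \<tau>0 M0 by (simp add: \<rho>_def)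
  qed
  \<comment> \<open>The step size minimizing 1 - 2 \<omega> \<tau> + \<omega>^2 M; the minimal value
    is \<open>\<rho>\<close>.\<close>
  define \<omega> where "\<omega> = \<tau> / M"
  define r where "r n = ((\<lambda>v. v - \<omega> *\<^sub>R D (D v)) ^^ n) y" for n
  have r0: "r 0 = y" and rS: "r (Suc n) = r n - \<omega> *\<^sub>R D (D (r n))" for n by (simp_all add: r_def)
  have rV: "r n \<in> V" for n
    by (induction n) (auto simp: r0 rS y DV subspace_diff[OF subV] subspace_scale[OF subV])
  have contr: "g (r n) (r n) \<le> \<rho> ^ n * g y y" for n
  proof (induction n)
    case (Suc n)
    let ?v = "r n"
    have "g (r (Suc n)) (r (Suc n)) = g ?v ?v - 2 * \<omega> * g (D (D ?v)) ?v + \<omega>\<^sup>2 * g (D (D ?v)) (D (D ?v))"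
      using g_sym[of "D (D ?v)" ?v]
      by (simp add: rS g.diff_left g.diff_right g.scaleR_left g.scaleR_right power2_eq_square algebra_simps)
    also have "\<dots> \<le> g ?v ?v - 2 * \<omega> * (\<tau> * g ?v ?v) + \<omega>\<^sup>2 * (M * g ?v ?v)"
    proof -
      have "2 * \<omega> * (\<tau> * g ?v ?v) \<le> 2 * \<omega> * g (D (D ?v)) ?v"
        using \<tau>0 M0 by (intro mult_left_mono low rV) (simp add: \<omega>_def)
      moreover have "\<omega>\<^sup>2 * g (D (D ?v)) (D (D ?v)) \<le> \<omega>\<^sup>2 * (M * g ?v ?v)"
        by (intro mult_left_mono up rV) simp
      ultimately show ?thesis by linarith
    qed
    also have "\<dots> = \<rho> * g ?v ?v" using M0 by (simp add: \<omega>_def \<rho>_def power2_eq_square field_simps)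
    also have "\<dots> \<le> \<rho> * (\<rho> ^ n * g y y)" using Suc \<rho> by (intro mult_left_mono) auto
    finally show ?case by simp
  qed (simp add: r0)
  have r_lim: "r \<longlonglongrightarrow> 0"
  proof -
    have "(\<lambda>n. (norm (r n))\<^sup>2) \<longlonglongrightarrow> 0"
    proof (rule Lim_null_comparison)
      have "norm ((norm (r n))\<^sup>2) \<le> (g y y / c) * \<rho> ^ n" for n
        using contr[of n] g_lower[of "r n"] c0 by (simp add: field_simps)
      then show "\<forall>\<^sub>F n in sequentially. norm ((norm (r n))\<^sup>2) \<le> (g y y / c) * \<rho> ^ n" by simp
      show "(\<lambda>n. (g y y / c) * \<rho> ^ n) \<longlonglongrightarrow> 0"
        using \<rho> by (intro tendsto_mult_right_zero LIMSEQ_power_zero) auto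
    qed
    then have "(\<lambda>n. sqrt ((norm (r n))\<^sup>2)) \<longlonglongrightarrow> sqrt 0" by (intro tendsto_intros)
    then show ?thesis by (simp add: tendsto_norm_zero_iff)
  qed
  \<comment> \<open>What the iteration has already removed from \<open>y\<close> lies in the range
    of \<open>D \<circ> D\<close>: each step adds \<open>\<omega> *\<^sub>R r n\<close> to the
    preimage.\<close>
  have "\<exists>x\<in>V. D (D x) = y - r n" for n
  proof (induction n)
    case 0
    have "D (0 *\<^sub>R y) = 0 *\<^sub>R D y" by (rule D_scale[OF y])
    then show ?case using subspace_0[OF subV] by (intro bexI[of _ 0]) (auto simp: r0)
  next
    case (Suc n)
    then obtain x where x: "x \<in> V" "D (D x) = y - r n" by blast
    have "D (D (x + \<omega> *\<^sub>R r n)) = D (D x) + \<omega> *\<^sub>R D (D (r n))"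
      using x rV[of n] subV by (simp add: D_add D_scale DV subspace_scale)
    then show ?case
      using x rV[of n] subV by (intro bexI[of _ "x + \<omega> *\<^sub>R r n"]) (auto simp: rS subspace_add subspace_scale)
  qed
  then obtain x where x: "\<And>n. x n \<in> V" "\<And>n. D (D (x n)) = y - r n" by metis
  define z where "z n = D (x n)" for n
  have zV: "z n \<in> V" and Dz: "D (z n) = y - r n" for n using x DV by (auto simp: z_def)
  obtain R where R: "\<And>n. norm (r n) \<le> R"
    using Bseq_def convergent_imp_Bseq[of r] r_lim convergent_def by (metis less_imp_le)
  have "norm (z n) \<le> (norm y + R) / d" for n
    using D_ge[OF zV[of n]] norm_triangle_ineq4[of y "r n"] R[of n] d(1) by (simp add: Dz field_simps)
  then obtain l \<phi> where l: "l \<in> V" "strict_mono (\<phi> :: nat \<Rightarrow> nat)" "(\<lambda>n. K (z (\<phi> n))) \<longlonglongrightarrow> l"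
    using K_convergent_subsequence[of z] zV by metis
  have r\<phi>: "(\<lambda>n. r (\<phi> n)) \<longlonglongrightarrow> 0" using LIMSEQ_subseq_LIMSEQ[OF r_lim l(2)] by (simp add: o_def)
  \<comment> \<open>Solving the equation for \<open>z n\<close> leaves terms on the right that
    converge along a subsequence, because the \<open>z n\<close> are bounded and \<open>K\<close> is
    compact.\<close>
  have zeq: "z n = inverse \<alpha> *\<^sub>R (K (z n) - (y - r n))" for n
    using Dz[of n] \<alpha> by (simp add: D_def algebra_simps flip: Dz)
  let ?z = "inverse \<alpha> *\<^sub>R (l - (y - 0))"
  have "(\<lambda>n. inverse \<alpha> *\<^sub>R (K (z (\<phi> n)) - (y - r (\<phi> n)))) \<longlonglongrightarrow> ?z"
    by (intro tendsto_intros l r\<phi>)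
  then have zlim: "(\<lambda>n. z (\<phi> n)) \<longlonglongrightarrow> ?z" using zeq by simp
  have zV': "?z \<in> V" using l y subV by (simp add: subspace_diff subspace_scale)
  have "(\<lambda>n. K (z (\<phi> n)) - \<alpha> *\<^sub>R z (\<phi> n)) \<longlonglongrightarrow> K ?z - \<alpha> *\<^sub>R ?z"
    using zV zV' zlim by (intro tendsto_intros K_tendsto)
  moreover have "(\<lambda>n. y - r (\<phi> n)) \<longlonglongrightarrow> y - 0" by (intro tendsto_intros r\<phi>)
  ultimately have "K ?z - \<alpha> *\<^sub>R ?z = y" using Dz LIMSEQ_unique by (fastforce simp: D_def)
  then show ?thesis using zV' by blast
qed

text \<open>Fredholm alternative: without an eigenvector the shifted operator is bounded below and
  onto, so it has a bounded inverse on \<open>V\<close>.\<close>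

lemma spectrum_iff_eigenvalue:
  assumes \<alpha>: "\<alpha> \<noteq> 0"
  shows "\<alpha> \<in> spectrum_on V K \<longleftrightarrow> (\<exists>v\<in>V. v \<noteq> 0 \<and> K v = \<alpha> *\<^sub>R v)"
proof
  assume "\<exists>v\<in>V. v \<noteq> 0 \<and> K v = \<alpha> *\<^sub>R v"
  then obtain v where v: "v \<in> V" "v \<noteq> 0" "K v - \<alpha> *\<^sub>R v = 0" by auto
  show "\<alpha> \<in> spectrum_on V K"
    unfolding spectrum_on_def
  proof (safe)
    fix R assume R: "linear_operator_on V R" "\<forall>v\<in>V. R (K v - \<alpha> *\<^sub>R v) = v \<and> K (R v) - \<alpha> *\<^sub>R R v = v"
    have "R (0 *\<^sub>R v) = 0 *\<^sub>R R v" using R(1) v(1) unfolding linear_operator_on_def by blast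
    then have "R 0 = 0" by simp
    moreover have "R (K v - \<alpha> *\<^sub>R v) = v" using R(2) v(1) by blast
    ultimately show False using v(2,3) by simp
  qed
next
  assume spec: "\<alpha> \<in> spectrum_on V K"
  show "\<exists>v\<in>V. v \<noteq> 0 \<and> K v = \<alpha> *\<^sub>R v"
  proof (rule ccontr)
    assume "\<not> ?thesis"
    then have inj: "\<And>v. v \<in> V \<Longrightarrow> K v = \<alpha> *\<^sub>R v \<Longrightarrow> v = 0" by blast
    obtain d where d: "d > 0" "\<And>v. v \<in> V \<Longrightarrow> d * norm v \<le> norm (K v - \<alpha> *\<^sub>R v)"
      using shifted_bounded_below[OF \<alpha> inj] by blast
    have "\<forall>y. \<exists>z. y \<in> V \<longrightarrow> z \<in> V \<and> K z - \<alpha> *\<^sub>R z = y" using shifted_surjective[OF \<alpha> inj] by blast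
    then obtain R where R: "\<And>y. y \<in> V \<Longrightarrow> R y \<in> V \<and> K (R y) - \<alpha> *\<^sub>R R y = y" by metis
    have uniq: "v = w" if "v \<in> V" "w \<in> V" "K v - \<alpha> *\<^sub>R v = K w - \<alpha> *\<^sub>R w" for v w
    proof -
      have "K (v - w) = \<alpha> *\<^sub>R (v - w)" using that by (simp add: K_diff algebra_simps)
      then show ?thesis using inj[of "v - w"] that subspace_diff[OF subV] by auto
    qed
    have "linear_operator_on V R"
      unfolding linear_operator_on_def
    proof (intro conjI ballI allI)
      show "R ` V \<subseteq> V" using R by blast
    next
      fix v w assume vw: "v \<in> V" "w \<in> V"
      show "R (v + w) = R v + R w"
      proof (rule uniq)
        have "K (R v + R w) - \<alpha> *\<^sub>R (R v + R w) = (K (R v) - \<alpha> *\<^sub>R R v) + (K (R w) - \<alpha> *\<^sub>R R w)"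
          using R vw by (simp add: K_add algebra_simps)
        also have "\<dots> = v + w" using R vw by simp
        finally show "K (R (v + w)) - \<alpha> *\<^sub>R R (v + w) = K (R v + R w) - \<alpha> *\<^sub>R (R v + R w)"
          using R vw subspace_add[OF subV] by simp
      qed (use R vw subspace_add[OF subV] in auto)
    next
      fix r v assume v: "v \<in> V"
      show "R (r *\<^sub>R v) = r *\<^sub>R R v"
      proof (rule uniq)
        have "K (r *\<^sub>R R v) - \<alpha> *\<^sub>R (r *\<^sub>R R v) = r *\<^sub>R (K (R v) - \<alpha> *\<^sub>R R v)"
          using R v by (simp add: K_scale algebra_simps)
        also have "\<dots> = r *\<^sub>R v" using R v by simp
        finally show "K (R (r *\<^sub>R v)) - \<alpha> *\<^sub>R R (r *\<^sub>R v) = K (r *\<^sub>R R v) - \<alpha> *\<^sub>R (r *\<^sub>R R v)"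
          using R v subspace_scale[OF subV] by simp
      qed (use R v subspace_scale[OF subV] in auto)
    qed
    moreover have "norm (R v) \<le> (1 / d) * norm v" if "v \<in> V" for v
      using d(2)[of "R v"] R[OF that] d(1) by (simp add: field_simps)
    moreover have "R (K v - \<alpha> *\<^sub>R v) = v" if "v \<in> V" for v
    proof -
      have "K v - \<alpha> *\<^sub>R v \<in> V" using that subV by (simp add: KV subspace_diff subspace_scale)
      then show ?thesis using uniq R that by metis
    qed
    ultimately have "\<alpha> \<notin> spectrum_on V K" unfolding spectrum_on_def using R by blast
    then show False using spec by blast
  qed
qed

section \<open>Eigenvalue counting by the variational principle\<close>

definition E :: "real \<Rightarrow> 'h set" where "E \<alpha> = {v \<in> V. K v = \<alpha> *\<^sub>R v}"

lemma subspace_E: "subspace (E \<alpha>)"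
  using subV by (auto simp: E_def subspace_def K_add K_scale K_zero algebra_simps)

lemma E_orthogonal: "v \<in> E \<alpha> \<Longrightarrow> w \<in> E \<beta> \<Longrightarrow> \<alpha> \<noteq> \<beta> \<Longrightarrow> g v w = 0"
  using K_sym[of v w] by (auto simp: E_def g.scaleR_left g.scaleR_right)

text \<open>A subspace with Rayleigh quotient at least \<open>\<epsilon>\<close> is represented by a
  finite basis; its dimension becomes a \<open>card\<close>, and its finiteness is carried
  along.\<close>

definition dominating :: "real \<Rightarrow> 'h set \<Rightarrow> bool" where
  "dominating \<epsilon> B \<longleftrightarrow> finite B \<and> independent B \<and> B \<subseteq> V \<and> (\<forall>v\<in>span B. g (K v) v \<ge> \<epsilon> * g v v)"

lemma span_UN_E:
  assumes "finite F" "\<And>\<alpha>. \<alpha> \<in> F \<Longrightarrow> D \<alpha> \<subseteq> E \<alpha>" "v \<in> span (\<Union>\<alpha>\<in>F. D \<alpha>)"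
  shows "\<exists>x. (\<forall>\<alpha>\<in>F. x \<alpha> \<in> E \<alpha>) \<and> v = (\<Sum>\<alpha>\<in>F. x \<alpha>)"
proof -
  let ?S = "{\<Sum>\<alpha>\<in>F. x \<alpha> |x. \<forall>\<alpha>\<in>F. x \<alpha> \<in> E \<alpha>}"
  have "subspace ?S"
    unfolding subspace_def
  proof (intro conjI ballI allI)
    show "0 \<in> ?S" using subspace_0[OF subspace_E] by (intro CollectI exI[of _ "\<lambda>_. 0"]) auto
  next
    fix v w assume "v \<in> ?S" "w \<in> ?S"
    then obtain x y where "\<forall>\<alpha>\<in>F. x \<alpha> \<in> E \<alpha>" "v = (\<Sum>\<alpha>\<in>F. x \<alpha>)" "\<forall>\<alpha>\<in>F. y \<alpha> \<in> E \<alpha>" "w = (\<Sum>\<alpha>\<in>F. y \<alpha>)" by blast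
    then show "v + w \<in> ?S"
      using subspace_add[OF subspace_E] by (intro CollectI exI[of _ "\<lambda>\<alpha>. x \<alpha> + y \<alpha>"]) (auto simp: sum.distrib)
  next
    fix r v assume "v \<in> ?S"
    then obtain x where "\<forall>\<alpha>\<in>F. x \<alpha> \<in> E \<alpha>" "v = (\<Sum>\<alpha>\<in>F. x \<alpha>)" by blast
    then show "r *\<^sub>R v \<in> ?S"
      using subspace_scale[OF subspace_E] by (intro CollectI exI[of _ "\<lambda>\<alpha>. r *\<^sub>R x \<alpha>"]) (auto simp: scaleR_sum_right)
  qed
  moreover have "(\<Union>\<alpha>\<in>F. D \<alpha>) \<subseteq> ?S"
  proof
    fix v assume "v \<in> (\<Union>\<alpha>\<in>F. D \<alpha>)"
    then obtain \<alpha> where \<alpha>: "\<alpha> \<in> F" "v \<in> E \<alpha>" using assms(2) by blast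
    then have "(\<Sum>\<beta>\<in>F. if \<beta> = \<alpha> then v else 0) = v" using assms(1) by simp
    then show "v \<in> ?S" using \<alpha> subspace_0[OF subspace_E]
      by (intro CollectI exI[of _ "\<lambda>\<beta>. if \<beta> = \<alpha> then v else 0"]) auto
  qed
  ultimately have "span (\<Union>\<alpha>\<in>F. D \<alpha>) \<subseteq> ?S" by (simp add: span_minimal)
  then show ?thesis using assms(3) by blast
qed

text \<open>Eigenspaces of different eigenvalues are orthogonal for \<open>g\<close>. Hence their
  bases unite to an independent set, and both \<open>g (K v) v\<close> and \<open>g v v\<close>
  split into sums over the eigenvalues.\<close>

lemma dominating_UN:
  assumes F: "finite F" and D: "\<And>\<alpha>. \<alpha> \<in> F \<Longrightarrow> finite (D \<alpha>) \<and> independent (D \<alpha>) \<and> D \<alpha> \<subseteq> E \<alpha>"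
    and \<epsilon>: "\<And>\<alpha>. \<alpha> \<in> F \<Longrightarrow> \<alpha> \<ge> \<epsilon>"
  shows "dominating \<epsilon> (\<Union>\<alpha>\<in>F. D \<alpha>) \<and> card (\<Union>\<alpha>\<in>F. D \<alpha>) = (\<Sum>\<alpha>\<in>F. card (D \<alpha>))"
proof -
  have ind: "independent (\<Union>\<alpha>\<in>F. D \<alpha>) \<and> card (\<Union>\<alpha>\<in>F. D \<alpha>) = (\<Sum>\<alpha>\<in>F. card (D \<alpha>))"
    using F D
  proof (induction F rule: finite_induct)
    case (insert \<beta> F)
    have z: "span (D \<beta>) \<inter> span (\<Union>\<alpha>\<in>F. D \<alpha>) \<subseteq> {0}"
    proof
      fix v assume v: "v \<in> span (D \<beta>) \<inter> span (\<Union>\<alpha>\<in>F. D \<alpha>)"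
      have vE: "v \<in> E \<beta>" using v insert.prems[of \<beta>] span_minimal[OF _ subspace_E] by blast
      obtain x where x: "\<forall>\<alpha>\<in>F. x \<alpha> \<in> E \<alpha>" "v = (\<Sum>\<alpha>\<in>F. x \<alpha>)"
        using span_UN_E[of F D v] v insert.hyps insert.prems by auto
      have "g v v = (\<Sum>\<alpha>\<in>F. g (x \<alpha>) v)" by (subst (1) x(2)) (simp add: g.sum_left)
      also have "\<dots> = 0" using x(1) vE insert.hyps by (intro sum.neutral ballI) (metis E_orthogonal)
      finally show "v \<in> {0}" by (simp add: g_zero_iff)
    qed
    have "0 \<notin> D \<beta>" using insert.prems[of \<beta>] dependent_zero by blast
    then have disj: "D \<beta> \<inter> (\<Union>\<alpha>\<in>F. D \<alpha>) = {}"
      using subset_trans[OF Int_mono[OF span_superset span_superset] z] by blast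
    have IH: "independent (\<Union>\<alpha>\<in>F. D \<alpha>)" "card (\<Union>\<alpha>\<in>F. D \<alpha>) = (\<Sum>\<alpha>\<in>F. card (D \<alpha>))"
      using insert.IH insert.prems by auto
    have "independent (D \<beta> \<union> (\<Union>\<alpha>\<in>F. D \<alpha>))" using independent_Un[OF _ IH(1) z] insert.prems by simp
    then show ?case using IH(2) disj insert by (auto simp: card_Un_disjoint)
  qed (simp add: independent_empty)
  have "g (K v) v \<ge> \<epsilon> * g v v" if v: "v \<in> span (\<Union>\<alpha>\<in>F. D \<alpha>)" for v
  proof -
    obtain x where x: "\<forall>\<alpha>\<in>F. x \<alpha> \<in> E \<alpha>" "v = (\<Sum>\<alpha>\<in>F. x \<alpha>)"
      using span_UN_E[of F D v] v F D by auto
    have gx: "g (x \<alpha>) v = g (x \<alpha>) (x \<alpha>)" if "\<alpha> \<in> F" for \<alpha>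
    proof -
      have "g (x \<alpha>) v = (\<Sum>\<beta>\<in>F. g (x \<alpha>) (x \<beta>))" by (simp add: x(2) g.sum_right)
      also have "\<dots> = (\<Sum>\<beta>\<in>F. if \<beta> = \<alpha> then g (x \<alpha>) (x \<alpha>) else 0)"
        using that x(1) by (intro sum.cong) (auto intro: E_orthogonal[of _ \<alpha>])
      finally show ?thesis using that F by simp
    qed
    have "K v = (\<Sum>\<alpha>\<in>F. K (x \<alpha>))" unfolding x(2) using x(1) F by (intro K_sum) (auto simp: E_def)
    also have "\<dots> = (\<Sum>\<alpha>\<in>F. \<alpha> *\<^sub>R x \<alpha>)" using x(1) by (intro sum.cong) (auto simp: E_def)
    finally have "g (K v) v = (\<Sum>\<alpha>\<in>F. \<alpha> * g (x \<alpha>) (x \<alpha>))"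
      using gx by (simp add: g.sum_left g.scaleR_left)
    moreover have "g v v = (\<Sum>\<alpha>\<in>F. g (x \<alpha>) (x \<alpha>))" by (subst (1) x(2)) (simp add: g.sum_left gx)
    ultimately show ?thesis
      using \<epsilon> g_nonneg by (auto simp: sum_distrib_left intro!: sum_mono mult_right_mono)
  qed
  moreover have "finite (\<Union>\<alpha>\<in>F. D \<alpha>)" using F D by blast
  moreover have "(\<Union>\<alpha>\<in>F. D \<alpha>) \<subseteq> V"
  proof -
    have "E \<alpha> \<subseteq> V" for \<alpha> by (auto simp: E_def)
    then show ?thesis using D by blast
  qed
  ultimately show ?thesis using ind by (simp add: dominating_def)
qed

text \<open>If \<open>B\<close> were larger than the union \<open>X\<close> of the eigenbases, some
  nonzero \<open>w\<close> in its span would be orthogonal to \<open>X\<close>. The orthogonal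
  complement of \<open>X\<close> is closed and invariant, so \<open>w\<close> would produce there an
  eigenvector with eigenvalue at least \<open>\<epsilon>\<close>, which also lies in the span of
  \<open>X\<close>. Finiteness of the set of eigenvalues and of the eigenbases comes from the a
  priori bound \<open>M\<close>.\<close>

lemma dominating_count:
  assumes \<epsilon>: "\<epsilon> > 0" and M: "\<And>B. dominating \<epsilon> B \<Longrightarrow> card B \<le> M"
  defines "A \<equiv> {\<alpha> \<in> spectrum_on V K. \<alpha> \<ge> \<epsilon>}"
  shows "finite A"
    and "\<exists>B. dominating \<epsilon> B \<and> card B = (\<Sum>\<alpha>\<in>A. multiplicity_on V K \<alpha>)"
    and "dominating \<epsilon> B \<Longrightarrow> card B \<le> (\<Sum>\<alpha>\<in>A. multiplicity_on V K \<alpha>)"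
proof -
  have A: "\<exists>v\<in>E \<alpha>. v \<noteq> 0" if "\<alpha> \<in> A" for \<alpha>
    using that spectrum_iff_eigenvalue[of \<alpha>] \<epsilon> by (auto simp: A_def E_def)
  then obtain e where e: "\<And>\<alpha>. \<alpha> \<in> A \<Longrightarrow> e \<alpha> \<in> E \<alpha> \<and> e \<alpha> \<noteq> 0" by metis
  show fin: "finite A"
  proof (rule ccontr)
    assume "infinite A"
    then obtain F where F: "F \<subseteq> A" "card F = Suc M" "finite F" by (meson infinite_arbitrarily_large)
    have "dominating \<epsilon> (\<Union>\<alpha>\<in>F. {e \<alpha>}) \<and> card (\<Union>\<alpha>\<in>F. {e \<alpha>}) = (\<Sum>\<alpha>\<in>F. card {e \<alpha>})"
      using F e by (intro dominating_UN) (auto simp: A_def)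
    then show False using M[of "\<Union>\<alpha>\<in>F. {e \<alpha>}"] F by simp
  qed
  have ex: "\<forall>\<alpha>\<in>A. \<exists>D. finite D \<and> independent D \<and> D \<subseteq> E \<alpha> \<and> E \<alpha> \<subseteq> span D \<and>
    card D = multiplicity_on V K \<alpha>"
  proof
    fix \<alpha> assume \<alpha>: "\<alpha> \<in> A"
    obtain D where D: "D \<subseteq> E \<alpha>" "independent D" "E \<alpha> \<subseteq> span D" "card D = dim (E \<alpha>)"
      using basis_exists by blast
    \<comment> \<open>For an infinite basis \<open>card D\<close>, and with it the multiplicity,
      would be the default value 0.\<close>
    have "finite D"
    proof (rule ccontr)
      assume "infinite D"
      then obtain D' where D': "D' \<subseteq> D" "card D' = Suc M" "finite D'" by (meson infinite_arbitrarily_large)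
      have "dominating \<epsilon> (\<Union>\<alpha>\<in>{\<alpha>}. D') \<and> card (\<Union>\<alpha>\<in>{\<alpha>}. D') = (\<Sum>\<alpha>\<in>{\<alpha>}. card D')"
        using D D' independent_mono[OF D(2) D'(1)] \<alpha> by (intro dominating_UN) (auto simp: A_def)
      then show False using M[of D'] D' by simp
    qed
    then show "\<exists>D. finite D \<and> independent D \<and> D \<subseteq> E \<alpha> \<and> E \<alpha> \<subseteq> span D \<and>
      card D = multiplicity_on V K \<alpha>"
      using D by (intro exI[of _ D]) (simp add: multiplicity_on_def E_def)
  qed
  obtain D where "\<forall>\<alpha>\<in>A. finite (D \<alpha>) \<and> independent (D \<alpha>) \<and> D \<alpha> \<subseteq> E \<alpha> \<and> E \<alpha> \<subseteq> span (D \<alpha>) \<and>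
    card (D \<alpha>) = multiplicity_on V K \<alpha>" using bchoice[OF ex] by (rule exE)
  then have D: "\<And>\<alpha>. \<alpha> \<in> A \<Longrightarrow> finite (D \<alpha>) \<and> independent (D \<alpha>) \<and> D \<alpha> \<subseteq> E \<alpha> \<and> E \<alpha> \<subseteq> span (D \<alpha>) \<and>
    card (D \<alpha>) = multiplicity_on V K \<alpha>" by simp
  define X where "X = (\<Union>\<alpha>\<in>A. D \<alpha>)"
  have X: "dominating \<epsilon> X" "card X = (\<Sum>\<alpha>\<in>A. multiplicity_on V K \<alpha>)"
  proof -
    have "dominating \<epsilon> (\<Union>\<alpha>\<in>A. D \<alpha>) \<and> card (\<Union>\<alpha>\<in>A. D \<alpha>) = (\<Sum>\<alpha>\<in>A. card (D \<alpha>))"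
      by (rule dominating_UN[OF fin]) (simp_all add: D, simp add: A_def)
    moreover have "(\<Sum>\<alpha>\<in>A. card (D \<alpha>)) = (\<Sum>\<alpha>\<in>A. multiplicity_on V K \<alpha>)"
      by (rule sum.cong) (simp_all add: D)
    ultimately show "dominating \<epsilon> X" "card X = (\<Sum>\<alpha>\<in>A. multiplicity_on V K \<alpha>)" by (simp_all add: X_def)
  qed
  show "\<exists>B. dominating \<epsilon> B \<and> card B = (\<Sum>\<alpha>\<in>A. multiplicity_on V K \<alpha>)" using X by blast
  assume B: "dominating \<epsilon> B"
  show "card B \<le> (\<Sum>\<alpha>\<in>A. multiplicity_on V K \<alpha>)"
  proof (rule ccontr)
    assume "\<not> ?thesis"
    then have gt: "card B > card X" using X by simp
    have "finite X" "finite B" "independent B" using X B by (auto simp: dominating_def)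
    then have "\<exists>B'\<subseteq>span B. independent B' \<and> finite B' \<and> card B \<le> card B' + card X \<and>
        (\<forall>v\<in>span B'. \<forall>b\<in>X. g v b = 0)"
      by (intro independent_in_kernel bounded_linear.linear g.bounded_linear_left)
    then obtain B' where B': "B' \<subseteq> span B" "independent B'" "card B \<le> card B' + card X"
      "\<And>v b. v \<in> span B' \<Longrightarrow> b \<in> X \<Longrightarrow> g v b = 0" by blast
    then have "B' \<noteq> {}" using gt by auto
    then obtain w where w: "w \<in> B'" by blast
    then have w0: "w \<noteq> 0" using B'(2) dependent_zero by blast
    have wB: "w \<in> span B" using w B' by blast
    have "span B \<subseteq> V" using B subV by (simp add: dominating_def span_minimal)
    then have wV: "w \<in> V" using wB by blast
    define U where "U = {v \<in> V. \<forall>b\<in>X. g v b = 0}"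
    have "closed {v. \<forall>b\<in>X. g v b = 0}"
    proof -
      have "{v. \<forall>b\<in>X. g v b = 0} = (\<Inter>b\<in>X. {v. g v b = 0})" by blast
      moreover have "closed {v. g v b = 0}" for b
        by (intro closed_Collect_eq linear_continuous_on bounded_linear_intros continuous_intros g.bounded_linear_left)
      ultimately show ?thesis by auto
    qed
    then have clU: "closed U" unfolding U_def using closedV
      by (simp add: Collect_conj_eq closed_Int)
    have subU: "subspace U"
      using subV by (auto simp: U_def subspace_def g.add_left g.scaleR_left g.zero_left)
    have KU: "K v \<in> U" if "v \<in> U" for v
    proof -
      have "g (K v) b = 0" if b: "b \<in> X" for b
      proof -
        obtain \<alpha> where "b \<in> E \<alpha>" using b D by (auto simp: X_def)
        then have "b \<in> V" "K b = \<alpha> *\<^sub>R b" by (auto simp: E_def)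
        then show ?thesis using K_sym[of v b] \<open>v \<in> U\<close> b by (auto simp: U_def g.scaleR_right)
      qed
      then show ?thesis using that KV by (auto simp: U_def)
    qed
    have "\<exists>v\<in>U. \<exists>\<mu>\<ge>\<epsilon>. v \<noteq> 0 \<and> K v = \<mu> *\<^sub>R v"
    proof (rule exists_eigenvector[OF _ clU subU KU \<epsilon> _ w0])
      show "w \<in> U" using w wV B'(4) span_base by (auto simp: U_def)
      show "g (K w) w \<ge> \<epsilon> * g w w" using B wB by (auto simp: dominating_def)
    qed (auto simp: U_def)
    then obtain v \<mu> where v: "v \<in> U" "\<mu> \<ge> \<epsilon>" "v \<noteq> 0" "K v = \<mu> *\<^sub>R v" by blast
    then have "v \<in> E \<mu>" "\<mu> \<in> A"
      using spectrum_iff_eigenvalue[of \<mu>] \<epsilon> by (auto simp: E_def A_def U_def)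
    then have "v \<in> span (D \<mu>)" "D \<mu> \<subseteq> X" using D by (auto simp: X_def)
    moreover have "g v x = 0" if "x \<in> span X" for x
      by (rule linear_eq_0_on_span[OF bounded_linear.linear[OF g.bounded_linear_right] _ that]) (use v(1) in \<open>auto simp: U_def\<close>)
    ultimately have "g v v = 0" using span_mono by blast
    then show False using v(3) g_zero_iff by simp
  qed
qed

end

context compact_symmetric begin

lemma compact_symmetric_uminus: "compact_symmetric V g (\<lambda>v. - K v) c C"
proof
  have "linear_operator_on V (\<lambda>v. - K v)"
    using K subspace_neg[OF subV] unfolding compact_operator_on_def linear_operator_on_def by auto
  moreover have "(\<lambda>v. - K v) ` (V \<inter> cball 0 1) = uminus ` (K ` (V \<inter> cball 0 1))" by auto
  then have "closure ((\<lambda>v. - K v) ` (V \<inter> cball 0 1)) = uminus ` closure (K ` (V \<inter> cball 0 1))"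
    using closure_scaleR[of "-1" "K ` (V \<inter> cball 0 1)"] by (simp add: image_image)
  then have "compact (closure ((\<lambda>v. - K v) ` (V \<inter> cball 0 1)))"
    using K compact_negations unfolding compact_operator_on_def by metis
  ultimately show "compact_operator_on V (\<lambda>v. - K v)" unfolding compact_operator_on_def by simp
qed (use subV closedV g g_sym c0 g_lower C0 g_upper K_sym in \<open>auto simp: g.minus_left g.minus_right\<close>)

lemma dominating_mono: "dominating \<epsilon> B \<Longrightarrow> \<delta> \<le> \<epsilon> \<Longrightarrow> dominating \<delta> B"
  unfolding dominating_def using g_nonneg by (meson mult_right_mono order_trans)

text \<open>Negative eigenvalues of \<open>K\<close> are positive eigenvalues of its negative.
  Applying the count and the exchange hypotheses to dominating sets of maximal size translates them
  into bounds for sums of multiplicities.\<close>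

theorem balanced_counting_limits:
  fixes M s\<^sub>0 :: real
  defines "dominating_neg \<equiv> compact_symmetric.dominating V g (\<lambda>v. - K v)"
  assumes s0: "0 < s\<^sub>0" "s\<^sub>0 \<le> 1/2" and M0: "M \<ge> 0"
    and count: "\<And>s B. 0 < s \<Longrightarrow> s \<le> s\<^sub>0 \<Longrightarrow> dominating s B \<Longrightarrow> real (card B) \<le> M / s"
    and count_neg: "\<And>s B. 0 < s \<Longrightarrow> s \<le> s\<^sub>0 \<Longrightarrow> dominating_neg s B \<Longrightarrow> real (card B) \<le> M / s"
    and swap: "\<And>s B. 0 < s \<Longrightarrow> s \<le> s\<^sub>0 \<Longrightarrow> dominating s B \<Longrightarrow>
      \<exists>B'. dominating_neg s B' \<and> real (card B) \<le> real (card B') + M * s powr (-2/3)"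
    and swap_neg: "\<And>s B. 0 < s \<Longrightarrow> s \<le> s\<^sub>0 \<Longrightarrow> dominating_neg s B \<Longrightarrow>
      \<exists>B'. dominating s B' \<and> real (card B) \<le> real (card B') + M * s powr (-2/3)"
  shows "(\<exists>l. ((\<lambda>\<epsilon>. \<Sum>\<alpha> | \<alpha> \<in> spectrum_on V K \<and> \<bar>\<alpha>\<bar> \<ge> \<epsilon>.
                    real (multiplicity_on V K \<alpha>) * \<alpha>) \<longlongrightarrow> l) (at_right 0)) \<and>
         (\<exists>l. ((\<lambda>\<epsilon>. \<Prod>\<alpha> | \<alpha> \<in> spectrum_on V K \<and> \<bar>\<alpha>\<bar> \<ge> \<epsilon>.
                    (1 + \<alpha>) ^ multiplicity_on V K \<alpha>) \<longlongrightarrow> l) (at_right 0))"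
proof -
  interpret neg: compact_symmetric V g "\<lambda>v. - K v" c C by (rule compact_symmetric_uminus)
  let ?K' = "\<lambda>v. - K v"
  let ?m = "multiplicity_on V K" and ?A = "spectrum_on V K"
  define P where "P s = {\<alpha> \<in> spectrum_on V K. \<alpha> \<ge> s}" for s
  define N where "N s = {\<alpha> \<in> spectrum_on V ?K'. \<alpha> \<ge> s}" for s
  \<comment> \<open>The count is assumed up to \<open>s\<^sub>0\<close>; larger thresholds are
    reduced to \<open>s\<^sub>0\<close> by monotonicity.\<close>
  have bound: "card B \<le> nat \<lfloor>M / min s s\<^sub>0\<rfloor>" if "s > 0" "dominating s B" for s B
    using count[of "min s s\<^sub>0" B] dominating_mono[OF that(2), of "min s s\<^sub>0"] that s0 by (simp add: le_nat_floor)
  have bound': "card B \<le> nat \<lfloor>M / min s s\<^sub>0\<rfloor>" if "s > 0" "neg.dominating s B" for s B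
    using count_neg[of "min s s\<^sub>0" B] neg.dominating_mono[OF that(2), of "min s s\<^sub>0"] that s0
    by (simp add: le_nat_floor dominating_neg_def)
  have pos_count: "finite (P s)" "\<exists>B. dominating s B \<and> card B = (\<Sum>\<alpha>\<in>P s. ?m \<alpha>)"
    "\<And>B. dominating s B \<Longrightarrow> card B \<le> (\<Sum>\<alpha>\<in>P s. ?m \<alpha>)" if s: "s > 0" for s
    unfolding P_def
    subgoal by (rule dominating_count(1)[OF s]) (rule bound[OF s])
    subgoal by (rule dominating_count(2)[OF s]) (rule bound[OF s])
    subgoal by (rule dominating_count(3)[OF s]) (rule bound[OF s])
    done
  have neg_count: "finite (N s)" "\<exists>B. neg.dominating s B \<and> card B = (\<Sum>\<alpha>\<in>N s. multiplicity_on V ?K' \<alpha>)"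
    "\<And>B. neg.dominating s B \<Longrightarrow> card B \<le> (\<Sum>\<alpha>\<in>N s. multiplicity_on V ?K' \<alpha>)" if s: "s > 0" for s
    unfolding N_def
    subgoal by (rule neg.dominating_count(1)[OF s]) (rule bound'[OF s])
    subgoal by (rule neg.dominating_count(2)[OF s]) (rule bound'[OF s])
    subgoal by (rule neg.dominating_count(3)[OF s]) (rule bound'[OF s])
    done
  have spec: "-\<alpha> \<in> ?A \<longleftrightarrow> \<alpha> \<in> spectrum_on V ?K'" if "\<alpha> \<noteq> 0" for \<alpha>
  proof -
    have "K v = (-\<alpha>) *\<^sub>R v \<longleftrightarrow> - K v = \<alpha> *\<^sub>R v" for v by (metis minus_minus scaleR_minus_left)
    then show ?thesis using spectrum_iff_eigenvalue[of "-\<alpha>"] neg.spectrum_iff_eigenvalue[of \<alpha>] that by simp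
  qed
  have mult: "?m (-\<alpha>) = multiplicity_on V ?K' \<alpha>" for \<alpha>
  proof -
    have "K v = (-\<alpha>) *\<^sub>R v \<longleftrightarrow> - K v = \<alpha> *\<^sub>R v" for v by (metis minus_minus scaleR_minus_left)
    then show ?thesis by (simp add: multiplicity_on_def)
  qed
  have split: "{x \<in> ?A. \<bar>x\<bar> \<ge> s} = P s \<union> uminus ` N s" "P s \<inter> uminus ` N s = {}" if s: "s > 0" for s
  proof -
    have "uminus ` N s = {x \<in> ?A. - x \<ge> s}"
    proof (intro equalityI subsetI)
      fix x assume "x \<in> uminus ` N s"
      then show "x \<in> {x \<in> ?A. - x \<ge> s}" using spec s by (auto simp: N_def)
    next
      fix x assume "x \<in> {x \<in> ?A. - x \<ge> s}"
      then have "- x \<in> N s" using spec[of "-x"] s by (auto simp: N_def)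
      then have "- (- x) \<in> uminus ` N s" by (rule imageI)
      then show "x \<in> uminus ` N s" by simp
    qed
    then show "{x \<in> ?A. \<bar>x\<bar> \<ge> s} = P s \<union> uminus ` N s" "P s \<inter> uminus ` N s = {}"
      using s by (auto simp: P_def)
  qed
  have sum_split: "(\<Sum>x | x \<in> ?A \<and> \<bar>x\<bar> \<ge> s. f x) = (\<Sum>x\<in>P s. f x) + (\<Sum>x\<in>N s. f (- x))"
    if s: "s > 0" for s and f :: "real \<Rightarrow> real"
    using split[OF s] pos_count(1)[OF s] neg_count(1)[OF s]
    by (simp add: sum.union_disjoint sum.reindex)
  define p where "p s = real (\<Sum>\<alpha>\<in>P s. ?m \<alpha>)" for s
  define n where "n s = real (\<Sum>\<alpha>\<in>N s. multiplicity_on V ?K' \<alpha>)" for s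
  have total: "(\<Sum>x | x \<in> ?A \<and> \<bar>x\<bar> \<ge> s. real (?m x)) = p s + n s" if "s > 0" for s
    using sum_split[OF that, of "\<lambda>x. real (?m x)"] by (simp add: p_def n_def mult)
  have signed: "(\<Sum>x | x \<in> ?A \<and> \<bar>x\<bar> \<ge> s. real (?m x) * sgn x) = p s - n s" if s: "s > 0" for s
  proof -
    have "(\<Sum>x\<in>P s. real (?m x) * sgn x) = p s"
      unfolding p_def of_nat_sum by (rule sum.cong) (use s in \<open>auto simp: P_def\<close>)
    moreover have "(\<Sum>x\<in>N s. real (?m (-x)) * sgn (-x)) = - n s"
      unfolding n_def of_nat_sum sum_negf[symmetric] by (rule sum.cong) (use s in \<open>auto simp: N_def mult\<close>)
    ultimately show ?thesis using sum_split[OF s, of "\<lambda>x. real (?m x) * sgn x"] by simp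
  qed
  have p: "p s \<le> M / s" "p s - n s \<le> M * s powr (-2/3)" if s: "0 < s" "s \<le> s\<^sub>0" for s
  proof -
    obtain B where B: "dominating s B" "card B = (\<Sum>\<alpha>\<in>P s. ?m \<alpha>)" using pos_count(2)[OF s(1)] by blast
    then show "p s \<le> M / s" using count[OF s B(1)] by (simp add: p_def)
    obtain B' where B': "neg.dominating s B'" "real (card B) \<le> real (card B') + M * s powr (-2/3)"
      using swap[OF s B(1)] by (auto simp: dominating_neg_def)
    have "card B' \<le> (\<Sum>\<alpha>\<in>N s. multiplicity_on V ?K' \<alpha>)" by (rule neg_count(3)[OF s(1) B'(1)])
    then have "real (card B') \<le> n s" unfolding n_def by (simp only: of_nat_le_iff)
    then show "p s - n s \<le> M * s powr (-2/3)" using B' B(2) by (simp add: p_def)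
  qed
  have n: "n s \<le> M / s" "n s - p s \<le> M * s powr (-2/3)" if s: "0 < s" "s \<le> s\<^sub>0" for s
  proof -
    obtain B where B: "neg.dominating s B" "card B = (\<Sum>\<alpha>\<in>N s. multiplicity_on V ?K' \<alpha>)"
      using neg_count(2)[OF s(1)] by blast
    have "real (card B) \<le> M / s" by (rule count_neg[OF s]) (use B in \<open>simp add: dominating_neg_def\<close>)
    then show "n s \<le> M / s" by (simp only: n_def B(2))
    obtain B' where B': "dominating s B'" "real (card B) \<le> real (card B') + M * s powr (-2/3)"
      using swap_neg[OF s] B(1) by (auto simp: dominating_neg_def)
    have "card B' \<le> (\<Sum>\<alpha>\<in>P s. ?m \<alpha>)" by (rule pos_count(3)[OF s(1) B'(1)])
    then have "real (card B') \<le> p s" unfolding p_def by (simp only: of_nat_le_iff)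
    then show "n s - p s \<le> M * s powr (-2/3)" using B' B(2) by (simp add: n_def)
  qed
  interpret balanced_family ?A ?m "2 * M" s\<^sub>0
  proof
    show "finite {x \<in> ?A. \<bar>x\<bar> \<ge> e}" if "e > 0" for e
      using split[OF that] pos_count(1)[OF that] neg_count(1)[OF that] by simp
    fix s :: real assume s: "0 < s" "s \<le> s\<^sub>0"
    show "(\<Sum>x | x \<in> ?A \<and> \<bar>x\<bar> \<ge> s. real (?m x)) \<le> 2 * M / s"
      using total[OF s(1)] p(1)[OF s] n(1)[OF s] by simp
    have "0 \<le> M * s powr (-2/3)" using M0 by simp
    then show "\<bar>\<Sum>x | x \<in> ?A \<and> \<bar>x\<bar> \<ge> s. real (?m x) * sgn x\<bar> \<le> 2 * M * s powr (-2/3)"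
      using signed[OF s(1)] p(2)[OF s] n(2)[OF s] by linarith
  qed (use s0 M0 in auto)
  show ?thesis using sum_converges prod_converges by (intro conjI)
qed

end

section \<open>The causal form of a family of linear maps\<close>

lemma measurable_on_subinterval:
  fixes f :: "real \<Rightarrow> 'b::euclidean_space"
  assumes "f \<in> borel_measurable (lebesgue_on {a..b})" "{c..d} \<subseteq> {a..b}"
  shows "f \<in> borel_measurable (lebesgue_on {c..d})"
  using measurable_restrict_mono[OF assms] by simp

lemma has_integral_reversed_affine:
  fixes g :: "real \<Rightarrow> 'b::euclidean_space"
  assumes g: "(g has_integral i) {c - \<beta> * y..c - \<beta> * x}" and \<beta>: "\<beta> > 0"
  shows "((\<lambda>t. g (c - \<beta> * t)) has_integral (i /\<^sub>R \<beta>)) {x..y}"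
proof -
  have "((\<lambda>t. g (- t)) has_integral i) {\<beta> * x - c..\<beta> * y - c}"
    using has_integral_reflect_real[of g i "c - \<beta> * x" "c - \<beta> * y"] g by simp
  from has_integral_affinity'[OF this[folded cbox_interval] \<beta>, of "- c"]
  have "((\<lambda>t. g (- (\<beta> * t + - c))) has_integral (i /\<^sub>R \<beta>)) {x..y}"
    using \<beta> by (simp add: mult.assoc[symmetric])
  then show ?thesis by simp
qed

lemma measurable_reversed_affine:
  fixes f :: "real \<Rightarrow> 'b::euclidean_space"
  assumes f: "f \<in> borel_measurable (lebesgue_on {c - \<beta> * y..c - \<beta> * x})" and \<beta>: "\<beta> > 0"
  shows "(\<lambda>t. f (c - \<beta> * t)) \<in> borel_measurable (lebesgue_on {x..y})"
proof -
  let ?S = "{c - \<beta> * y..c - \<beta> * x}"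
  have m: "(\<lambda>t. if t \<in> ?S then f t else 0) \<in> borel_measurable lebesgue"
    using f by (intro borel_measurable_if_I) auto
  have "(\<lambda>t. c - \<beta> * t) \<in> lebesgue \<rightarrow>\<^sub>M lebesgue"
    using lebesgue_affine_measurable[where c = "\<lambda>x::real. - \<beta>" and t = c] \<beta> by simp
  from measurable_compose[OF this m]
  have "(\<lambda>t. if c - \<beta> * t \<in> ?S then f (c - \<beta> * t) else 0) \<in> borel_measurable lebesgue" .
  moreover have "(c - \<beta> * t \<in> ?S) = (t \<in> {x..y})" for t using \<beta> by auto
  ultimately have "(\<lambda>t. if t \<in> {x..y} then f (c - \<beta> * t) else 0) \<in> borel_measurable lebesgue" by simp
  then show ?thesis by (rule borel_measurable_if_D)
qed

text \<open>Endpoints are exempt because the Lipschitz estimates for the data are available only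
  inside the pieces.\<close>

lemma integral_le_interior:
  fixes f g :: "real \<Rightarrow> real"
  assumes "f integrable_on {a..b}" "g integrable_on {a..b}" "\<And>t. a < t \<Longrightarrow> t < b \<Longrightarrow> f t \<le> g t"
  shows "integral {a..b} f \<le> integral {a..b} g"
proof -
  have "integral {a<..<b} f \<le> integral {a<..<b} g"
    using assms by (intro integral_le) (auto simp: integrable_on_open_interval_real)
  then show ?thesis by (simp add: integral_open_interval_real)
qed

lemma integral_cong_interior:
  fixes f g :: "real \<Rightarrow> 'b::euclidean_space"
  assumes "\<And>t. a < t \<Longrightarrow> t < b \<Longrightarrow> f t = g t"
  shows "integral {a..b} f = integral {a..b} g"
proof -
  have "integral {a<..<b} f = integral {a<..<b} g" using assms by (intro integral_cong) auto
  then show ?thesis by (simp add: integral_open_interval_real)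
qed

text \<open>Square integrability in terms of the gauge integral, usable on every subinterval; on the
  unit interval it agrees with \<open>sq_int\<close>.\<close>

definition sqi :: "real \<Rightarrow> real \<Rightarrow> (real \<Rightarrow> 'k::euclidean_space) \<Rightarrow> bool" where
  "sqi a b f \<longleftrightarrow> f \<in> borel_measurable (lebesgue_on {a..b}) \<and> (\<lambda>t. (norm (f t))\<^sup>2) integrable_on {a..b}"

definition energy :: "real \<Rightarrow> real \<Rightarrow> (real \<Rightarrow> 'k::euclidean_space) \<Rightarrow> real" where
  "energy a b f = integral {a..b} (\<lambda>t. (norm (f t))\<^sup>2)"

definition linear_family ::
  "real \<Rightarrow> real \<Rightarrow> real \<Rightarrow> (real \<Rightarrow> 'k::euclidean_space \<Rightarrow> 'f::euclidean_space) \<Rightarrow> bool" where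
  "linear_family a b c A \<longleftrightarrow> c \<ge> 0 \<and> (\<forall>t\<in>{a..b}. linear (A t) \<and> (\<forall>x. norm (A t x) \<le> c * norm x)) \<and>
     (\<forall>x. (\<lambda>t. A t x) \<in> borel_measurable (lebesgue_on {a..b}))"

lemma energy_nonneg: "energy a b f \<ge> 0"
  unfolding energy_def by (cases "(\<lambda>t. (norm (f t))\<^sup>2) integrable_on {a..b}")
    (auto intro: integral_nonneg simp: not_integrable_integral)

lemma sqi_subinterval: "sqi a b f \<Longrightarrow> {c..d} \<subseteq> {a..b} \<Longrightarrow> sqi c d f"
  unfolding sqi_def using measurable_on_subinterval integrable_on_subinterval by blast

lemma linear_family_subinterval:
  "linear_family a b c A \<Longrightarrow> {x..y} \<subseteq> {a..b} \<Longrightarrow> linear_family x y c A"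
  unfolding linear_family_def using measurable_on_subinterval by blast

lemma linear_family_diff:
  assumes "linear_family a b c A" "linear_family a b d B" "\<And>t x. t \<in> {a..b} \<Longrightarrow> norm (A t x - B t x) \<le> e * norm x" "e \<ge> 0"
  shows "linear_family a b e (\<lambda>t x. A t x - B t x)"
proof -
  have "(\<lambda>t. A t x - B t x) \<in> borel_measurable (lebesgue_on {a..b})" for x
    using assms unfolding linear_family_def by (intro borel_measurable_diff) auto
  then show ?thesis using assms unfolding linear_family_def by (auto intro!: linear_compose_sub)
qed

lemma linear_family_measurable:
  assumes A: "linear_family a b c A" and f: "f \<in> borel_measurable (lebesgue_on {a..b})"
  shows "(\<lambda>t. A t (f t)) \<in> borel_measurable (lebesgue_on {a..b})"
proof -
  have "(\<lambda>t. \<Sum>b\<in>Basis. (f t \<bullet> b) *\<^sub>R A t b) \<in> borel_measurable (lebesgue_on {a..b})"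
    using A f unfolding linear_family_def by (intro borel_measurable_sum borel_measurable_scaleR) auto
  moreover have "A t (f t) = (\<Sum>b\<in>Basis. (f t \<bullet> b) *\<^sub>R A t b)" if "t \<in> {a..b}" for t
  proof -
    interpret linear "A t" using A that unfolding linear_family_def by blast
    have "A t (\<Sum>b\<in>Basis. (f t \<bullet> b) *\<^sub>R b) = (\<Sum>b\<in>Basis. (f t \<bullet> b) *\<^sub>R A t b)"
      by (simp add: sum scaleR)
    then show ?thesis by (simp add: euclidean_representation)
  qed
  ultimately show ?thesis by (subst measurable_cong) auto
qed

lemma sqi_norm_integrable:
  assumes "sqi a b f" shows "(\<lambda>t. norm (f t)) integrable_on {a..b}"
proof -
  have "(\<lambda>t. norm (f t)) absolutely_integrable_on {a..b}"
  proof (rule measurable_bounded_by_integrable_imp_absolutely_integrable)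
    show "(\<lambda>t. 1 + (norm (f t))\<^sup>2) integrable_on {a..b}"
      using assms by (intro integrable_add) (auto simp: sqi_def)
    fix t show "norm (norm (f t)) \<le> 1 + (norm (f t))\<^sup>2"
    proof -
      have "0 \<le> (norm (f t) - 1)\<^sup>2" by simp
      then have "2 * norm (f t) \<le> (norm (f t))\<^sup>2 + 1" by (simp add: power2_diff)
      then show ?thesis using norm_ge_zero[of "f t"] unfolding real_norm_def abs_norm_cancel by linarith
    qed
  qed (use assms in \<open>auto simp: sqi_def\<close>)
  then show ?thesis by (simp add: set_lebesgue_integral_eq_integral(1))
qed

lemma linear_family_absolutely_integrable:
  assumes A: "linear_family a b c A" and f: "sqi a b f"
  shows "(\<lambda>t. A t (f t)) absolutely_integrable_on {a..b}"
proof (rule measurable_bounded_by_integrable_imp_absolutely_integrable)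
  show "(\<lambda>t. c * norm (f t)) integrable_on {a..b}"
    using sqi_norm_integrable[OF f] by (rule integrable_on_mult_right)
qed (use A f linear_family_measurable[OF A] in \<open>auto simp: sqi_def linear_family_def\<close>)

lemma linear_family_integrable:
  "linear_family a b c A \<Longrightarrow> sqi a b f \<Longrightarrow> (\<lambda>t. A t (f t)) integrable_on {a..b}"
  using linear_family_absolutely_integrable set_lebesgue_integral_eq_integral(1) by blast

text \<open>Cauchy-Schwarz against the constant 1, obtained by integrating the square of the
  deviation of \<open>norm (f t)\<close> from its mean.\<close>

lemma integral_norm_square_le:
  assumes f: "sqi a b f" and "a \<le> b"
  shows "(integral {a..b} (\<lambda>t. norm (f t)))\<^sup>2 \<le> (b - a) * energy a b f"
proof (cases "a = b")
  case False
  then have l: "b - a > 0" using assms by simp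
  define m where "m = integral {a..b} (\<lambda>t. norm (f t))"
  note I = sqi_norm_integrable[OF f]
  have J: "(\<lambda>t. (norm (f t))\<^sup>2) integrable_on {a..b}" using f by (simp add: sqi_def)
  let ?r = "m / (b - a)"
  have "((\<lambda>t. (norm (f t))\<^sup>2 - 2 * ?r * norm (f t) + ?r\<^sup>2) has_integral
      energy a b f - 2 * ?r * m + ?r\<^sup>2 * (b - a)) {a..b}"
    using I J l unfolding m_def energy_def
    by (intro has_integral_add has_integral_diff has_integral_mult_right integrable_integral)
      (auto simp: mult.commute intro!: has_integral_const_real[THEN has_integral_eq_rhs])
  moreover have "0 \<le> (norm (f t))\<^sup>2 - 2 * ?r * norm (f t) + ?r\<^sup>2" for t
    using zero_le_power2[of "norm (f t) - ?r"] by (simp add: power2_diff mult_ac)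
  ultimately have "0 \<le> energy a b f - 2 * ?r * m + ?r\<^sup>2 * (b - a)" by (meson has_integral_nonneg)
  also have "\<dots> = energy a b f - m\<^sup>2 / (b - a)"
  proof -
    have "?r\<^sup>2 * (b - a) = m\<^sup>2 / (b - a)" using l by (simp add: power2_eq_square)
    moreover have "2 * ?r * m = 2 * (m\<^sup>2 / (b - a))" by (simp add: power2_eq_square)
    ultimately show ?thesis by linarith
  qed
  finally show ?thesis using l by (simp add: m_def field_simps)
qed simp

lemma norm_integral_linear_family_le:
  assumes A: "linear_family a b c A" and f: "sqi a b f" and s: "{x..y} \<subseteq> {a..b}"
  shows "norm (integral {x..y} (\<lambda>t. A t (f t))) \<le> c * integral {a..b} (\<lambda>t. norm (f t))"
proof -
  have A': "linear_family x y c A" and f': "sqi x y f"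
    using linear_family_subinterval[OF A s] sqi_subinterval[OF f s] by auto
  have "norm (integral {x..y} (\<lambda>t. A t (f t))) \<le> integral {x..y} (\<lambda>t. c * norm (f t))"
    using A' linear_family_integrable[OF A' f'] sqi_norm_integrable[OF f']
    by (intro integral_norm_bound_integral integrable_on_mult_right) (auto simp: linear_family_def)
  also have "\<dots> = c * integral {x..y} (\<lambda>t. norm (f t))" by simp
  also have "\<dots> \<le> c * integral {a..b} (\<lambda>t. norm (f t))"
    using A sqi_norm_integrable[OF f] sqi_norm_integrable[OF f'] s
    by (intro mult_left_mono integral_subset_le) (auto simp: linear_family_def)
  finally show ?thesis .
qed

locale alternating_form =
  fixes \<sigma> :: "'f::euclidean_space \<Rightarrow> 'f \<Rightarrow> real" and Cs :: real
  assumes bil: "bilinear \<sigma>" and \<sigma>_bound: "\<bar>\<sigma> x y\<bar> \<le> Cs * norm x * norm y" and Cs0: "Cs > 0"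
    and alt: "\<sigma> x x = 0"
begin

lemma bounded_bilinear_\<sigma>: "bounded_bilinear \<sigma>"
  using bil by (simp add: bilinear_conv_bounded_bilinear)

sublocale \<sigma>: bounded_bilinear \<sigma> by (rule bounded_bilinear_\<sigma>)

text \<open>The integrand couples every time with all earlier ones. Two separate families
  \<open>A\<close> and \<open>B\<close> allow a change of the family to be expanded
  bilinearly.\<close>

definition causal :: "real \<Rightarrow> real \<Rightarrow> (real \<Rightarrow> 'k::euclidean_space \<Rightarrow> 'f) \<Rightarrow> (real \<Rightarrow> 'k \<Rightarrow> 'f) \<Rightarrow> (real \<Rightarrow> 'k) \<Rightarrow> real" where
  "causal a b A B f = integral {a..b} (\<lambda>t. \<sigma> (integral {a..t} (\<lambda>r. A r (f r))) (B t (f t)))"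

lemma causal_absolutely_integrable:
  fixes A :: "real \<Rightarrow> 'k::euclidean_space \<Rightarrow> 'f"
  assumes A: "linear_family a b \<alpha> A" and B: "linear_family a b \<beta> B" and f: "sqi a b f"
  shows "(\<lambda>t. \<sigma> (integral {a..t} (\<lambda>r. A r (f r))) (B t (f t))) absolutely_integrable_on {a..b}"
proof (rule absolutely_integrable_bounded_measurable_product[OF bil])
  have "continuous_on {a..b} (\<lambda>t. integral {a..t} (\<lambda>r. A r (f r)))"
    using linear_family_integrable[OF A f] by (rule indefinite_integral_continuous_1)
  then show "(\<lambda>t. integral {a..t} (\<lambda>r. A r (f r))) \<in> borel_measurable (lebesgue_on {a..b})"
    "bounded ((\<lambda>t. integral {a..t} (\<lambda>r. A r (f r))) ` {a..b})"
    by (auto intro: continuous_imp_measurable_on_sets_lebesgue compact_imp_bounded compact_continuous_image)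
qed (use linear_family_absolutely_integrable[OF B f] in auto)

lemma causal_integrable:
  fixes A :: "real \<Rightarrow> 'k::euclidean_space \<Rightarrow> 'f"
  assumes "linear_family a b \<alpha> A" "linear_family a b \<beta> B" "sqi a b f"
  shows "(\<lambda>t. \<sigma> (integral {a..t} (\<lambda>r. A r (f r))) (B t (f t))) integrable_on {a..b}"
  using causal_absolutely_integrable[OF assms] set_lebesgue_integral_eq_integral(1) by blast

text \<open>Both arguments of \<open>\<sigma>\<close> are controlled through the integral of
  \<open>norm (f t)\<close>, whose square is at most the length times the energy. On a block of
  length h the form therefore has size h, and perturbing the family by O(h) changes it by
  O(h^2).\<close>

lemma causal_bound:
  fixes A :: "real \<Rightarrow> 'k::euclidean_space \<Rightarrow> 'f"
  assumes A: "linear_family a b \<alpha> A" and B: "linear_family a b \<beta> B" and f: "sqi a b f" and ab: "a \<le> b"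
  shows "\<bar>causal a b A B f\<bar> \<le> Cs * \<alpha> * \<beta> * (b - a) * energy a b f"
proof -
  let ?N = "integral {a..b} (\<lambda>t. norm (f t))"
  have N: "?N \<ge> 0" using sqi_norm_integrable[OF f] by (intro integral_nonneg) auto
  have ab0: "\<alpha> \<ge> 0" "\<beta> \<ge> 0" using A B by (auto simp: linear_family_def)
  have "norm (causal a b A B f) \<le> integral {a..b} (\<lambda>t. (Cs * \<alpha> * ?N * \<beta>) * norm (f t))"
    unfolding causal_def
  proof (rule integral_norm_bound_integral[OF causal_integrable[OF A B f]])
    show "(\<lambda>t. Cs * \<alpha> * ?N * \<beta> * norm (f t)) integrable_on {a..b}"
      using sqi_norm_integrable[OF f] by (rule integrable_on_mult_right)
    fix t assume t: "t \<in> {a..b}"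
    let ?y = "integral {a..t} (\<lambda>r. A r (f r))"
    have "norm (\<sigma> ?y (B t (f t))) \<le> Cs * norm ?y * norm (B t (f t))" using \<sigma>_bound by simp
    also have "\<dots> \<le> Cs * (\<alpha> * ?N) * (\<beta> * norm (f t))"
    proof (intro mult_mono)
      show "norm ?y \<le> \<alpha> * ?N" using t by (intro norm_integral_linear_family_le[OF A f]) auto
      show "norm (B t (f t)) \<le> \<beta> * norm (f t)" using B t by (auto simp: linear_family_def)
    qed (use Cs0 N ab0 in auto)
    finally show "norm (\<sigma> ?y (B t (f t))) \<le> (Cs * \<alpha> * ?N * \<beta>) * norm (f t)" by (simp add: mult_ac)
  qed
  also have "\<dots> = Cs * \<alpha> * \<beta> * ?N\<^sup>2" by (simp add: power2_eq_square mult_ac)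
  also have "\<dots> \<le> Cs * \<alpha> * \<beta> * ((b - a) * energy a b f)"
    using integral_norm_square_le[OF f ab] Cs0 ab0 by (intro mult_left_mono) auto
  finally show ?thesis by (simp add: mult_ac)
qed

text \<open>Earlier times act on later ones only through the accumulated integral, which the mean
  condition resets to zero at \<open>c\<close>.\<close>

lemma causal_split:
  fixes A :: "real \<Rightarrow> 'k::euclidean_space \<Rightarrow> 'f"
  assumes A: "linear_family a b \<alpha> A" and B: "linear_family a b \<beta> B" and f: "sqi a b f"
    and c: "a \<le> c" "c \<le> b" and mean: "integral {a..c} (\<lambda>r. A r (f r)) = 0"
  shows "causal a b A B f = causal a c A B f + causal c b A B f"
proof -
  let ?F = "\<lambda>x t. \<sigma> (integral {x..t} (\<lambda>r. A r (f r))) (B t (f t))"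
  have "integral {a..b} (?F a) = integral {a..c} (?F a) + integral {c..b} (?F a)"
    using Henstock_Kurzweil_Integration.integral_combine[OF c causal_integrable[OF A B f]] by simp
  also have "integral {c..b} (?F a) = integral {c..b} (?F c)"
  proof (rule integral_cong)
    fix t assume t: "t \<in> {c..b}"
    have "(\<lambda>r. A r (f r)) integrable_on {a..t}"
      using linear_family_integrable[OF A f] t by (auto intro: integrable_on_subinterval)
    from Henstock_Kurzweil_Integration.integral_combine[OF c(1) _ this, of] t mean
    show "?F a t = ?F c t" by simp
  qed
  finally show ?thesis by (simp add: causal_def)
qed

text \<open>Telescoping: the inner family is changed first and the outer one second, and
  \<open>causal_bound\<close> applies to both differences.\<close>

lemma causal_diff:
  fixes A :: "real \<Rightarrow> 'k::euclidean_space \<Rightarrow> 'f"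
  assumes A: "linear_family a b \<alpha> A" and B: "linear_family a b \<alpha>' B" and f: "sqi a b f"
    and e: "\<And>t x. t \<in> {a..b} \<Longrightarrow> norm (A t x - B t x) \<le> e * norm x" "e \<ge> 0" and ab: "a \<le> b"
  shows "\<bar>causal a b A A f - causal a b B B f\<bar> \<le> Cs * e * (\<alpha> + \<alpha>') * (b - a) * energy a b f"
proof -
  let ?D = "\<lambda>t x. A t x - B t x"
  have D: "linear_family a b e ?D" by (rule linear_family_diff[OF A B e])
  have I: "integral {a..t} (\<lambda>r. A r (f r) - B r (f r)) = integral {a..t} (\<lambda>r. A r (f r)) - integral {a..t} (\<lambda>r. B r (f r))"
    if "t \<in> {a..b}" for t
    using that by (intro integral_diff integrable_on_subinterval[OF linear_family_integrable[OF A f]]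
      integrable_on_subinterval[OF linear_family_integrable[OF B f]]) auto
  have "causal a b A A f - causal a b B B f = causal a b ?D A f + causal a b B ?D f"
  proof -
    have "causal a b ?D A f + causal a b B ?D f =
      integral {a..b} (\<lambda>t. \<sigma> (integral {a..t} (\<lambda>r. ?D r (f r))) (A t (f t)) + \<sigma> (integral {a..t} (\<lambda>r. B r (f r))) (?D t (f t)))"
      unfolding causal_def by (intro integral_add[symmetric] causal_integrable[OF D A f] causal_integrable[OF B D f])
    also have "\<dots> = integral {a..b} (\<lambda>t. \<sigma> (integral {a..t} (\<lambda>r. A r (f r))) (A t (f t)) - \<sigma> (integral {a..t} (\<lambda>r. B r (f r))) (B t (f t)))"
      by (intro integral_cong) (simp add: I \<sigma>.diff_left \<sigma>.diff_right)
    also have "\<dots> = causal a b A A f - causal a b B B f"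
      unfolding causal_def by (intro integral_diff causal_integrable[OF A A f] causal_integrable[OF B B f])
    finally show ?thesis by simp
  qed
  also have "\<bar>\<dots>\<bar> \<le> Cs * e * \<alpha> * (b - a) * energy a b f + Cs * \<alpha>' * e * (b - a) * energy a b f"
    using causal_bound[OF D A f ab] causal_bound[OF B D f ab] by linarith
  finally show ?thesis by (simp add: algebra_simps)
qed

text \<open>Reversing time exchanges \<open>\<tau> < t\<close> and \<open>t < \<tau>\<close>, which for a constant family flips the sign because
  \<open>\<sigma>\<close> is alternating.\<close>

lemma causal_reversed:
  fixes A :: "'k::euclidean_space \<Rightarrow> 'f"
  assumes A: "linear A" and f: "sqi a (a + \<beta> * (b - a)) f" and \<beta>: "\<beta> > 0" and ab: "a \<le> b"
  shows "causal a b (\<lambda>_. A) (\<lambda>_. A) (\<lambda>t. f (a + \<beta> * b - \<beta> * t))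
    = - causal a (a + \<beta> * (b - a)) (\<lambda>_. A) (\<lambda>_. A) f / \<beta>\<^sup>2"
proof -
  let ?e = "a + \<beta> * (b - a)"
  let ?\<phi> = "\<lambda>t. a + \<beta> * b - \<beta> * t"
  obtain c where c: "c > 0" "\<And>x. norm (A x) \<le> c * norm x" using linear_bounded_pos[OF A] by blast
  have A': "linear_family a ?e c (\<lambda>_. A)" using c A by (auto simp: linear_family_def)
  note I = linear_family_integrable[OF A' f]
  have e: "?\<phi> a = ?e" "?\<phi> b = a" "a \<le> ?e" using \<beta> ab by (auto simp: algebra_simps mult_left_mono)
  define Y where "Y r = integral {a..r} (\<lambda>t. A (f t))" for r
  have Yt: "integral {a..t} (\<lambda>r. A (f (?\<phi> r))) = (Y ?e - Y (?\<phi> t)) /\<^sub>R \<beta>" if t: "t \<in> {a..b}" for t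
  proof -
    have \<phi>t: "a \<le> ?\<phi> t" "?\<phi> t \<le> ?e" using t \<beta> by (auto simp: algebra_simps mult_left_mono)
    have "Y (?\<phi> t) + integral {?\<phi> t..?e} (\<lambda>r. A (f r)) = Y ?e"
      unfolding Y_def by (rule Henstock_Kurzweil_Integration.integral_combine[OF \<phi>t I])
    then have 1: "integral {?\<phi> t..?\<phi> a} (\<lambda>r. A (f r)) = Y ?e - Y (?\<phi> t)" unfolding e by (simp add: algebra_simps)
    have "(\<lambda>r. A (f r)) integrable_on {?\<phi> t..?\<phi> a}"
      using I \<phi>t unfolding e by (auto intro: integrable_on_subinterval)
    then have "((\<lambda>r. A (f r)) has_integral (Y ?e - Y (?\<phi> t))) {?\<phi> t..?\<phi> a}"
      using 1 integrable_integral by metis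
    from has_integral_reversed_affine[OF this \<beta>] show ?thesis by (rule integral_unique)
  qed
  \<comment> \<open>After the substitution the inner integral runs from \<open>r\<close> to the
    right end, so it is the total \<open>Y ?e\<close> minus \<open>Y r\<close>. The total
    contributes \<open>\<sigma> (Y ?e) (Y ?e)\<close>, which vanishes; the rest is minus the
    original form.\<close>
  let ?G = "\<lambda>r. \<sigma> ((Y ?e - Y r) /\<^sub>R \<beta>) (A (f r))"
  have "((\<lambda>r. \<sigma> (Y ?e) (A (f r)) - \<sigma> (Y r) (A (f r))) has_integral \<sigma> (Y ?e) (Y ?e) - causal a ?e (\<lambda>_. A) (\<lambda>_. A) f) {a..?e}"
  proof (rule has_integral_diff)
    have "((\<lambda>r. A (f r)) has_integral Y ?e) {a..?e}" unfolding Y_def using I by (rule integrable_integral)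
    from has_integral_linear[OF this \<sigma>.bounded_linear_right[of "Y ?e"]]
    show "((\<lambda>r. \<sigma> (Y ?e) (A (f r))) has_integral \<sigma> (Y ?e) (Y ?e)) {a..?e}" by (simp add: o_def)
    show "((\<lambda>r. \<sigma> (Y r) (A (f r))) has_integral causal a ?e (\<lambda>_. A) (\<lambda>_. A) f) {a..?e}"
      unfolding causal_def Y_def by (rule integrable_integral[OF causal_integrable[OF A' A' f]])
  qed
  from has_integral_mult_right[OF this, of "1 / \<beta>"]
  have "(?G has_integral - causal a ?e (\<lambda>_. A) (\<lambda>_. A) f / \<beta>) {?\<phi> b..?\<phi> a}"
    unfolding e by (rule has_integral_eq_rhs[OF has_integral_eq[rotated]])
      (auto simp: \<sigma>.diff_left \<sigma>.scaleR_left alt divide_inverse_commute)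
  from has_integral_reversed_affine[OF this \<beta>]
  have "((\<lambda>t. ?G (?\<phi> t)) has_integral - causal a ?e (\<lambda>_. A) (\<lambda>_. A) f / \<beta>\<^sup>2) {a..b}"
    by (simp add: power2_eq_square divide_inverse mult_ac)
  then have "((\<lambda>t. \<sigma> (integral {a..t} (\<lambda>r. A (f (?\<phi> r)))) (A (f (?\<phi> t)))) has_integral
      - causal a ?e (\<lambda>_. A) (\<lambda>_. A) f / \<beta>\<^sup>2) {a..b}"
    by (rule has_integral_eq[rotated]) (simp add: Yt)
  then show ?thesis unfolding causal_def by (rule integral_unique)
qed

end

section \<open>Square integrable functions, weights and reversed time on an interval\<close>

lemma measurable_combine:
  fixes f :: "real \<Rightarrow> 'b::euclidean_space"
  assumes "f \<in> borel_measurable (lebesgue_on {a..c})" "f \<in> borel_measurable (lebesgue_on {c..b})" "a \<le> c" "c \<le> b"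
  shows "f \<in> borel_measurable (lebesgue_on {a..b})"
proof -
  have "(\<lambda>x. (if x \<in> {a..c} then f x else 0) + (if x \<in> {c<..b} then f x else 0)) \<in> borel_measurable lebesgue"
  proof (intro borel_measurable_add borel_measurable_if_I)
    show "f \<in> borel_measurable (lebesgue_on {c<..b})"
      by (rule measurable_restrict_mono[OF assms(2)]) auto
  qed (use assms in auto)
  moreover have "(if x \<in> {a..c} then f x else 0) + (if x \<in> {c<..b} then f x else 0)
    = (if x \<in> {a..b} then f x else 0)" for x using assms by auto
  ultimately have "(\<lambda>x. if x \<in> {a..b} then f x else 0) \<in> borel_measurable lebesgue" by simp
  then show ?thesis by (rule borel_measurable_if_D)
qed

lemma measurable_cong_interior:
  fixes f g :: "real \<Rightarrow> 'b::euclidean_space"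
  assumes f: "f \<in> borel_measurable (lebesgue_on {a..b})" and eq: "\<And>t. a < t \<Longrightarrow> t < b \<Longrightarrow> g t = f t"
  shows "g \<in> borel_measurable (lebesgue_on {a..b})"
proof -
  have "(\<lambda>t. if t \<in> {a<..<b} then f t else if t = a then g a else g b) \<in> borel_measurable (lebesgue_on {a..b})"
  proof (intro measurable_If f)
    show "{x \<in> space (lebesgue_on {a..b}). x \<in> {a<..<b}} \<in> sets (lebesgue_on {a..b})"
    proof -
      have "{x \<in> space (lebesgue_on {a..b}). x \<in> {a<..<b}} = {a<..<b} \<inter> {a..b}" by auto
      then show ?thesis by (simp add: sets_restrict_space_iff)
    qed
    show "{x \<in> space (lebesgue_on {a..b}). x = a} \<in> sets (lebesgue_on {a..b})"
    proof -
      have "{x \<in> space (lebesgue_on {a..b}). x = a} = {a} \<inter> {a..b}" by auto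
      then show ?thesis by (simp add: sets_restrict_space_iff)
    qed
  qed auto
  moreover have "g t = (if t \<in> {a<..<b} then f t else if t = a then g a else g b)" if "t \<in> {a..b}" for t
    using eq[of t] that by auto
  ultimately show ?thesis by (subst measurable_cong) auto
qed

lemma sqi_cong_interior:
  assumes f: "sqi a b f" and eq: "\<And>t. a < t \<Longrightarrow> t < b \<Longrightarrow> g t = f t"
  shows "sqi a b g"
  unfolding sqi_def
proof
  show "g \<in> borel_measurable (lebesgue_on {a..b})"
    using f eq measurable_cong_interior[of f a b g] by (simp add: sqi_def)
  show "(\<lambda>t. (norm (g t))\<^sup>2) integrable_on {a..b}"
  proof (rule integrable_spike_finite[of "{a, b}"])
    show "(\<lambda>t. (norm (f t))\<^sup>2) integrable_on {a..b}" using f by (simp add: sqi_def)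
    show "(norm (g t))\<^sup>2 = (norm (f t))\<^sup>2" if "t \<in> {a..b} - {a, b}" for t
      using eq[of t] that by simp
  qed simp
qed

lemma energy_cong_interior: "(\<And>t. a < t \<Longrightarrow> t < b \<Longrightarrow> g t = f t) \<Longrightarrow> energy a b g = energy a b f"
  unfolding energy_def by (rule integral_cong_interior) simp

lemma sqi_combine:
  assumes "sqi a c f" "sqi c b f" "a \<le> c" "c \<le> b"
  shows "sqi a b f"
  using assms unfolding sqi_def
  by (auto intro: measurable_combine Henstock_Kurzweil_Integration.integrable_combine[of a c b])

text \<open>With \<open>G\<close> equal to minus the trivialized \<open>H\<close> this is the
  squared norm of a variation. Being a single integral, it scales differently from
  \<open>causal\<close> under stretching.\<close>

definition weight :: "real \<Rightarrow> real \<Rightarrow> (real \<Rightarrow> 'k::euclidean_space \<Rightarrow> 'k) \<Rightarrow> (real \<Rightarrow> 'k) \<Rightarrow> real" where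
  "weight a b G f = integral {a..b} (\<lambda>t. G t (f t) \<bullet> f t)"

lemma weight_integrable:
  fixes G :: "real \<Rightarrow> 'k::euclidean_space \<Rightarrow> 'k"
  assumes G: "linear_family a b c G" and f: "sqi a b f"
  shows "(\<lambda>t. G t (f t) \<bullet> f t) integrable_on {a..b}"
proof -
  have "(\<lambda>t. G t (f t) \<bullet> f t) absolutely_integrable_on {a..b}"
  proof (rule measurable_bounded_by_integrable_imp_absolutely_integrable)
    show "(\<lambda>t. G t (f t) \<bullet> f t) \<in> borel_measurable (lebesgue_on {a..b})"
      using linear_family_measurable[OF G] f by (intro borel_measurable_inner) (auto simp: sqi_def)
    show "(\<lambda>t. c * (norm (f t))\<^sup>2) integrable_on {a..b}"
      using f by (intro integrable_on_mult_right) (simp add: sqi_def)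
    fix t assume t: "t \<in> {a..b}"
    have "\<bar>G t (f t) \<bullet> f t\<bar> \<le> norm (G t (f t)) * norm (f t)" by (rule Cauchy_Schwarz_ineq2)
    also have "\<dots> \<le> (c * norm (f t)) * norm (f t)"
      using G t by (intro mult_right_mono) (auto simp: linear_family_def)
    finally show "norm (G t (f t) \<bullet> f t) \<le> c * (norm (f t))\<^sup>2" by (simp add: power2_eq_square)
  qed simp
  then show ?thesis by (simp add: set_lebesgue_integral_eq_integral(1))
qed

lemma weight_lower:
  fixes G :: "real \<Rightarrow> 'k::euclidean_space \<Rightarrow> 'k"
  assumes G: "linear_family a b c G" and f: "sqi a b f"
    and low: "\<And>t x. t \<in> {a..b} \<Longrightarrow> g\<^sub>0 * (norm x)\<^sup>2 \<le> G t x \<bullet> x"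
  shows "g\<^sub>0 * energy a b f \<le> weight a b G f"
proof -
  have "integral {a..b} (\<lambda>t. g\<^sub>0 * (norm (f t))\<^sup>2) \<le> weight a b G f"
    unfolding weight_def
    using f low by (intro integral_le weight_integrable[OF G f] integrable_on_mult_right) (auto simp: sqi_def)
  then show ?thesis by (simp add: energy_def)
qed

lemma weight_combine:
  fixes G :: "real \<Rightarrow> 'k::euclidean_space \<Rightarrow> 'k"
  assumes "linear_family a b c G" "sqi a b f" "a \<le> x" "x \<le> b"
  shows "weight a b G f = weight a x G f + weight x b G f"
  using Henstock_Kurzweil_Integration.integral_combine[OF assms(3,4) weight_integrable[OF assms(1,2)]]
  by (simp add: weight_def)

lemma energy_combine:
  assumes "sqi a b f" "a \<le> x" "x \<le> b"
  shows "energy a b f = energy a x f + energy x b f"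
  using Henstock_Kurzweil_Integration.integral_combine[OF assms(2,3), of "\<lambda>t. (norm (f t))\<^sup>2"] assms(1)
  by (simp add: energy_def sqi_def)

lemma integral_reversed:
  fixes g :: "real \<Rightarrow> real"
  assumes "g integrable_on {a..a + \<beta> * (b - a)}" "\<beta> > 0"
  shows "((\<lambda>t. g (a + \<beta> * b - \<beta> * t)) has_integral integral {a..a + \<beta> * (b - a)} g / \<beta>) {a..b}"
proof -
  have e: "a + \<beta> * b - \<beta> * b = a" "a + \<beta> * b - \<beta> * a = a + \<beta> * (b - a)" by (auto simp: algebra_simps)
  have "(g has_integral integral {a..a + \<beta> * (b - a)} g) {a + \<beta> * b - \<beta> * b..a + \<beta> * b - \<beta> * a}"
    unfolding e by (rule integrable_integral[OF assms(1)])
  from has_integral_reversed_affine[OF this assms(2)] show ?thesis by (simp add: divide_inverse_commute)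
qed

lemma sqi_reversed:
  assumes f: "sqi a (a + \<beta> * (b - a)) f" and \<beta>: "\<beta> > 0"
  shows "sqi a b (\<lambda>t. f (a + \<beta> * b - \<beta> * t))"
    and "energy a b (\<lambda>t. f (a + \<beta> * b - \<beta> * t)) = energy a (a + \<beta> * (b - a)) f / \<beta>"
proof -
  have e: "a + \<beta> * b - \<beta> * b = a" "a + \<beta> * b - \<beta> * a = a + \<beta> * (b - a)" by (auto simp: algebra_simps)
  have I: "(\<lambda>t. (norm (f t))\<^sup>2) integrable_on {a..a + \<beta> * (b - a)}" using f by (simp add: sqi_def)
  note J = integral_reversed[OF I \<beta>]
  have "(\<lambda>t. f (a + \<beta> * b - \<beta> * t)) \<in> borel_measurable (lebesgue_on {a..b})"
    using f by (intro measurable_reversed_affine[OF _ \<beta>]) (simp only: e sqi_def)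
  then show "sqi a b (\<lambda>t. f (a + \<beta> * b - \<beta> * t))" using has_integral_integrable[OF J] by (simp add: sqi_def)
  show "energy a b (\<lambda>t. f (a + \<beta> * b - \<beta> * t)) = energy a (a + \<beta> * (b - a)) f / \<beta>"
    using integral_unique[OF J] by (simp add: energy_def)
qed

lemma (in alternating_form) causal_cong_interior:
  assumes "\<And>t. a < t \<Longrightarrow> t < b \<Longrightarrow> A t (f t) = B t (g t)"
  shows "causal a b A A f = causal a b B B g"
  unfolding causal_def
proof (rule integral_cong_interior)
  fix t assume t: "a < t" "t < b"
  have "integral {a..t} (\<lambda>r. A r (f r)) = integral {a..t} (\<lambda>r. B r (g r))"
    by (rule integral_cong_interior) (use assms t in auto)
  then show "\<sigma> (integral {a..t} (\<lambda>r. A r (f r))) (A t (f t)) = \<sigma> (integral {a..t} (\<lambda>r. B r (g r))) (B t (g t))"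
    using assms[OF t] by simp
qed

section \<open>Freezing, reversing and stretching a single block\<close>

locale second_variation_data = alternating_form \<sigma> Cs
  for \<sigma> :: "'f::euclidean_space \<Rightarrow> 'f \<Rightarrow> real" and Cs :: real +
  fixes Z :: "real \<Rightarrow> 'k::euclidean_space \<Rightarrow> 'f" and G :: "real \<Rightarrow> 'k \<Rightarrow> 'k" and Cz Cg g\<^sub>0 L :: real
  assumes Z: "linear_family 0 1 Cz Z" and G: "linear_family 0 1 Cg G" and Cz0: "Cz > 0"
    and g0: "g\<^sub>0 > 0" and G_lower: "\<And>t x. t \<in> {0..1} \<Longrightarrow> g\<^sub>0 * (norm x)\<^sup>2 \<le> G t x \<bullet> x" and L0: "L \<ge> 0"
begin

text \<open>The interval is open because the data may take arbitrary values at subdivision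
  points.\<close>

definition lipschitz_between :: "real \<Rightarrow> real \<Rightarrow> bool" where
  "lipschitz_between a b \<longleftrightarrow> (\<forall>t s x. a < t \<and> t < b \<and> a < s \<and> s < b \<longrightarrow>
     norm (Z t x - Z s x) \<le> L * \<bar>t - s\<bar> * norm x \<and> norm (G t x - G s x) \<le> L * \<bar>t - s\<bar> * norm x)"

lemma Z_sub: "0 \<le> a \<Longrightarrow> b \<le> 1 \<Longrightarrow> linear_family a b Cz Z"
  and G_sub: "0 \<le> a \<Longrightarrow> b \<le> 1 \<Longrightarrow> linear_family a b Cg G"
  using linear_family_subinterval[OF Z] linear_family_subinterval[OF G] by auto

text \<open>\<open>Z\<close> is frozen at the midpoint for the reversed function and for the
  original one. Each freezing costs \<open>2 * Cs * Cz * L * (b - a)\<^sup>2\<close> times an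
  energy; these errors enter with the factors 1/\<beta> and 1/\<beta>^2, at most 2 and 4, which
  explains the 12.\<close>

lemma causal_block_reversed:
  assumes ab: "0 \<le> a" "a < b" "b \<le> 1" and lip: "lipschitz_between a b" and f: "sqi 0 1 f"
    and \<beta>: "1/2 \<le> \<beta>" "\<beta> \<le> 1"
  defines "e \<equiv> a + \<beta> * (b - a)"
  shows "causal a b Z Z (\<lambda>t. f (a + \<beta> * b - \<beta> * t))
    \<le> - causal a e Z Z f / \<beta>\<^sup>2 + 12 * Cs * Cz * L * (b - a)\<^sup>2 * energy a e f"
proof -
  define m where "m = (a + b) / 2"
  define A where "A t = (if t \<in> {a<..<b} then Z t else Z m)" for t
  let ?f' = "\<lambda>t. f (a + \<beta> * b - \<beta> * t)"
  have e: "a \<le> e" "e \<le> b"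
  proof -
    have "0 \<le> \<beta> * (b - a)" "\<beta> * (b - a) \<le> 1 * (b - a)" using ab \<beta> by (auto intro!: mult_right_mono)
    then show "a \<le> e" "e \<le> b" by (auto simp: e_def)
  qed
  have m: "a < m" "m < b" "m \<in> {0..1}" using ab by (auto simp: m_def)
  have lin: "linear (Z m)" and mb: "norm (Z m x) \<le> Cz * norm x" for x
    using Z m(3) by (auto simp: linear_family_def)
  have Zm: "linear_family a b Cz (\<lambda>_. Z m)" using lin mb Cz0 by (auto simp: linear_family_def)
  have A: "linear_family a b Cz A"
    unfolding linear_family_def
  proof (intro conjI ballI allI)
    show "0 \<le> Cz" using Cz0 by simp
    show "linear (A t)" "norm (A t x) \<le> Cz * norm x" if "t \<in> {a..b}" for t x
      using lin mb Z that ab by (auto simp: A_def linear_family_def)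
    have "(\<lambda>t. Z t x) \<in> borel_measurable (lebesgue_on {a..b})" for x
      using Z_sub[of a b] ab by (auto simp: linear_family_def)
    then show "(\<lambda>t. A t x) \<in> borel_measurable (lebesgue_on {a..b})" for x
      by (rule measurable_cong_interior) (auto simp: A_def)
  qed
  have diff: "norm (A t x - Z m x) \<le> (L * (b - a)) * norm x" if "t \<in> {a..b}" for t x
  proof (cases "t \<in> {a<..<b}")
    case True
    then have "norm (Z t x - Z m x) \<le> L * \<bar>t - m\<bar> * norm x" using lip m by (auto simp: lipschitz_between_def)
    also have "\<dots> \<le> (L * (b - a)) * norm x" using True m L0 by (intro mult_right_mono mult_left_mono) auto
    finally show ?thesis using True by (simp add: A_def)
  next
    case False
    then have "A t x - Z m x = 0" by (auto simp: A_def)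
    then show ?thesis using L0 ab by simp
  qed
  have fe: "sqi a e f" using f e ab by (auto intro: sqi_subinterval)
  note fr = sqi_reversed[OF fe[unfolded e_def], folded e_def]
  have \<beta>0: "\<beta> > 0" using \<beta> by simp
  let ?E = "energy a e f" and ?D = "2 * (Cs * Cz * L * (b - a)\<^sup>2)"
  have D0: "?D \<ge> 0" using Cs0 Cz0 L0 by simp
  have E0: "?E \<ge> 0" by (rule energy_nonneg)
  have 1: "causal a b Z Z ?f' \<le> causal a b (\<lambda>_. Z m) (\<lambda>_. Z m) ?f' + ?D * (?E / \<beta>)"
  proof -
    have "causal a b Z Z ?f' = causal a b A A ?f'" by (rule causal_cong_interior) (simp add: A_def)
    moreover have "\<bar>causal a b A A ?f' - causal a b (\<lambda>_. Z m) (\<lambda>_. Z m) ?f'\<bar>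
      \<le> Cs * (L * (b - a)) * (Cz + Cz) * (b - a) * energy a b ?f'"
      using ab L0 by (intro causal_diff[OF A Zm fr(1)[OF \<beta>0]] diff) auto
    ultimately show ?thesis using fr(2)[OF \<beta>0] by (simp add: power2_eq_square mult_ac)
  qed
  have 2: "causal a e Z Z f - ?D * ?E \<le> causal a e (\<lambda>_. Z m) (\<lambda>_. Z m) f"
  proof -
    have "causal a e Z Z f = causal a e A A f"
      by (rule causal_cong_interior) (use e in \<open>simp add: A_def\<close>)
    moreover have "\<bar>causal a e A A f - causal a e (\<lambda>_. Z m) (\<lambda>_. Z m) f\<bar>
      \<le> Cs * (L * (b - a)) * (Cz + Cz) * (e - a) * ?E"
      using ab e L0 by (intro causal_diff[OF linear_family_subinterval[OF A] linear_family_subinterval[OF Zm] fe] diff) auto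
    moreover have "Cs * (L * (b - a)) * (Cz + Cz) * (e - a) * ?E \<le> Cs * (L * (b - a)) * (Cz + Cz) * (b - a) * ?E"
      using e ab Cs0 Cz0 L0 E0 by (intro mult_right_mono mult_left_mono) auto
    ultimately show ?thesis by (simp add: power2_eq_square mult_ac)
  qed
  have 3: "causal a b (\<lambda>_. Z m) (\<lambda>_. Z m) ?f' = - causal a e (\<lambda>_. Z m) (\<lambda>_. Z m) f / \<beta>\<^sup>2"
    unfolding e_def using fe ab \<beta>0 by (intro causal_reversed lin) (auto simp: e_def)
  have "- causal a e (\<lambda>_. Z m) (\<lambda>_. Z m) f / \<beta>\<^sup>2 \<le> - (causal a e Z Z f - ?D * ?E) / \<beta>\<^sup>2"
    using 2 by (intro divide_right_mono) auto
  also have "\<dots> = - causal a e Z Z f / \<beta>\<^sup>2 + (1 / \<beta>\<^sup>2) * (?D * ?E)" by (simp add: diff_divide_distrib)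
  finally have "causal a b Z Z ?f' \<le> - causal a e Z Z f / \<beta>\<^sup>2 + (1 / \<beta>\<^sup>2) * (?D * ?E) + (1 / \<beta>) * (?D * ?E)"
    using 1 3 by simp
  moreover have "1 / \<beta> \<le> 2" using \<beta> by (simp add: field_simps)
  then have "(1 / \<beta>)\<^sup>2 \<le> 2\<^sup>2" using \<beta>0 by (intro power_mono) auto
  then have "(1 / \<beta>\<^sup>2) * (?D * ?E) \<le> 4 * (?D * ?E)"
    using D0 E0 by (intro mult_right_mono) (auto simp: power_divide)
  moreover have "(1 / \<beta>) * (?D * ?E) \<le> 2 * (?D * ?E)"
    using \<open>1 / \<beta> \<le> 2\<close> D0 E0 by (intro mult_right_mono) auto
  ultimately have "causal a b Z Z ?f' \<le> - causal a e Z Z f / \<beta>\<^sup>2 + 6 * (?D * ?E)" by linarith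
  then show ?thesis by (simp add: mult_ac)
qed

text \<open>The change of variable in a single integral produces only one factor 1/\<beta>.
  \<open>G\<close> is compared with its midpoint value once for the reversed and once for the
  original function, each time at the cost \<open>L * (b - a)\<close> times the energy.\<close>

lemma weight_block_reversed:
  assumes ab: "0 \<le> a" "a < b" "b \<le> 1" and lip: "lipschitz_between a b" and f: "sqi 0 1 f"
    and \<beta>: "1/2 \<le> \<beta>" "\<beta> \<le> 1"
  defines "e \<equiv> a + \<beta> * (b - a)"
  shows "weight a b G (\<lambda>t. f (a + \<beta> * b - \<beta> * t)) \<le> (weight a e G f + 2 * L * (b - a) * energy a e f) / \<beta>"
proof -
  define m where "m = (a + b) / 2"
  let ?f' = "\<lambda>t. f (a + \<beta> * b - \<beta> * t)"
  have e: "a \<le> e" "e \<le> b"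
  proof -
    have "0 \<le> \<beta> * (b - a)" "\<beta> * (b - a) \<le> 1 * (b - a)" using ab \<beta> by (auto intro!: mult_right_mono)
    then show "a \<le> e" "e \<le> b" by (auto simp: e_def)
  qed
  have m: "a < m" "m < b" "m \<in> {0..1}" using ab by (auto simp: m_def)
  have \<beta>0: "\<beta> > 0" using \<beta> by simp
  have Gm: "linear_family x y Cg (\<lambda>_. G m)" for x y
    using G m(3) by (auto simp: linear_family_def)
  have diff: "\<bar>G t x \<bullet> x - G m x \<bullet> x\<bar> \<le> L * (b - a) * (norm x)\<^sup>2" if t: "a < t" "t < b" for t x
  proof -
    have "\<bar>(G t x - G m x) \<bullet> x\<bar> \<le> norm (G t x - G m x) * norm x" by (rule Cauchy_Schwarz_ineq2)
    also have "\<dots> \<le> (L * \<bar>t - m\<bar> * norm x) * norm x"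
      using lip m t by (intro mult_right_mono) (auto simp: lipschitz_between_def)
    also have "\<dots> \<le> (L * (b - a) * norm x) * norm x"
      using t m L0 by (intro mult_right_mono mult_left_mono) auto
    finally show ?thesis by (simp add: inner_diff_left power2_eq_square mult_ac)
  qed
  have fe: "sqi a e f" using f e ab by (auto intro: sqi_subinterval)
  note fr = sqi_reversed[OF fe[unfolded e_def] \<beta>0, folded e_def]
  \<comment> \<open>A majorant of the density that does not depend on time explicitly and hence
    survives the change of variable.\<close>
  let ?H = "\<lambda>x. G m x \<bullet> x + L * (b - a) * (norm x)\<^sup>2"
  have H: "(\<lambda>t. ?H (f t)) integrable_on {a..e}"
    using fe weight_integrable[OF Gm fe] by (intro integrable_add integrable_on_mult_right) (auto simp: sqi_def)
  note J = integral_reversed[OF H[unfolded e_def] \<beta>0, folded e_def]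
  have "weight a b G ?f' \<le> integral {a..b} (\<lambda>t. ?H (?f' t))"
    unfolding weight_def
  proof (rule integral_le_interior)
    show "(\<lambda>t. G t (?f' t) \<bullet> ?f' t) integrable_on {a..b}" using G_sub[of a b] ab by (intro weight_integrable fr(1)) auto
    show "(\<lambda>t. ?H (?f' t)) integrable_on {a..b}" using J by blast
    fix t assume "a < t" "t < b"
    then show "G t (?f' t) \<bullet> ?f' t \<le> ?H (?f' t)" using diff[of t "?f' t"] by linarith
  qed
  also have "\<dots> = integral {a..e} (\<lambda>t. ?H (f t)) / \<beta>" using J by (rule integral_unique)
  also have "integral {a..e} (\<lambda>t. ?H (f t)) \<le> integral {a..e} (\<lambda>t. G t (f t) \<bullet> f t + 2 * L * (b - a) * (norm (f t))\<^sup>2)"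
  proof (rule integral_le_interior[OF H])
    show "(\<lambda>t. G t (f t) \<bullet> f t + 2 * L * (b - a) * (norm (f t))\<^sup>2) integrable_on {a..e}"
      using fe weight_integrable[OF G_sub fe] ab e
      by (intro integrable_add integrable_on_mult_right) (auto simp: sqi_def)
    fix t assume "a < t" "t < e"
    then show "?H (f t) \<le> G t (f t) \<bullet> f t + 2 * L * (b - a) * (norm (f t))\<^sup>2"
      using diff[of t "f t"] e by linarith
  qed
  also have "integral {a..e} (\<lambda>t. G t (f t) \<bullet> f t + 2 * L * (b - a) * (norm (f t))\<^sup>2)
    = weight a e G f + 2 * L * (b - a) * energy a e f"
    unfolding weight_def energy_def
    using fe weight_integrable[OF G_sub fe] ab e
    by (subst integral_add) (auto simp: sqi_def intro!: integrable_on_mult_right)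
  finally show ?thesis using \<beta>0 by (simp add: divide_right_mono)
qed

end

section \<open>Grids and the reversal of all blocks at once\<close>

context second_variation_data begin

definition grid :: "(nat \<Rightarrow> real) \<Rightarrow> nat \<Rightarrow> real \<Rightarrow> bool" where
  "grid p m h \<longleftrightarrow> p 0 = 0 \<and> p m = 1 \<and>
     (\<forall>j<m. p j < p (Suc j) \<and> p (Suc j) - p j \<le> h \<and> lipschitz_between (p j) (p (Suc j)))"

lemma grid_mono:
  assumes "grid p m h" "i \<le> j" "j \<le> m"
  shows "p i \<le> p j"
  using assms(2,3)
proof (induction j rule: dec_induct)
  case (step n)
  then have "p n < p (Suc n)" using assms(1) by (auto simp: grid_def)
  then show ?case using step by simp
qed simp

lemma grid_range: "grid p m h \<Longrightarrow> j \<le> m \<Longrightarrow> 0 \<le> p j \<and> p j \<le> 1"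
  using grid_mono[of p m h 0 j] grid_mono[of p m h j m] by (auto simp: grid_def)

lemma grid_sum:
  fixes \<Phi> :: "real \<Rightarrow> real \<Rightarrow> real"
  assumes g: "grid p m h" and z: "\<Phi> 0 0 = 0"
    and add: "\<And>k. k < m \<Longrightarrow> \<Phi> 0 (p (Suc k)) = \<Phi> 0 (p k) + \<Phi> (p k) (p (Suc k))"
  shows "\<Phi> 0 1 = (\<Sum>j<m. \<Phi> (p j) (p (Suc j)))"
proof -
  have "\<Phi> 0 (p k) = (\<Sum>j<k. \<Phi> (p j) (p (Suc j)))" if "k \<le> m" for k
    using that
  proof (induction k)
    case 0
    then show ?case using g z by (simp add: grid_def)
  next
    case (Suc k)
    then show ?case using add[of k] by simp
  qed
  from this[of m] show ?thesis using g by (simp add: grid_def)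
qed

lemma energy_grid:
  assumes g: "grid p m h" and f: "sqi 0 1 f"
  shows "energy 0 1 f = (\<Sum>j<m. energy (p j) (p (Suc j)) f)"
proof (rule grid_sum[OF g])
  fix k assume k: "k < m"
  show "energy 0 (p (Suc k)) f = energy 0 (p k) f + energy (p k) (p (Suc k)) f"
    using k grid_range[OF g, of k] grid_range[OF g, of "Suc k"] grid_mono[OF g, of k "Suc k"]
    by (intro energy_combine sqi_subinterval[OF f]) auto
qed (simp add: energy_def)

lemma weight_grid:
  assumes g: "grid p m h" and f: "sqi 0 1 f"
  shows "weight 0 1 G f = (\<Sum>j<m. weight (p j) (p (Suc j)) G f)"
proof (rule grid_sum[OF g, where \<Phi> = "\<lambda>a b. weight a b G f"])
  fix k assume k: "k < m"
  have r: "0 \<le> p k" "p k \<le> p (Suc k)" "p (Suc k) \<le> 1"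
    using k grid_range[OF g, of k] grid_range[OF g, of "Suc k"] grid_mono[OF g, of k "Suc k"] by auto
  then show "weight 0 (p (Suc k)) G f = weight 0 (p k) G f + weight (p k) (p (Suc k)) G f"
    by (intro weight_combine[OF G_sub] sqi_subinterval[OF f]) auto
qed (simp add: weight_def)

text \<open>With vanishing block means the accumulated integral is zero at every grid point, so
  distinct blocks do not interact.\<close>

lemma causal_grid:
  assumes g: "grid p m h" and f: "sqi 0 1 f"
    and mean: "\<And>j. j < m \<Longrightarrow> integral {p j..p (Suc j)} (\<lambda>t. Z t (f t)) = 0"
  shows "causal 0 1 Z Z f = (\<Sum>j<m. causal (p j) (p (Suc j)) Z Z f)"
proof (rule grid_sum[OF g, where \<Phi> = "\<lambda>a b. causal a b Z Z f"])
  have r: "0 \<le> p k" "p k \<le> p (Suc k)" "p (Suc k) \<le> 1" if "k < m" for k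
    using that grid_range[OF g, of k] grid_range[OF g, of "Suc k"] grid_mono[OF g, of k "Suc k"] by auto
  have I: "(\<lambda>t. Z t (f t)) integrable_on {0..x}" if "x \<le> 1" for x
    using linear_family_integrable[OF Z f] that by (auto intro: integrable_on_subinterval)
  have zero: "integral {0..p k} (\<lambda>t. Z t (f t)) = 0" if "k \<le> m" for k
    using that
  proof (induction k)
    case 0
    then show ?case using g by (simp add: grid_def)
  next
    case (Suc k)
    then have "k < m" by simp
    from Henstock_Kurzweil_Integration.integral_combine[OF r(1,2)[OF this] I[OF r(3)[OF this]]]
    show ?case using Suc mean[OF \<open>k < m\<close>] by simp
  qed
  fix k assume k: "k < m"
  show "causal 0 (p (Suc k)) Z Z f = causal 0 (p k) Z Z f + causal (p k) (p (Suc k)) Z Z f"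
    using r[OF k] k zero[of k] by (intro causal_split[OF Z_sub Z_sub] sqi_subinterval[OF f]) auto
qed (simp add: causal_def)

text \<open>With \<open>h\<close> of order \<open>s\<close> this bounds the number of eigenvalues above \<open>s\<close> by \<open>O(1/s)\<close>.\<close>

lemma energy_eq_0_if_vanishing_moments:
  assumes g: "grid p m h" and f: "sqi 0 1 f"
    and mean: "\<And>j. j < m \<Longrightarrow> integral {p j..p (Suc j)} (\<lambda>t. Z t (f t)) = 0"
    and dom: "s * weight 0 1 G f \<le> causal 0 1 Z Z f" and s: "s > 0" and small: "Cs * Cz\<^sup>2 * h < s * g\<^sub>0"
  shows "energy 0 1 f = 0"
proof -
  have cg: "causal 0 1 Z Z f = (\<Sum>j<m. causal (p j) (p (Suc j)) Z Z f)"
    by (rule causal_grid[OF g f]) (rule mean)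
  have "causal (p j) (p (Suc j)) Z Z f \<le> (Cs * Cz\<^sup>2 * h) * energy (p j) (p (Suc j)) f" if j: "j < m" for j
  proof -
    have r: "0 \<le> p j" "p j \<le> p (Suc j)" "p (Suc j) \<le> 1" "p (Suc j) - p j \<le> h"
      using j grid_range[OF g, of j] grid_range[OF g, of "Suc j"] grid_mono[OF g, of j "Suc j"] g by (auto simp: grid_def)
    have "\<bar>causal (p j) (p (Suc j)) Z Z f\<bar> \<le> Cs * Cz * Cz * (p (Suc j) - p j) * energy (p j) (p (Suc j)) f"
      using r by (intro causal_bound Z_sub sqi_subinterval[OF f]) auto
    also have "\<dots> \<le> Cs * Cz * Cz * h * energy (p j) (p (Suc j)) f"
      using r Cs0 Cz0 energy_nonneg by (intro mult_right_mono mult_left_mono) auto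
    finally show ?thesis by (simp add: power2_eq_square mult_ac)
  qed
  then have "causal 0 1 Z Z f \<le> (Cs * Cz\<^sup>2 * h) * energy 0 1 f"
    unfolding cg energy_grid[OF g f] sum_distrib_left by (intro sum_mono) auto
  moreover have "s * (g\<^sub>0 * energy 0 1 f) \<le> s * weight 0 1 G f"
    using s by (intro mult_left_mono weight_lower[OF G f G_lower]) auto
  ultimately have "s * g\<^sub>0 * energy 0 1 f \<le> (Cs * Cz\<^sup>2 * h) * energy 0 1 f" using dom by simp
  then have "(s * g\<^sub>0 - Cs * Cz\<^sup>2 * h) * energy 0 1 f \<le> 0" by (simp add: algebra_simps)
  then show ?thesis using energy_nonneg[of 0 1 f] small by (simp add: mult_le_0_iff)
qed

text \<open>As \<open>t\<close> runs through a block, the argument of \<open>f\<close> runs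
  backwards over its first \<open>\<beta>\<close> fraction. Half-open blocks leave at most one
  nonzero summand, and the sum makes linearity in \<open>f\<close> evident.\<close>

definition reversal :: "real \<Rightarrow> (nat \<Rightarrow> real) \<Rightarrow> nat \<Rightarrow> (real \<Rightarrow> 'k) \<Rightarrow> real \<Rightarrow> 'k" where
  "reversal \<beta> p m f t = (\<Sum>j<m. if p j \<le> t \<and> t < p (Suc j) then f (p j + \<beta> * p (Suc j) - \<beta> * t) else 0)"

lemma reversal_on_block:
  assumes g: "grid p m h" and j: "j < m" and t: "p j < t" "t < p (Suc j)"
  shows "reversal \<beta> p m f t = f (p j + \<beta> * p (Suc j) - \<beta> * t)"
proof -
  have "\<not> (p i \<le> t \<and> t < p (Suc i))" if "i < m" "i \<noteq> j" for i
  proof (cases "i < j")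
    case True
    then have "p (Suc i) \<le> p j" using j by (intro grid_mono[OF g]) auto
    then show ?thesis using t by auto
  next
    case False
    then have "p (Suc j) \<le> p i" using that by (intro grid_mono[OF g]) auto
    then show ?thesis using t by auto
  qed
  then have "reversal \<beta> p m f t = (\<Sum>i<m. if i = j then f (p j + \<beta> * p (Suc j) - \<beta> * t) else 0)"
    unfolding reversal_def by (intro sum.cong) (use t in auto)
  then show ?thesis using j by simp
qed

lemma reversal_linear:
  "reversal \<beta> p m (\<lambda>t. f t + f' t) t = reversal \<beta> p m f t + reversal \<beta> p m f' t"
  "reversal \<beta> p m (\<lambda>t. r *\<^sub>R f t) t = r *\<^sub>R reversal \<beta> p m f t"
  "reversal \<beta> p m (\<lambda>t. f t - f' t) t = reversal \<beta> p m f t - reversal \<beta> p m f' t"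
proof -
  show "reversal \<beta> p m (\<lambda>t. f t + f' t) t = reversal \<beta> p m f t + reversal \<beta> p m f' t"
    unfolding reversal_def sum.distrib[symmetric] by (rule sum.cong) auto
  show "reversal \<beta> p m (\<lambda>t. r *\<^sub>R f t) t = r *\<^sub>R reversal \<beta> p m f t"
    unfolding reversal_def scaleR_sum_right by (rule sum.cong) auto
  show "reversal \<beta> p m (\<lambda>t. f t - f' t) t = reversal \<beta> p m f t - reversal \<beta> p m f' t"
    unfolding reversal_def sum_subtractf[symmetric] by (rule sum.cong) auto
qed

lemma block_cut:
  assumes g: "grid p m h" and j: "j < m" and \<beta>: "0 < \<beta>" "\<beta> \<le> 1"
  defines "e \<equiv> p j + \<beta> * (p (Suc j) - p j)"
  shows "0 \<le> p j" "p j < e" "e \<le> p (Suc j)" "p j < p (Suc j)" "p (Suc j) \<le> 1" "p (Suc j) - p j \<le> h"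
    "lipschitz_between (p j) (p (Suc j))" "p (Suc j) - e = (1 - \<beta>) * (p (Suc j) - p j)"
proof -
  show r: "0 \<le> p j" "p j < p (Suc j)" "p (Suc j) \<le> 1" "p (Suc j) - p j \<le> h"
    "lipschitz_between (p j) (p (Suc j))"
    using j grid_range[OF g, of j] grid_range[OF g, of "Suc j"] g by (auto simp: grid_def)
  have "\<beta> * (p (Suc j) - p j) \<le> 1 * (p (Suc j) - p j)" using r \<beta> by (intro mult_right_mono) auto
  then show "e \<le> p (Suc j)" by (simp add: e_def)
  show "p j < e" using r \<beta> by (simp add: e_def)
  show "p (Suc j) - e = (1 - \<beta>) * (p (Suc j) - p j)" by (simp add: e_def algebra_simps)
qed

lemma reversal_block:
  assumes g: "grid p m h" and f: "sqi 0 1 f" and j: "j < m" and \<beta>: "0 < \<beta>" "\<beta> \<le> 1"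
  defines "e \<equiv> p j + \<beta> * (p (Suc j) - p j)"
  shows "sqi (p j) (p (Suc j)) (reversal \<beta> p m f)"
    and "energy (p j) (p (Suc j)) (reversal \<beta> p m f) = energy (p j) e f / \<beta>"
proof -
  note r = block_cut[OF g j \<beta>, folded e_def]
  have fe: "sqi (p j) e f" by (rule sqi_subinterval[OF f]) (use r in auto)
  note fr = sqi_reversed[OF fe[unfolded e_def] \<beta>(1), folded e_def]
  note eq = reversal_on_block[OF g j]
  show "sqi (p j) (p (Suc j)) (reversal \<beta> p m f)" by (rule sqi_cong_interior[OF fr(1)]) (rule eq)
  have "energy (p j) (p (Suc j)) (reversal \<beta> p m f) = energy (p j) (p (Suc j)) (\<lambda>t. f (p j + \<beta> * p (Suc j) - \<beta> * t))"
    by (rule energy_cong_interior) (rule eq)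
  then show "energy (p j) (p (Suc j)) (reversal \<beta> p m f) = energy (p j) e f / \<beta>" using fr(2) by simp
qed

lemma sqi_reversal:
  assumes g: "grid p m h" and f: "sqi 0 1 f" and \<beta>: "0 < \<beta>" "\<beta> \<le> 1"
  shows "sqi 0 1 (reversal \<beta> p m f)"
proof -
  have "sqi 0 (p k) (reversal \<beta> p m f)" if "k \<le> m" for k
    using that
  proof (induction k)
    case 0
    have "sqi 0 0 (\<lambda>_. 0::'k)" by (simp add: sqi_def integrable_on_refl[of _ 0, simplified])
    then have "sqi 0 0 (reversal \<beta> p m f)" by (rule sqi_cong_interior) auto
    then show ?case using g by (simp add: grid_def)
  next
    case (Suc k)
    then have k: "k < m" and IH: "sqi 0 (p k) (reversal \<beta> p m f)" by auto
    show ?case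
      by (rule sqi_combine[OF IH reversal_block(1)[OF g f k \<beta>]])
        (use k grid_range[OF g, of k] grid_mono[OF g, of k "Suc k"] in auto)
  qed
  from this[of m] show ?thesis using g by (simp add: grid_def)
qed

text \<open>Together with linearity this lets the reversal act on classes: functions of energy zero
  are sent to functions of energy zero.\<close>

lemma energy_reversal_le:
  assumes g: "grid p m h" and f: "sqi 0 1 f" and \<beta>: "0 < \<beta>" "\<beta> \<le> 1"
  shows "energy 0 1 (reversal \<beta> p m f) \<le> energy 0 1 f / \<beta>"
  unfolding energy_grid[OF g f] energy_grid[OF g sqi_reversal[OF g f \<beta>]] sum_divide_distrib
proof (intro sum_mono)
  fix j assume "j \<in> {..<m}"
  then have j: "j < m" by simp
  let ?e = "p j + \<beta> * (p (Suc j) - p j)"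
  note r = block_cut[OF g j \<beta>]
  have "energy (p j) (p (Suc j)) f = energy (p j) ?e f + energy ?e (p (Suc j)) f"
    using r by (intro energy_combine sqi_subinterval[OF f]) auto
  then show "energy (p j) (p (Suc j)) (reversal \<beta> p m f) \<le> energy (p j) (p (Suc j)) f / \<beta>"
    using reversal_block(2)[OF g f j \<beta>] energy_nonneg[of ?e "p (Suc j)" f] \<beta> by (simp add: divide_right_mono)
qed

text \<open>The key estimate. On each block only the part of \<open>f\<close> in the first \<open>\<beta>\<close> fraction is kept; it is
  reversed, which changes the sign of the form up to \<open>O(h\<^sup>2)\<close>, and stretched to the whole block, which
  multiplies the form by \<open>1/\<beta>\<^sup>2\<close> but the weight only by \<open>1/\<beta>\<close>. This gain absorbs the error.\<close>

lemma reversal_dominates: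
  assumes g: "grid p m h" and f: "sqi 0 1 f" and s: "s > 0" and \<beta>: "1/2 \<le> \<beta>" "\<beta> < 1"
    and mean1: "\<And>j. j < m \<Longrightarrow> integral {p j..p j + \<beta> * (p (Suc j) - p j)} (\<lambda>t. Z t (f t)) = 0"
    and mean2: "\<And>j. j < m \<Longrightarrow> integral {p j + \<beta> * (p (Suc j) - p j)..p (Suc j)} (\<lambda>t. Z t (f t)) = 0"
    and mean3: "\<And>j. j < m \<Longrightarrow> integral {p j..p (Suc j)} (\<lambda>t. Z t (reversal \<beta> p m f t)) = 0"
    and dom: "s * weight 0 1 G f \<le> causal 0 1 Z Z f"
    and small: "Cs * Cz\<^sup>2 * (1 - \<beta>) * h \<le> s * g\<^sub>0 / 2"
    and gain: "12 * Cs * Cz * L * h\<^sup>2 + 4 * s * L * h \<le> s * (1 - \<beta>) * g\<^sub>0"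
  shows "s * weight 0 1 G (reversal \<beta> p m f) \<le> - causal 0 1 Z Z (reversal \<beta> p m f)"
    and "energy 0 1 (reversal \<beta> p m f) = 0 \<Longrightarrow> energy 0 1 f = 0"
proof -
  have \<beta>': "0 < \<beta>" "\<beta> \<le> 1" using \<beta> by auto
  let ?f' = "reversal \<beta> p m f"
  define e where "e j = p j + \<beta> * (p (Suc j) - p j)" for j
  note r = block_cut[OF g _ \<beta>', folded e_def]
  have f': "sqi 0 1 ?f'" by (rule sqi_reversal[OF g f \<beta>'])
  have fA: "sqi (p j) (e j) f" and fP: "sqi (e j) (p (Suc j)) f" and fI: "sqi (p j) (p (Suc j)) f" if "j < m" for j
    using r[OF that] by (auto intro!: sqi_subinterval[OF f])
  define cA where "cA j = causal (p j) (e j) Z Z f" for j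
  define cP where "cP j = causal (e j) (p (Suc j)) Z Z f" for j
  define wA where "wA j = weight (p j) (e j) G f" for j
  define wP where "wP j = weight (e j) (p (Suc j)) G f" for j
  define EA where "EA j = energy (p j) (e j) f" for j
  define EP where "EP j = energy (e j) (p (Suc j)) f" for j
  have E0: "EA j \<ge> 0" "EP j \<ge> 0" for j by (simp_all add: EA_def EP_def energy_nonneg)
  \<comment> \<open>\<open>mean1\<close> and \<open>mean2\<close> together decouple the blocks;
    \<open>mean1\<close> also decouples the kept part of a block from its tail.\<close>
  have mean: "integral {p j..p (Suc j)} (\<lambda>t. Z t (f t)) = 0" if j: "j < m" for j
  proof -
    have "(\<lambda>t. Z t (f t)) integrable_on {p j..p (Suc j)}"
      using r[OF j] by (intro linear_family_integrable[OF Z_sub] fI[OF j]) auto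
    from Henstock_Kurzweil_Integration.integral_combine[OF _ _ this, of "e j"]
    show ?thesis using r[OF j] mean1[OF j] mean2[OF j] by (simp add: e_def)
  qed
  have cg: "causal 0 1 Z Z f = (\<Sum>j<m. causal (p j) (p (Suc j)) Z Z f)"
    by (rule causal_grid[OF g f]) (rule mean)
  have cg': "causal 0 1 Z Z ?f' = (\<Sum>j<m. causal (p j) (p (Suc j)) Z Z ?f')"
    by (rule causal_grid[OF g f']) (rule mean3)
  have causal_f: "causal 0 1 Z Z f = (\<Sum>j<m. cA j) + (\<Sum>j<m. cP j)"
    unfolding cg sum.distrib[symmetric] cA_def cP_def
  proof (rule sum.cong)
    fix j assume "j \<in> {..<m}"
    then have j: "j < m" by simp
    show "causal (p j) (p (Suc j)) Z Z f = causal (p j) (e j) Z Z f + causal (e j) (p (Suc j)) Z Z f"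
      using r[OF j] mean1[OF j] by (intro causal_split[OF Z_sub Z_sub] fI[OF j]) (auto simp: e_def)
  qed simp
  have weight_f: "weight 0 1 G f = (\<Sum>j<m. wA j) + (\<Sum>j<m. wP j)"
    unfolding weight_grid[OF g f] sum.distrib[symmetric] wA_def wP_def
  proof (rule sum.cong)
    fix j assume "j \<in> {..<m}"
    then have j: "j < m" by simp
    show "weight (p j) (p (Suc j)) G f = weight (p j) (e j) G f + weight (e j) (p (Suc j)) G f"
      using r[OF j] by (intro weight_combine[OF G_sub] fI[OF j]) auto
  qed simp
  have energy_f: "energy 0 1 f = (\<Sum>j<m. EA j) + (\<Sum>j<m. EP j)"
    unfolding energy_grid[OF g f] sum.distrib[symmetric] EA_def EP_def
  proof (rule sum.cong)
    fix j assume "j \<in> {..<m}"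
    then have j: "j < m" by simp
    show "energy (p j) (p (Suc j)) f = energy (p j) (e j) f + energy (e j) (p (Suc j)) f"
      using r[OF j] by (intro energy_combine fI[OF j]) auto
  qed simp
  have wA: "g\<^sub>0 * EA j \<le> wA j" and wP: "g\<^sub>0 * EP j \<le> wP j" if j: "j < m" for j
    unfolding EA_def wA_def EP_def wP_def using r[OF j]
    by (auto intro!: weight_lower[OF G_sub] fA[OF j] fP[OF j] G_lower)
  \<comment> \<open>The tail has length \<open>1 - \<beta>\<close> times that of the block, so by
    \<open>small\<close> its form is at most half of \<open>s\<close> times its weight. The other
    half survives in \<open>key\<close> and makes the reversal injective.\<close>
  have cP: "cP j \<le> (s / 2) * wP j" if j: "j < m" for j
  proof -
    have "\<bar>cP j\<bar> \<le> Cs * Cz * Cz * (p (Suc j) - e j) * EP j"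
      unfolding cP_def EP_def using r[OF j] by (intro causal_bound Z_sub fP[OF j]) auto
    also have "\<dots> = (Cs * Cz\<^sup>2 * (1 - \<beta>)) * (p (Suc j) - p j) * EP j"
      using r(8)[OF j] by (simp add: power2_eq_square mult_ac)
    also have "\<dots> \<le> (Cs * Cz\<^sup>2 * (1 - \<beta>)) * h * EP j"
      using r[OF j] Cs0 Cz0 \<beta> E0 by (intro mult_right_mono mult_left_mono) auto
    also have "\<dots> \<le> (s * g\<^sub>0 / 2) * EP j" using small E0 by (intro mult_right_mono) auto
    also have "\<dots> = (s / 2) * (g\<^sub>0 * EP j)" by simp
    also have "\<dots> \<le> (s / 2) * wP j" using wP[OF j] s by (intro mult_left_mono) auto
    finally show ?thesis by simp
  qed
  then have "(\<Sum>j<m. cP j) \<le> (s / 2) * (\<Sum>j<m. wP j)" unfolding sum_distrib_left by (intro sum_mono) auto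
  then have key: "s * (\<Sum>j<m. wA j) + (s / 2) * (\<Sum>j<m. wP j) \<le> (\<Sum>j<m. cA j)"
    using dom unfolding causal_f weight_f by (simp add: algebra_simps)
  have "0 \<le> wP j" if "j < m" for j
    using wP[OF that] E0(2)[of j] g0 by (meson mult_nonneg_nonneg less_imp_le order_trans)
  then have sumP0: "0 \<le> (\<Sum>j<m. wP j)" by (intro sum_nonneg) auto
  have key': "s * (\<Sum>j<m. wA j) \<le> (\<Sum>j<m. cA j)"
  proof -
    have "0 \<le> (s / 2) * (\<Sum>j<m. wP j)" using sumP0 s by simp
    then show ?thesis using key by linarith
  qed
  let ?D = "12 * Cs * Cz * L * h\<^sup>2"
  have h0: "0 \<le> h" if "j < m" for j using r[OF that] by linarith
  have sqh: "(p (Suc j) - p j)\<^sup>2 \<le> h\<^sup>2" if "j < m" for j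
    using r[OF that] by (intro power_mono) auto
  have block_eq: "reversal \<beta> p m f t = f (p j + \<beta> * p (Suc j) - \<beta> * t)" if "j < m" "p j < t" "t < p (Suc j)" for j t
    by (rule reversal_on_block[OF g that])
  have causal_f': "causal 0 1 Z Z ?f' \<le> (\<Sum>j<m. - cA j / \<beta>\<^sup>2 + ?D * EA j)"
    unfolding cg'
  proof (rule sum_mono)
    fix j assume "j \<in> {..<m}"
    then have j: "j < m" by simp
    have "causal (p j) (p (Suc j)) Z Z ?f' = causal (p j) (p (Suc j)) Z Z (\<lambda>t. f (p j + \<beta> * p (Suc j) - \<beta> * t))"
      by (rule causal_cong_interior) (simp add: block_eq[OF j])
    also have "\<dots> \<le> - cA j / \<beta>\<^sup>2 + 12 * Cs * Cz * L * (p (Suc j) - p j)\<^sup>2 * EA j"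
      unfolding cA_def EA_def e_def using r[OF j] \<beta> by (intro causal_block_reversed f) auto
    also have "12 * Cs * Cz * L * (p (Suc j) - p j)\<^sup>2 * EA j \<le> ?D * EA j"
      using sqh[OF j] Cs0 Cz0 L0 E0 by (intro mult_right_mono mult_left_mono) auto
    finally show "causal (p j) (p (Suc j)) Z Z ?f' \<le> - cA j / \<beta>\<^sup>2 + ?D * EA j" by simp
  qed
  have weight_f': "weight 0 1 G ?f' \<le> (\<Sum>j<m. (wA j + 2 * L * h * EA j) / \<beta>)"
    unfolding weight_grid[OF g f']
  proof (rule sum_mono)
    fix j assume "j \<in> {..<m}"
    then have j: "j < m" by simp
    have "weight (p j) (p (Suc j)) G ?f' = weight (p j) (p (Suc j)) G (\<lambda>t. f (p j + \<beta> * p (Suc j) - \<beta> * t))"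
      unfolding weight_def by (rule integral_cong_interior) (simp add: block_eq[OF j])
    also have "\<dots> \<le> (wA j + 2 * L * (p (Suc j) - p j) * EA j) / \<beta>"
      unfolding wA_def EA_def e_def using r[OF j] \<beta> by (intro weight_block_reversed f) auto
    also have "\<dots> \<le> (wA j + 2 * L * h * EA j) / \<beta>"
      using r[OF j] \<beta>' L0 E0 by (intro divide_right_mono add_left_mono mult_right_mono mult_left_mono) auto
    finally show "weight (p j) (p (Suc j)) G ?f' \<le> (wA j + 2 * L * h * EA j) / \<beta>" .
  qed
  have "s * weight 0 1 G ?f' \<le> s * (\<Sum>j<m. (wA j + 2 * L * h * EA j) / \<beta>)"
    using weight_f' s by (intro mult_left_mono) auto
  also have "\<dots> \<le> s * (\<Sum>j<m. wA j) / \<beta>\<^sup>2 - (\<Sum>j<m. ?D * EA j)"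
  proof -
    have "s * ((wA j + 2 * L * h * EA j) / \<beta>) \<le> s * wA j / \<beta>\<^sup>2 - ?D * EA j" if j: "j < m" for j
    proof -
      have w0: "0 \<le> wA j" using wA[OF j] E0(1)[of j] g0 by (meson mult_nonneg_nonneg less_imp_le order_trans)
      have inv: "1 \<le> 1 / \<beta>" "1 / \<beta> \<le> 2" using \<beta> by (auto simp: field_simps)
      have q: "1 - \<beta> \<le> 1 / \<beta>\<^sup>2 - 1 / \<beta>"
      proof -
        have "1 / \<beta>\<^sup>2 - 1 / \<beta> = (1 / \<beta>)\<^sup>2 * (1 - \<beta>)" using \<beta>' by (simp add: power2_eq_square field_simps)
        also have "\<dots> \<ge> 1 * (1 - \<beta>)" using inv \<beta> by (intro mult_right_mono one_le_power) auto
        finally show ?thesis by simp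
      qed
      have "(?D + s * (2 * L * h) / \<beta>) * EA j \<le> (s * (1 - \<beta>) * g\<^sub>0) * EA j"
      proof (rule mult_right_mono[OF _ E0(1)])
        have "(s * (2 * L * h)) * (1 / \<beta>) \<le> (s * (2 * L * h)) * 2"
          using inv s L0 h0[OF j] by (intro mult_left_mono) auto
        then show "?D + s * (2 * L * h) / \<beta> \<le> s * (1 - \<beta>) * g\<^sub>0" using gain by simp
      qed
      also have "\<dots> = (s * (1 - \<beta>)) * (g\<^sub>0 * EA j)" by simp
      also have "\<dots> \<le> (s * (1 - \<beta>)) * wA j" using wA[OF j] s \<beta> by (intro mult_left_mono) auto
      also have "\<dots> \<le> (s * (1 / \<beta>\<^sup>2 - 1 / \<beta>)) * wA j" using q w0 s by (intro mult_right_mono mult_left_mono) auto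
      finally show ?thesis by (simp add: algebra_simps add_divide_distrib)
    qed
    then have "(\<Sum>j<m. s * ((wA j + 2 * L * h * EA j) / \<beta>)) \<le> (\<Sum>j<m. s * wA j / \<beta>\<^sup>2 - ?D * EA j)"
      by (intro sum_mono) auto
    then show ?thesis by (simp add: sum_subtractf sum_distrib_left sum_divide_distrib)
  qed
  also have "\<dots> \<le> (\<Sum>j<m. cA j) / \<beta>\<^sup>2 - (\<Sum>j<m. ?D * EA j)"
    using key' by (intro diff_right_mono divide_right_mono) auto
  also have "\<dots> = - (\<Sum>j<m. - cA j / \<beta>\<^sup>2 + ?D * EA j)"
    by (simp add: sum_subtractf sum_divide_distrib)
  also have "\<dots> \<le> - causal 0 1 Z Z ?f'" using causal_f' by simp
  finally show "s * weight 0 1 G ?f' \<le> - causal 0 1 Z Z ?f'" .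
  \<comment> \<open>The reversal sees only the kept parts, so these have energy zero; then
    \<open>key\<close> forces the weights of the tails to vanish as well.\<close>
  assume "energy 0 1 ?f' = 0"
  then have "(\<Sum>j<m. EA j / \<beta>) = 0"
    unfolding energy_grid[OF g f'] using reversal_block(2)[OF g f _ \<beta>'] by (simp add: EA_def e_def)
  then have EA: "EA j = 0" if "j < m" for j
    using that E0 \<beta>' by (subst (asm) sum_nonneg_eq_0_iff) auto
  have "\<bar>cA j\<bar> \<le> Cs * Cz * Cz * (e j - p j) * EA j" if j: "j < m" for j
    unfolding cA_def EA_def using r[OF j] by (intro causal_bound Z_sub fA[OF j]) auto
  then have cA: "(\<Sum>j<m. cA j) = 0" using EA by (intro sum.neutral) auto
  have "0 \<le> (\<Sum>j<m. wA j)" using wA EA by (intro sum_nonneg) fastforce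
  then have "0 \<le> s * (\<Sum>j<m. wA j)" using s by simp
  then have "(s / 2) * (\<Sum>j<m. wP j) \<le> 0" using key cA by linarith
  then have "(\<Sum>j<m. wP j) \<le> 0" using s by (simp add: mult_le_0_iff)
  moreover have "(\<Sum>j<m. g\<^sub>0 * EP j) \<le> (\<Sum>j<m. wP j)" using wP by (intro sum_mono) auto
  ultimately have "g\<^sub>0 * (\<Sum>j<m. EP j) \<le> 0" by (simp add: sum_distrib_left)
  then have "(\<Sum>j<m. EP j) \<le> 0" using g0 by (simp add: mult_le_0_iff)
  moreover have "0 \<le> (\<Sum>j<m. EP j)" using E0 by (intro sum_nonneg) auto
  ultimately show "energy 0 1 f = 0" unfolding energy_f using EA by simp
qed

end

section \<open>Passage to square integrable classes\<close>

text \<open>An explicit negligible set serves all subintervals of the unit interval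
  simultaneously.\<close>

definition ae_eq :: "(real \<Rightarrow> 'b) \<Rightarrow> (real \<Rightarrow> 'b) \<Rightarrow> bool" where
  "ae_eq f g \<longleftrightarrow> (\<exists>N. negligible N \<and> (\<forall>t\<in>{0..1} - N. f t = g t))"

lemma AE_imp_ae_eq:
  assumes "AE t in lebesgue_on {0..1}. f t = g t" shows "ae_eq f g"
proof -
  have "AE t in lebesgue. t \<in> {0..1} \<longrightarrow> f t = g t"
    using assms by (simp add: AE_restrict_space_iff)
  then obtain N where N: "negligible N" "{t. \<not> (t \<in> {0..1} \<longrightarrow> f t = g t)} \<subseteq> N"
    unfolding eventually_ae_filter_negligible by blast
  show ?thesis unfolding ae_eq_def by (rule exI[of _ N]) (use N in blast)
qed

lemma ae_eq_AE:
  assumes "ae_eq f g" shows "AE t in lebesgue_on {0..1}. f t = g t"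
proof -
  obtain N where N: "negligible N" "\<And>t. t \<in> {0..1} - N \<Longrightarrow> f t = g t" using assms unfolding ae_eq_def by blast
  have "AE t in lebesgue. t \<in> {0..1} \<longrightarrow> f t = g t"
    unfolding eventually_ae_filter_negligible by (rule exI[of _ N]) (use N in auto)
  then show ?thesis by (simp add: AE_restrict_space_iff)
qed

lemma ae_eq_compose: "ae_eq f g \<Longrightarrow> ae_eq (\<lambda>t. F t (f t)) (\<lambda>t. F t (g t))"
  unfolding ae_eq_def by (metis (no_types))

lemma integral_ae_eq:
  fixes f g :: "real \<Rightarrow> 'b::euclidean_space"
  assumes "ae_eq f g" "0 \<le> a" "b \<le> 1" shows "integral {a..b} f = integral {a..b} g"
proof -
  obtain N where N: "negligible N" "\<And>t. t \<in> {0..1} - N \<Longrightarrow> f t = g t" using assms unfolding ae_eq_def by blast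
  show ?thesis by (rule integral_spike[OF N(1)]) (use N(2) assms in auto)
qed

lemma sq_int_sqi: "f \<in> sq_int \<longleftrightarrow> sqi 0 1 f"
proof
  assume f: "f \<in> sq_int"
  then have "(\<lambda>t. (norm (f t))\<^sup>2) integrable_on {0..1}" unfolding sq_int_def by (intro integrable_on_lebesgue_on) auto
  then show "sqi 0 1 f" using f by (simp add: sqi_def sq_int_def)
next
  assume f: "sqi 0 1 f"
  then have "(\<lambda>t. (norm (f t))\<^sup>2) absolutely_integrable_on {0..1}"
    by (intro nonnegative_absolutely_integrable_1) (auto simp: sqi_def)
  then have "integrable (lebesgue_on {0..1}) (\<lambda>t. (norm (f t))\<^sup>2)"
    by (intro absolutely_integrable_imp_integrable) auto
  then show "f \<in> sq_int" using f by (simp add: sqi_def sq_int_def)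
qed

lemma sqi_rep: "sqi 0 1 (rep_L2 v)"
proof -
  have "sq_int_rel (rep_L2 v) (rep_L2 v)" using Quotient3_rel_rep[OF Quotient3_L2] by blast
  then show ?thesis by (simp add: sq_int_rel_def sq_int_sqi)
qed

lemma rep_abs_L2:
  assumes "sqi 0 1 f" shows "ae_eq (rep_L2 (abs_L2 f)) f"
proof -
  have "sq_int_rel f f" using assms by (simp add: sq_int_rel_def sq_int_sqi)
  then have "sq_int_rel (rep_L2 (abs_L2 f)) f" by (rule Quotient3_rep_abs[OF Quotient3_L2])
  then show ?thesis by (intro AE_imp_ae_eq) (simp add: sq_int_rel_def)
qed

lemma abs_L2_eqI:
  assumes "sqi 0 1 f" "sqi 0 1 g" "ae_eq f g" shows "abs_L2 f = abs_L2 g"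
  by (rule Quotient3_rel_abs[OF Quotient3_L2]) (use assms ae_eq_AE in \<open>auto simp: sq_int_rel_def sq_int_sqi\<close>)

lemma abs_rep_L2: "abs_L2 (rep_L2 v) = v"
  by (rule Quotient3_abs_rep[OF Quotient3_L2])

lemma sqi_add: "sqi 0 1 f \<Longrightarrow> sqi 0 1 g \<Longrightarrow> sqi 0 1 (\<lambda>t. f t + g t)"
  and sqi_scaleR: "sqi 0 1 f \<Longrightarrow> sqi 0 1 (\<lambda>t. r *\<^sub>R f t)"
  and sqi_diff: "sqi 0 1 f \<Longrightarrow> sqi 0 1 g \<Longrightarrow> sqi 0 1 (\<lambda>t. f t - g t)"
  using sq_int_add[of f g] sq_int_scaleR[of f r] sq_int_add[of f "\<lambda>t. - g t"] sq_int_minus[of g]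
  by (auto simp: sq_int_sqi)

lemma abs_L2_add: "sqi 0 1 f \<Longrightarrow> sqi 0 1 g \<Longrightarrow> abs_L2 f + abs_L2 g = abs_L2 (\<lambda>t. f t + g t)"
  and abs_L2_scaleR: "sqi 0 1 f \<Longrightarrow> r *\<^sub>R abs_L2 f = abs_L2 (\<lambda>t. r *\<^sub>R f t)"
  by (auto intro!: plus_L2.abs_eq scaleR_L2.abs_eq simp: sq_int_rel_def sq_int_sqi)

lemma rep_L2_add: "ae_eq (rep_L2 (v + w)) (\<lambda>t. rep_L2 v t + rep_L2 w t)"
  using rep_abs_L2[OF sqi_add[OF sqi_rep sqi_rep], of v w] abs_L2_add[OF sqi_rep sqi_rep, of v w]
  by (simp add: abs_rep_L2)

lemma rep_L2_scaleR: "ae_eq (rep_L2 (r *\<^sub>R v)) (\<lambda>t. r *\<^sub>R rep_L2 v t)"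
  using rep_abs_L2[OF sqi_scaleR[OF sqi_rep], of r v] abs_L2_scaleR[OF sqi_rep, of r v]
  by (simp add: abs_rep_L2)

lemma LINT_eq_integral:
  fixes f :: "real \<Rightarrow> 'b::euclidean_space"
  assumes "f absolutely_integrable_on {a..b}"
  shows "(LINT t|lebesgue_on {a..b}. f t) = integral {a..b} f"
  using lebesgue_integral_eq_integral[OF absolutely_integrable_imp_integrable[OF assms]] by simp

lemma norm_L2_energy: "(norm v)\<^sup>2 = energy 0 1 (rep_L2 v)"
proof -
  have "(\<lambda>t. (norm (rep_L2 v t))\<^sup>2) absolutely_integrable_on {0..1}"
    using sqi_rep[of v] by (intro nonnegative_absolutely_integrable_1) (auto simp: sqi_def)
  then show ?thesis
    by (simp add: power2_norm_eq_inner inner_L2.rep_eq energy_def flip: LINT_eq_integral)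
qed

lemma energy_abs_L2: "sqi 0 1 f \<Longrightarrow> (norm (abs_L2 f))\<^sup>2 = energy 0 1 f"
  unfolding norm_L2_energy energy_def
  by (rule integral_ae_eq[OF ae_eq_compose[OF rep_abs_L2]]) auto

text \<open>\<open>rep_L2\<close> is additive and homogeneous only up to negligible sets;
  integration removes the ambiguity.\<close>

lemma linear_integral_L2:
  fixes A :: "real \<Rightarrow> 'k::euclidean_space \<Rightarrow> 'f::euclidean_space"
  assumes A: "linear_family 0 1 c A" and ab: "0 \<le> a" "b \<le> 1"
  shows "linear (\<lambda>v. integral {a..b} (\<lambda>t. A t (rep_L2 v t)))"
proof -
  have A': "linear_family a b c A" using linear_family_subinterval[OF A] ab by auto
  have I: "(\<lambda>t. A t (rep_L2 v t)) integrable_on {a..b}" for v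
    by (intro linear_family_integrable[OF A'] sqi_subinterval[OF sqi_rep]) (use ab in auto)
  have lin: "linear (A t)" if "t \<in> {a..b}" for t using A' that by (auto simp: linear_family_def)
  show ?thesis
  proof (rule linearI)
    fix v w :: "'k L2"
    have "integral {a..b} (\<lambda>t. A t (rep_L2 (v + w) t)) = integral {a..b} (\<lambda>t. A t (rep_L2 v t + rep_L2 w t))"
      by (rule integral_ae_eq[OF ae_eq_compose[OF rep_L2_add] ab])
    also have "\<dots> = integral {a..b} (\<lambda>t. A t (rep_L2 v t) + A t (rep_L2 w t))"
      by (rule integral_cong) (simp add: linear_add[OF lin])
    finally show "integral {a..b} (\<lambda>t. A t (rep_L2 (v + w) t))
      = integral {a..b} (\<lambda>t. A t (rep_L2 v t)) + integral {a..b} (\<lambda>t. A t (rep_L2 w t))"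
      by (simp add: integral_add[OF I I])
  next
    fix r and v :: "'k L2"
    have "integral {a..b} (\<lambda>t. A t (rep_L2 (r *\<^sub>R v) t)) = integral {a..b} (\<lambda>t. A t (r *\<^sub>R rep_L2 v t))"
      by (rule integral_ae_eq[OF ae_eq_compose[OF rep_L2_scaleR] ab])
    also have "\<dots> = integral {a..b} (\<lambda>t. r *\<^sub>R A t (rep_L2 v t))"
      by (rule integral_cong) (simp add: linear_scale[OF lin])
    finally show "integral {a..b} (\<lambda>t. A t (rep_L2 (r *\<^sub>R v) t)) = r *\<^sub>R integral {a..b} (\<lambda>t. A t (rep_L2 v t))"
      by simp
  qed
qed

lemma eq_0_if_components_eq_0:
  fixes x :: "'f::euclidean_space" assumes "\<And>b. b \<in> Basis \<Longrightarrow> x \<bullet> b = 0" shows "x = 0"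
  using assms euclidean_all_zero_iff by blast

section \<open>Dominated subspaces and the reversal on classes\<close>

context second_variation_data begin

text \<open>Depending on the sign chosen for \<open>\<sigma>\<close>, this becomes the trivialized
  quadratic form of \<open>K\<close> or of its negative; \<open>W\<close> is the squared norm of
  variations.\<close>

definition Q :: "'k L2 \<Rightarrow> real" where "Q v = causal 0 1 Z Z (rep_L2 v)"
definition W :: "'k L2 \<Rightarrow> real" where "W v = weight 0 1 G (rep_L2 v)"

lemma causal_ae_eq:
  assumes "ae_eq f g" shows "causal 0 1 Z Z f = causal 0 1 Z Z g"
proof -
  have "ae_eq (\<lambda>t. \<sigma> (integral {0..t} (\<lambda>r. Z r (f r))) (Z t (f t))) (\<lambda>t. \<sigma> (integral {0..t} (\<lambda>r. Z r (g r))) (Z t (g t)))"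
  proof -
    have eq: "integral {0..t} (\<lambda>r. Z r (f r)) = integral {0..t} (\<lambda>r. Z r (g r))" if "t \<in> {0..1}" for t
      by (rule integral_ae_eq[OF ae_eq_compose[OF assms]]) (use that in auto)
    obtain N where N: "negligible N" "\<And>t. t \<in> {0..1} - N \<Longrightarrow> f t = g t"
      using assms unfolding ae_eq_def by blast
    show ?thesis unfolding ae_eq_def
    proof (intro exI[of _ N] conjI ballI N(1))
      fix t assume "t \<in> {0..1} - N"
      then show "\<sigma> (integral {0..t} (\<lambda>r. Z r (f r))) (Z t (f t)) = \<sigma> (integral {0..t} (\<lambda>r. Z r (g r))) (Z t (g t))"
        using N(2)[of t] eq[of t] by simp
    qed
  qed
  then show ?thesis unfolding causal_def by (rule integral_ae_eq) auto
qed

lemma Q_abs: "sqi 0 1 f \<Longrightarrow> Q (abs_L2 f) = causal 0 1 Z Z f"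
  unfolding Q_def by (rule causal_ae_eq[OF rep_abs_L2])

lemma W_abs: "sqi 0 1 f \<Longrightarrow> W (abs_L2 f) = weight 0 1 G f"
  unfolding W_def weight_def by (rule integral_ae_eq[OF ae_eq_compose[OF rep_abs_L2]]) auto

lemma linear_moment:
  assumes "0 \<le> a" "b \<le> 1"
  shows "linear (\<lambda>v. integral {a..b} (\<lambda>t. Z t (rep_L2 v t)) \<bullet> i)"
  using linear_compose[OF linear_integral_L2[OF Z assms] bounded_linear.linear[OF bounded_linear_inner_left]]
  by (simp add: o_def)

definition reversal_L2 :: "real \<Rightarrow> (nat \<Rightarrow> real) \<Rightarrow> nat \<Rightarrow> 'k L2 \<Rightarrow> 'k L2" where
  "reversal_L2 \<beta> p m v = abs_L2 (reversal \<beta> p m (rep_L2 v))"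

text \<open>The difference of the two functions has energy zero, and so has its reversal.\<close>

lemma abs_reversal_eqI:
  assumes g: "grid p m h" and \<beta>: "0 < \<beta>" "\<beta> \<le> 1" and f: "sqi 0 1 f" "sqi 0 1 f'" and eq: "ae_eq f f'"
  shows "abs_L2 (reversal \<beta> p m f) = abs_L2 (reversal \<beta> p m f')"
proof -
  let ?d = "\<lambda>t. f t - f' t"
  have d: "sqi 0 1 ?d" by (rule sqi_diff[OF f])
  have "energy 0 1 ?d = energy 0 1 (\<lambda>t. 0 :: 'k)"
    unfolding energy_def by (rule integral_ae_eq) (use eq in \<open>auto simp: ae_eq_def\<close>)
  then have "energy 0 1 (reversal \<beta> p m ?d) \<le> 0" using energy_reversal_le[OF g d \<beta>] by (simp add: energy_def)
  then have z: "energy 0 1 (reversal \<beta> p m ?d) = 0" using energy_nonneg[of 0 1 "reversal \<beta> p m ?d"] by linarith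
  let ?r = "\<lambda>f. reversal \<beta> p m f"
  have R: "sqi 0 1 (?r f)" "sqi 0 1 (?r f')" "sqi 0 1 (?r ?d)" using sqi_reversal[OF g _ \<beta>] f d by auto
  have "abs_L2 (?r f) = abs_L2 (?r f') + abs_L2 (?r ?d)"
    using abs_L2_add[OF R(2,3)] by (simp add: reversal_linear(3))
  moreover have "abs_L2 (?r ?d) = 0" using energy_abs_L2[OF R(3)] z by simp
  ultimately show ?thesis by simp
qed

lemma linear_reversal_L2:
  assumes g: "grid p m h" and \<beta>: "0 < \<beta>" "\<beta> \<le> 1"
  shows "linear (reversal_L2 \<beta> p m)"
proof (rule linearI)
  fix v w :: "'k L2" and r :: real
  have R: "sqi 0 1 (reversal \<beta> p m (rep_L2 v))" for v by (rule sqi_reversal[OF g sqi_rep \<beta>])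
  have "reversal_L2 \<beta> p m (v + w) = abs_L2 (reversal \<beta> p m (\<lambda>t. rep_L2 v t + rep_L2 w t))"
    unfolding reversal_L2_def by (rule abs_reversal_eqI[OF g \<beta> sqi_rep sqi_add[OF sqi_rep sqi_rep] rep_L2_add])
  also have "reversal \<beta> p m (\<lambda>t. rep_L2 v t + rep_L2 w t)
    = (\<lambda>t. reversal \<beta> p m (rep_L2 v) t + reversal \<beta> p m (rep_L2 w) t)"
    by (rule ext) (rule reversal_linear(1))
  finally show "reversal_L2 \<beta> p m (v + w) = reversal_L2 \<beta> p m v + reversal_L2 \<beta> p m w"
    by (simp add: reversal_L2_def abs_L2_add[OF R R])
  have "reversal_L2 \<beta> p m (r *\<^sub>R v) = abs_L2 (reversal \<beta> p m (\<lambda>t. r *\<^sub>R rep_L2 v t))"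
    unfolding reversal_L2_def by (rule abs_reversal_eqI[OF g \<beta> sqi_rep sqi_scaleR[OF sqi_rep] rep_L2_scaleR])
  also have "reversal \<beta> p m (\<lambda>t. r *\<^sub>R rep_L2 v t) = (\<lambda>t. r *\<^sub>R reversal \<beta> p m (rep_L2 v) t)"
    by (rule ext) (rule reversal_linear(2))
  finally show "reversal_L2 \<beta> p m (r *\<^sub>R v) = r *\<^sub>R reversal_L2 \<beta> p m v"
    by (simp add: reversal_L2_def abs_L2_scaleR[OF R])
qed

text \<open>The counterpart of \<open>dominating\<close> in the trivialization. It ranges over all
  classes; membership in the space of variations is recovered from a vanishing total integral of
  \<open>Z\<close>.\<close>

definition W_dominated :: "real \<Rightarrow> 'k L2 set \<Rightarrow> bool" where
  "W_dominated s B \<longleftrightarrow> finite B \<and> independent B \<and> (\<forall>v\<in>span B. s * W v \<le> Q v)"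

text \<open>On the common kernel of the components of the block moments, \<open>m * DIM('f)\<close>
  in number, the energy vanishes, so no independent vector is left.\<close>

lemma W_dominated_card_le:
  assumes g: "grid p m h" and s: "s > 0" and small: "Cs * Cz\<^sup>2 * h < s * g\<^sub>0" and B: "W_dominated s B"
  shows "card B \<le> m * DIM('f)"
proof -
  define F where "F = (\<lambda>(j, i) v. integral {p j..p (Suc j)} (\<lambda>t. Z t (rep_L2 v t)) \<bullet> (i::'f))"
  let ?I = "{..<m} \<times> (Basis :: 'f set)"
  have "\<exists>B'\<subseteq>span B. independent B' \<and> finite B' \<and> card B \<le> card B' + card ?I \<and> (\<forall>v\<in>span B'. \<forall>i\<in>?I. F i v = 0)"
  proof (rule independent_in_kernel)
    show "linear (F x)" if x: "x \<in> ?I" for x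
      using x grid_range[OF g, of "fst x"] grid_range[OF g, of "Suc (fst x)"] unfolding F_def
      by (cases x) (auto intro!: linear_moment)
  qed (use B in \<open>auto simp: W_dominated_def\<close>)
  then obtain B' where B': "B' \<subseteq> span B" "independent B'" "card B \<le> card B' + card ?I"
    "\<And>v x. v \<in> span B' \<Longrightarrow> x \<in> ?I \<Longrightarrow> F x v = 0" by blast
  have "v = 0" if v: "v \<in> B'" for v
  proof -
    have "energy 0 1 (rep_L2 v) = 0"
    proof (rule energy_eq_0_if_vanishing_moments[OF g sqi_rep _ _ s small])
      show "s * weight 0 1 G (rep_L2 v) \<le> causal 0 1 Z Z (rep_L2 v)"
        using B B'(1) v unfolding W_dominated_def W_def Q_def by blast
      show "integral {p j..p (Suc j)} (\<lambda>t. Z t (rep_L2 v t)) = 0" if "j < m" for j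
        by (rule eq_0_if_components_eq_0) (use B'(4)[OF span_base[OF v], of "(j, _)"] that in \<open>auto simp: F_def\<close>)
    qed
    then show "v = 0" using norm_L2_energy[of v] by simp
  qed
  then have "B' = {}" using B'(2) dependent_zero by blast
  then show ?thesis using B'(3) by simp
qed

text \<open>Three vector conditions per block are imposed: zero mean on the kept part, on the tail,
  and of the reversed function on the whole block. On what remains the reversal is injective and
  carries the lower bound from \<open>Q\<close> to \<open>- Q\<close>.\<close>

lemma W_dominated_swap:
  assumes g: "grid p m h" and s: "s > 0" and \<beta>: "1/2 \<le> \<beta>" "\<beta> < 1"
    and small: "Cs * Cz\<^sup>2 * (1 - \<beta>) * h \<le> s * g\<^sub>0 / 2"
    and gain: "12 * Cs * Cz * L * h\<^sup>2 + 4 * s * L * h \<le> s * (1 - \<beta>) * g\<^sub>0"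
    and B: "W_dominated s B"
  shows "\<exists>B'. finite B' \<and> independent B' \<and> (\<forall>v\<in>span B'. s * W v \<le> - Q v) \<and>
    (\<forall>v\<in>span B'. integral {0..1} (\<lambda>t. Z t (rep_L2 v t)) = 0) \<and> card B \<le> card B' + 3 * (m * DIM('f))"
proof -
  have \<beta>': "0 < \<beta>" "\<beta> \<le> 1" using \<beta> by auto
  let ?T = "reversal_L2 \<beta> p m"
  have T: "linear ?T" by (rule linear_reversal_L2[OF g \<beta>'])
  define e where "e j = p j + \<beta> * (p (Suc j) - p j)" for j
  note r = block_cut[OF g _ \<beta>', folded e_def]
  define F where "F = (\<lambda>(j, i::'f, k::nat) v.
    (if k = 0 then integral {p j..e j} (\<lambda>t. Z t (rep_L2 v t)) \<bullet> i
     else if k = 1 then integral {e j..p (Suc j)} (\<lambda>t. Z t (rep_L2 v t)) \<bullet> i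
     else integral {p j..p (Suc j)} (\<lambda>t. Z t (rep_L2 (?T v) t)) \<bullet> i))"
  let ?I = "{..<m} \<times> (Basis :: 'f set) \<times> {..<3::nat}"
  have "\<exists>B'\<subseteq>span B. independent B' \<and> finite B' \<and> card B \<le> card B' + card ?I \<and> (\<forall>v\<in>span B'. \<forall>i\<in>?I. F i v = 0)"
  proof (rule independent_in_kernel)
    fix x assume x: "x \<in> ?I"
    obtain j i k where x': "x = (j, i, k)" by (cases x) auto
    have j: "j < m" using x x' by simp
    have "linear (\<lambda>v. integral {p j..p (Suc j)} (\<lambda>t. Z t (rep_L2 (?T v) t)) \<bullet> i)"
      using linear_compose[OF T linear_moment[of "p j" "p (Suc j)" i]] r[OF j] by (simp add: o_def)
    moreover have "linear (\<lambda>v. integral {p j..e j} (\<lambda>t. Z t (rep_L2 v t)) \<bullet> i)"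
      "linear (\<lambda>v. integral {e j..p (Suc j)} (\<lambda>t. Z t (rep_L2 v t)) \<bullet> i)"
      using r[OF j] by (auto intro!: linear_moment)
    ultimately show "linear (F x)" unfolding F_def x' by (cases "k = 0"; cases "k = 1") simp_all
  qed (use B in \<open>auto simp: W_dominated_def\<close>)
  then obtain B' where B': "B' \<subseteq> span B" "independent B'" "finite B'" "card B \<le> card B' + card ?I"
    "\<And>v x. v \<in> span B' \<Longrightarrow> x \<in> ?I \<Longrightarrow> F x v = 0" by blast
  have mean1: "integral {p j..e j} (\<lambda>t. Z t (rep_L2 v t)) = 0"
    and mean2: "integral {e j..p (Suc j)} (\<lambda>t. Z t (rep_L2 v t)) = 0"
    and mean3: "integral {p j..p (Suc j)} (\<lambda>t. Z t (rep_L2 (?T v) t)) = 0"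
    if v: "v \<in> span B'" and j: "j < m" for v j
  proof -
    have F: "F (j, i, k) v = 0" if "i \<in> Basis" "k < 3" for i k
      by (rule B'(5)[OF v]) (use j that in simp)
    show "integral {p j..e j} (\<lambda>t. Z t (rep_L2 v t)) = 0"
      by (rule eq_0_if_components_eq_0) (use F[of _ 0] in \<open>simp add: F_def\<close>)
    show "integral {e j..p (Suc j)} (\<lambda>t. Z t (rep_L2 v t)) = 0"
      by (rule eq_0_if_components_eq_0) (use F[of _ 1] in \<open>simp add: F_def\<close>)
    show "integral {p j..p (Suc j)} (\<lambda>t. Z t (rep_L2 (?T v) t)) = 0"
      by (rule eq_0_if_components_eq_0) (use F[of _ 2] in \<open>simp add: F_def\<close>)
  qed
  have R: "sqi 0 1 (reversal \<beta> p m (rep_L2 v))" for v by (rule sqi_reversal[OF g sqi_rep \<beta>'])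
  have mean3': "integral {p j..p (Suc j)} (\<lambda>t. Z t (reversal \<beta> p m (rep_L2 v) t)) = 0"
    if "v \<in> span B'" "j < m" for v j
  proof -
    have "integral {p j..p (Suc j)} (\<lambda>t. Z t (rep_L2 (?T v) t)) = integral {p j..p (Suc j)} (\<lambda>t. Z t (reversal \<beta> p m (rep_L2 v) t))"
      unfolding reversal_L2_def
      by (rule integral_ae_eq[OF ae_eq_compose[OF rep_abs_L2[OF R]]]) (use r[OF that(2)] in auto)
    then show ?thesis using mean3[OF that] by simp
  qed
  have sub: "span B' \<subseteq> span B" using B'(1) by (simp add: span_minimal)
  have dom: "s * weight 0 1 G (rep_L2 v) \<le> causal 0 1 Z Z (rep_L2 v)" if "v \<in> span B'" for v
    using B sub that unfolding W_dominated_def W_def Q_def by blast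
  have key: "s * weight 0 1 G (reversal \<beta> p m (rep_L2 v)) \<le> - causal 0 1 Z Z (reversal \<beta> p m (rep_L2 v))"
    "energy 0 1 (reversal \<beta> p m (rep_L2 v)) = 0 \<Longrightarrow> energy 0 1 (rep_L2 v) = 0" if v: "v \<in> span B'" for v
  proof -
    note hyps = mean1[OF v, unfolded e_def] mean2[OF v, unfolded e_def] mean3'[OF v] dom[OF v]
    show "s * weight 0 1 G (reversal \<beta> p m (rep_L2 v)) \<le> - causal 0 1 Z Z (reversal \<beta> p m (rep_L2 v))"
      by (rule reversal_dominates(1)[OF g sqi_rep s \<beta> _ _ _ _ small gain]) (simp_all add: hyps)
    show "energy 0 1 (reversal \<beta> p m (rep_L2 v)) = 0 \<Longrightarrow> energy 0 1 (rep_L2 v) = 0"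
      by (rule reversal_dominates(2)[OF g sqi_rep s \<beta> _ _ _ _ small gain]) (simp_all add: hyps)
  qed
  have inj: "inj_on ?T (span B')"
  proof (rule linear_inj_on_iff_eq_0[THEN iffD2, OF T subspace_span], intro ballI impI)
    fix v assume v: "v \<in> span B'" "?T v = 0"
    then have "energy 0 1 (reversal \<beta> p m (rep_L2 v)) = 0"
      using energy_abs_L2[OF R, of v] by (simp add: reversal_L2_def)
    then have "energy 0 1 (rep_L2 v) = 0" using key(2) v(1) by blast
    then show "v = 0" using norm_L2_energy[of v] by simp
  qed
  show ?thesis
  proof (intro exI[of _ "?T ` B'"] conjI)
    show "finite (?T ` B')" using B'(3) by simp
    show "independent (?T ` B')" by (rule linear_independent_injective_image[OF T B'(2) inj])
    have sp: "span (?T ` B') = ?T ` span B'" by (rule linear_span_image[OF T])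
    show "\<forall>v\<in>span (?T ` B'). s * W v \<le> - Q v"
      unfolding sp using key(1) by (auto simp: reversal_L2_def W_abs[OF R] Q_abs[OF R])
    \<comment> \<open>The block means of a reversed function add up to its total integral, whose
      vanishing makes it a variation after transport back.\<close>
    show "\<forall>v\<in>span (?T ` B'). integral {0..1} (\<lambda>t. Z t (rep_L2 v t)) = 0"
    proof
      fix w assume "w \<in> span (?T ` B')"
      then obtain v where v: "v \<in> span B'" "w = ?T v" unfolding sp by blast
      show "integral {0..1} (\<lambda>t. Z t (rep_L2 w t)) = 0"
      proof (rule eq_0_if_components_eq_0)
        fix i :: 'f
        have I: "(\<lambda>t. Z t (rep_L2 w t)) integrable_on {0..1}" by (rule linear_family_integrable[OF Z sqi_rep])
        have "integral {0..1} (\<lambda>t. Z t (rep_L2 w t)) \<bullet> i = (\<Sum>j<m. integral {p j..p (Suc j)} (\<lambda>t. Z t (rep_L2 w t)) \<bullet> i)"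
        proof (rule grid_sum[OF g, where \<Phi> = "\<lambda>a b. integral {a..b} (\<lambda>t. Z t (rep_L2 w t)) \<bullet> i"])
          fix k assume k: "k < m"
          have rk: "0 \<le> p k" "p k \<le> p (Suc k)" "p (Suc k) \<le> 1"
            using k grid_range[OF g, of k] grid_range[OF g, of "Suc k"] grid_mono[OF g, of k "Suc k"] by auto
          have "(\<lambda>t. Z t (rep_L2 w t)) integrable_on {0..p (Suc k)}"
            using I rk by (auto intro: integrable_on_subinterval)
          from Henstock_Kurzweil_Integration.integral_combine[OF rk(1,2) this]
          show "integral {0..p (Suc k)} (\<lambda>t. Z t (rep_L2 w t)) \<bullet> i = integral {0..p k} (\<lambda>t. Z t (rep_L2 w t)) \<bullet> i +
            integral {p k..p (Suc k)} (\<lambda>t. Z t (rep_L2 w t)) \<bullet> i" by (simp add: inner_add_left[symmetric])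
        qed simp
        then show "integral {0..1} (\<lambda>t. Z t (rep_L2 w t)) \<bullet> i = 0" using mean3[OF v(1)] v(2) by simp
      qed
    qed
    have "card (?T ` B') = card B'" using inj inj_on_subset span_superset by (blast intro: card_image)
    then show "card B \<le> card (?T ` B') + 3 * (m * DIM('f))" using B'(4) by (simp add: card_cartesian_product mult_ac)
  qed
qed

end

section \<open>Choice of the block length and of the discarded fraction\<close>

context second_variation_data begin

definition pieces :: "(nat \<Rightarrow> real) \<Rightarrow> nat \<Rightarrow> bool" where
  "pieces q n \<longleftrightarrow> q 0 = 0 \<and> q n = 1 \<and> (\<forall>i<n. q i < q (Suc i) \<and> lipschitz_between (q i) (q (Suc i)))"

text \<open>Each piece is cut into \<open>K\<close> equal parts; pieces have length at most 1, so
  the parts have length at most \<open>1 / K\<close>. Quotient and remainder of the index by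
  \<open>K\<close> give the piece and the position inside it.\<close>

lemma exists_grid:
  assumes q: "pieces q n" and K: "K > 0" "1 / real K \<le> h"
  shows "\<exists>p. grid p (n * K) h"
proof -
  have mono: "q i \<le> q j" if "i \<le> j" "j \<le> n" for i j
    using that
  proof (induction j rule: dec_induct)
    case (step k)
    then have "q k < q (Suc k)" using q by (auto simp: pieces_def)
    then show ?case using step by simp
  qed simp
  define p where "p k = q (k div K) + real (k mod K) / real K * (q (Suc (k div K)) - q (k div K))" for k
  have "p k < p (Suc k) \<and> p (Suc k) - p k \<le> h \<and> lipschitz_between (p k) (p (Suc k))" if k: "k < n * K" for k
  proof -
    define i where "i = k div K"
    define d where "d = (q (Suc i) - q i) / real K"
    have i: "i < n" using k by (simp add: i_def less_mult_imp_div_less)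
    have qi: "q i < q (Suc i)" "lipschitz_between (q i) (q (Suc i))" using q i by (auto simp: pieces_def)
    have r: "k mod K < K" using K by simp
    have pk: "p k = q i + real (k mod K) * d" by (simp add: p_def i_def d_def)
    have pS: "p (Suc k) = q i + real (Suc (k mod K)) * d"
    proof (cases "Suc (k mod K) = K")
      \<comment> \<open>At the end of a piece \<open>Suc k\<close> already refers to the next one,
        whose left end is \<open>q i\<close> plus \<open>K\<close> steps of length
        \<open>d\<close>.\<close>
      case True
      then have "Suc k mod K = 0" "Suc k div K = Suc i" by (simp_all add: mod_Suc div_Suc i_def)
      then show ?thesis using True K by (simp add: p_def d_def del: of_nat_Suc)
    next
      case False
      then have "Suc k mod K = Suc (k mod K)" "Suc k div K = i" by (simp_all add: mod_Suc div_Suc i_def)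
      then show ?thesis by (simp add: p_def d_def)
    qed
    have d0: "d > 0" using qi K by (simp add: d_def)
    have "q (Suc i) - q i \<le> 1" using mono[of 0 i] mono[of "Suc i" n] i q by (auto simp: pieces_def)
    then have "d \<le> 1 / real K" using K by (simp add: d_def divide_right_mono)
    then have "d \<le> h" using K by linarith
    moreover have "q i \<le> p k" using d0 by (simp add: pk)
    moreover have "p (Suc k) \<le> q (Suc i)"
    proof -
      have "real (Suc (k mod K)) * d \<le> real K * d" using r d0 by (intro mult_right_mono) auto
      also have "\<dots> = q (Suc i) - q i" using K by (simp add: d_def)
      finally show ?thesis by (simp add: pS)
    qed
    moreover have "p (Suc k) - p k = d" by (simp add: pk pS algebra_simps)
    ultimately show ?thesis using d0 qi(2) by (auto simp: lipschitz_between_def)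
  qed
  moreover have "p 0 = 0" using q by (simp add: p_def pieces_def)
  moreover have "p (n * K) = 1" using q K by (simp add: p_def pieces_def)
  ultimately show ?thesis unfolding grid_def by blast
qed

lemma exists_grid_card:
  assumes q: "pieces q n" and h: "0 < h"
  obtains p m where "grid p m h" "real m \<le> real n * (1 / h + 1)"
proof -
  define K where "K = nat \<lceil>1 / h\<rceil>"
  have K: "1 / h \<le> real K" "real K \<le> 1 / h + 1" using h by (auto simp: K_def)
  have "1 / h > 0" using h by simp
  then have K0: "K > 0" using K by (cases K) auto
  have "1 / real K \<le> h" using K(1) K0 h by (simp add: field_simps)
  then obtain p where "grid p (n * K) h" using exists_grid[OF q K0] by blast
  moreover have "real (n * K) \<le> real n * (1 / h + 1)" using K(2) by (simp add: mult_left_mono)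
  ultimately show thesis using that by blast
qed

lemma W_dominated_card_bound:
  assumes q: "pieces q n"
  shows "\<exists>M\<ge>0. \<forall>s B. 0 < s \<and> s \<le> 1 \<and> W_dominated s B \<longrightarrow> real (card B) \<le> M / s"
proof -
  define D where "D = real DIM('f)"
  \<comment> \<open>With blocks of length \<open>s * \<kappa>\<close> the form is at most half of
    \<open>s * g\<^sub>0\<close> times the energy.\<close>
  define \<kappa> where "\<kappa> = g\<^sub>0 / (2 * (Cs * Cz\<^sup>2))"
  have \<kappa>0: "\<kappa> > 0" using g0 Cs0 Cz0 by (simp add: \<kappa>_def)
  have "real (card B) \<le> (real n * (1 / \<kappa> + 1) * D) / s" if s: "0 < s" "s \<le> 1" and B: "W_dominated s B" for s B
  proof -
    have "s * \<kappa> > 0" using s \<kappa>0 by simp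
    then obtain p m where p: "grid p m (s * \<kappa>)" "real m \<le> real n * (1 / (s * \<kappa>) + 1)"
      using exists_grid_card[OF q] by blast
    have "Cs * Cz\<^sup>2 * (s * \<kappa>) = s * g\<^sub>0 / 2" using Cs0 Cz0 by (simp add: \<kappa>_def)
    then have "Cs * Cz\<^sup>2 * (s * \<kappa>) < s * g\<^sub>0" using s g0 by simp
    from W_dominated_card_le[OF p(1) s(1) this B] have "real (card B) \<le> real m * D"
      unfolding D_def by (metis of_nat_le_iff of_nat_mult)
    also have "\<dots> \<le> (real n * (1 / (s * \<kappa>) + 1)) * D" using p(2) by (intro mult_right_mono) (auto simp: D_def)
    also have "\<dots> \<le> (real n * (1 / (s * \<kappa>) + 1 / s)) * D"
      using s by (intro mult_right_mono mult_left_mono add_left_mono) (auto simp: D_def)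
    also have "\<dots> = (real n * (1 / \<kappa> + 1) * D) / s" using s \<kappa>0 by (simp add: field_simps)
    finally show ?thesis .
  qed
  moreover have "0 \<le> real n * (1 / \<kappa> + 1) * D" using \<kappa>0 by (simp add: D_def)
  ultimately show ?thesis by blast
qed

text \<open>With \<open>s = x\<^sup>3\<close> the block length is \<open>\<delta> x\<^sup>2\<close>, so that \<open>1 - \<beta>\<close> is of order \<open>x\<close> and the cut off pieces have
  length of order \<open>s\<close>.\<close>

lemma W_dominated_swap_bound:
  assumes q: "pieces q n"
  shows "\<exists>M\<ge>0. \<exists>s\<^sub>0. 0 < s\<^sub>0 \<and> s\<^sub>0 \<le> 1/2 \<and> (\<forall>s B. 0 < s \<and> s \<le> s\<^sub>0 \<and> W_dominated s B \<longrightarrow>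
    (\<exists>B'. finite B' \<and> independent B' \<and> (\<forall>v\<in>span B'. s * W v \<le> - Q v) \<and>
    (\<forall>v\<in>span B'. integral {0..1} (\<lambda>t. Z t (rep_L2 v t)) = 0) \<and> real (card B) \<le> real (card B') + M * s powr (-2/3)))"
proof -
  define D where "D = real DIM('f)"
  \<comment> \<open>The discarded fraction \<open>1 - \<beta>\<close> will be \<kappa> x. The
    constant \<open>\<kappa>\<close> makes the gain beat the errors of freezing \<open>Z\<close> and
    \<open>G\<close>, with the summand 1 keeping it positive; \<open>\<delta>\<close> then makes the
    tails short enough, and \<open>s\<^sub>0\<close> ensures that \<kappa> x is at most 1/2.\<close>
  define \<kappa> where "\<kappa> = (12 * Cs * Cz * L + 4 * L + 1) / g\<^sub>0"
  define \<delta> where "\<delta> = min 1 (g\<^sub>0 / (2 * (Cs * Cz\<^sup>2 * \<kappa>)))"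
  define s\<^sub>0 where "s\<^sub>0 = min (1/2) ((1 / (2 * \<kappa>)) ^ 3)"
  have "12 * Cs * Cz * L + 4 * L + 1 > 0" using L0 Cs0 Cz0 by (simp add: add_nonneg_pos)
  then have \<kappa>0: "\<kappa> > 0" using g0 by (simp add: \<kappa>_def)
  have \<delta>: "0 < \<delta>" "\<delta> \<le> 1" using g0 Cs0 Cz0 \<kappa>0 by (auto simp: \<delta>_def)
  have "\<delta> \<le> g\<^sub>0 / (2 * (Cs * Cz\<^sup>2 * \<kappa>))" by (simp add: \<delta>_def)
  then have \<delta>': "Cs * Cz\<^sup>2 * \<kappa> * \<delta> \<le> g\<^sub>0 / 2" using Cs0 Cz0 \<kappa>0 by (simp add: field_simps)
  have s0: "0 < s\<^sub>0" "s\<^sub>0 \<le> 1/2" using \<kappa>0 by (auto simp: s\<^sub>0_def)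
  let ?M = "3 * (real n * (1 / \<delta> + 1)) * D"
  have "\<exists>B'. finite B' \<and> independent B' \<and> (\<forall>v\<in>span B'. s * W v \<le> - Q v) \<and>
    (\<forall>v\<in>span B'. integral {0..1} (\<lambda>t. Z t (rep_L2 v t)) = 0) \<and> real (card B) \<le> real (card B') + ?M * s powr (-2/3)"
    if s: "0 < s" "s \<le> s\<^sub>0" and B: "W_dominated s B" for s B
  proof -
    define x where "x = s powr (1/3)"
    have x0: "x > 0" using s by (simp add: x_def)
    have x3: "x ^ 3 = s" using s by (simp add: x_def powr_power)
    have x2: "s powr (-2/3) = 1 / x\<^sup>2"
      using s by (simp add: x_def powr_power powr_minus_divide)
    have "x ^ 3 \<le> 1 ^ 3" using x3 s s0 by simp
    then have x1: "x \<le> 1" using power_mono_iff[of x 1 3] x0 by simp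
    have "x ^ 3 \<le> (1 / (2 * \<kappa>)) ^ 3" using x3 s by (simp add: s\<^sub>0_def)
    then have "x \<le> 1 / (2 * \<kappa>)" using power_mono_iff[of x "1 / (2 * \<kappa>)" 3] x0 \<kappa>0 by simp
    then have x\<kappa>: "\<kappa> * x \<le> 1/2" using \<kappa>0 by (simp add: field_simps)
    define h where "h = \<delta> * x\<^sup>2"
    have h0: "h > 0" using \<delta> x0 by (simp add: h_def)
    obtain p m where p: "grid p m h" "real m \<le> real n * (1 / h + 1)"
      using exists_grid_card[OF q h0] by blast
    define \<beta> where "\<beta> = 1 - \<kappa> * x"
    have \<beta>: "1/2 \<le> \<beta>" "\<beta> < 1" using x\<kappa> \<kappa>0 x0 by (auto simp: \<beta>_def)
    have small: "Cs * Cz\<^sup>2 * (1 - \<beta>) * h \<le> s * g\<^sub>0 / 2"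
    proof -
      have "Cs * Cz\<^sup>2 * (1 - \<beta>) * h = (Cs * Cz\<^sup>2 * \<kappa> * \<delta>) * s"
        by (simp add: \<beta>_def h_def x3[symmetric] power2_eq_square power3_eq_cube)
      also have "\<dots> \<le> (g\<^sub>0 / 2) * s" using \<delta>' s by (intro mult_right_mono) auto
      finally show ?thesis by (simp add: mult_ac)
    qed
    have gain: "12 * Cs * Cz * L * h\<^sup>2 + 4 * s * L * h \<le> s * (1 - \<beta>) * g\<^sub>0"
    proof -
      have hx: "h \<le> x * x" using mult_right_mono[OF \<delta>(2), of "x\<^sup>2"] by (simp add: h_def power2_eq_square)
      have "h\<^sup>2 \<le> (x * x)\<^sup>2" using hx h0 by (intro power_mono) auto
      then have h2: "h\<^sup>2 \<le> s * x" by (simp add: x3[symmetric] power2_eq_square power3_eq_cube mult_ac)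
      have "x * x \<le> 1 * x" using x1 x0 by (intro mult_right_mono) auto
      then have h1: "h \<le> x" using hx by simp
      have "12 * Cs * Cz * L * h\<^sup>2 + 4 * s * L * h \<le> 12 * Cs * Cz * L * (s * x) + 4 * s * L * x"
        using h1 h2 L0 Cs0 Cz0 s by (intro add_mono mult_left_mono) auto
      also have "\<dots> \<le> (12 * Cs * Cz * L + 4 * L + 1) * (s * x)" using s x0 by (simp add: algebra_simps)
      also have "\<dots> = s * (1 - \<beta>) * g\<^sub>0" using g0 by (simp add: \<beta>_def \<kappa>_def)
      finally show ?thesis .
    qed
    obtain B' where B': "finite B'" "independent B'" "\<forall>v\<in>span B'. s * W v \<le> - Q v"
      "\<forall>v\<in>span B'. integral {0..1} (\<lambda>t. Z t (rep_L2 v t)) = 0" "card B \<le> card B' + 3 * (m * DIM('f))"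
      using W_dominated_swap[OF p(1) s(1) \<beta> small gain B] by blast
    have "1 \<le> 1 / x\<^sup>2" using x0 x1 by (simp add: power_le_one)
    then have "1 / h + 1 \<le> (1 / \<delta> + 1) * (1 / x\<^sup>2)" by (simp add: h_def add_divide_distrib)
    then have "real m \<le> real n * ((1 / \<delta> + 1) * (1 / x\<^sup>2))" using p(2) by (meson mult_left_mono of_nat_0_le_iff order_trans)
    then have "3 * (real m * D) \<le> 3 * (real n * ((1 / \<delta> + 1) * (1 / x\<^sup>2)) * D)"
      by (intro mult_left_mono mult_right_mono) (auto simp: D_def)
    also have "\<dots> = ?M * s powr (-2/3)" unfolding x2 by simp
    finally have "3 * (real m * D) \<le> ?M * s powr (-2/3)" .
    moreover have "real (card B) \<le> real (card B' + 3 * (m * DIM('f)))" using B'(5) by (simp only: of_nat_le_iff)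
    then have "real (card B) \<le> real (card B') + 3 * (real m * D)" by (simp add: D_def)
    ultimately have "real (card B) \<le> real (card B') + ?M * s powr (-2/3)" by linarith
    then show ?thesis using B' by blast
  qed
  moreover have "0 \<le> ?M" using \<delta> by (simp add: D_def)
  ultimately show ?thesis using s0 by blast
qed

end

section \<open>Analytic families and symmetry of second derivatives\<close>

text \<open>Termwise differentiation. Continuity of the derivative at the centre suffices later,
  because every point of a closed piece is the centre of an expansion.\<close>

lemma power_series_C1:
  fixes f :: "real \<Rightarrow> real"
  assumes r: "r > 0" and f: "\<And>y. \<bar>y - x\<bar> < r \<Longrightarrow> (\<lambda>n. (y - x) ^ n * a n) sums f y"
  shows "\<And>y. \<bar>y - x\<bar> < r \<Longrightarrow> (f has_real_derivative deriv f y) (at y)" and "isCont (deriv f) x"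
proof -
  define F where "F h = (\<Sum>n. a n * h ^ n)" for h
  define F' where "F' h = (\<Sum>n. diffs a n * h ^ n)" for h
  have S: "summable (\<lambda>n. a n * h ^ n)" if "norm h < r" for h
    using sums_summable[OF f[of "x + h"]] that by (simp add: mult.commute)
  have S': "summable (\<lambda>n. diffs a n * h ^ n)" if "norm h < r" for h
    by (rule termdiff_converges[OF that]) (rule S)
  have D: "(F has_real_derivative F' h) (at h)" if "norm h < r" for h
    unfolding F_def[abs_def] F'_def by (rule termdiffs_strong'[OF S that])
  have D': "isCont F' h" if "norm h < r" for h
    unfolding F'_def[abs_def] by (rule DERIV_isCont[OF termdiffs_strong'[OF S' that]])
  have eq: "f y = F (y - x)" if "\<bar>y - x\<bar> < r" for y
    using sums_unique[OF f[OF that]] by (simp add: F_def mult.commute)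
  have Df: "(f has_real_derivative F' (y - x)) (at y)" if y: "\<bar>y - x\<bar> < r" for y
  proof -
    have "((\<lambda>y. F (y - x)) has_real_derivative F' (y - x)) (at y)"
      using DERIV_shift[of F "F' (y - x)" y "- x"] D[of "y - x"] y by simp
    moreover have "open {y. \<bar>y - x\<bar> < r}" by (intro open_Collect_less continuous_intros)
    ultimately show ?thesis
      by (rule has_field_derivative_transform_within_open[where S = "{y. \<bar>y - x\<bar> < r}"]) (use y eq in auto)
  qed
  show "(f has_real_derivative deriv f y) (at y)" if "\<bar>y - x\<bar> < r" for y
    using Df[OF that] DERIV_imp_deriv by metis
  have "isCont (\<lambda>y. F' (y - x)) x"
    by (rule isCont_o2[where g = F' and f = "\<lambda>y. y - x"]) (use D'[of 0] r in auto)
  moreover have "\<forall>\<^sub>F y in nhds x. F' (y - x) = deriv f y"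
  proof -
    have "\<forall>\<^sub>F y in nhds x. y \<in> {y. \<bar>y - x\<bar> < r}"
      by (rule eventually_nhds_in_open) (use r in \<open>auto intro!: open_Collect_less continuous_intros\<close>)
    then show ?thesis by eventually_elim (use Df DERIV_imp_deriv in fastforce)
  qed
  ultimately show "isCont (deriv f) x" using isCont_cong by fast
qed

text \<open>Expansions at the endpoints make the derivative continuous up to them, hence bounded on
  the compact interval; the mean value estimate is then applied to each component.\<close>

lemma real_analytic_on_Lipschitz:
  fixes g :: "real \<Rightarrow> 'b::euclidean_space"
  assumes g: "real_analytic_on {a..b} g"
  obtains L where "L \<ge> 0" "\<And>s t. s \<in> {a..b} \<Longrightarrow> t \<in> {a..b} \<Longrightarrow> norm (g s - g t) \<le> L * \<bar>s - t\<bar>"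
proof -
  have "\<exists>B\<ge>0. \<forall>s\<in>{a..b}. \<forall>t\<in>{a..b}. \<bar>g s \<bullet> i - g t \<bullet> i\<bar> \<le> B * \<bar>s - t\<bar>" for i
  proof -
    let ?f = "\<lambda>y. g y \<bullet> i"
    have C1: "(?f has_real_derivative deriv ?f x) (at x) \<and> isCont (deriv ?f) x" if x: "x \<in> {a..b}" for x
    proof -
      obtain r c where r: "r > 0" "\<And>y. \<bar>y - x\<bar> < r \<Longrightarrow> (\<lambda>n. (y - x) ^ n *\<^sub>R c n) sums g y"
        using g x unfolding real_analytic_on_def by blast
      have "(\<lambda>n. (y - x) ^ n * (c n \<bullet> i)) sums ?f y" if "\<bar>y - x\<bar> < r" for y
        using bounded_linear.sums[OF bounded_linear_inner_left r(2)[OF that], of i] by simp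
      from power_series_C1[OF r(1) this] show ?thesis using r(1) by simp
    qed
    have "continuous_on {a..b} (deriv ?f)" using C1 by (intro continuous_at_imp_continuous_on) blast
    then have "bounded (deriv ?f ` {a..b})" by (intro compact_imp_bounded compact_continuous_image) auto
    then obtain B where B: "B > 0" "\<And>x. x \<in> {a..b} \<Longrightarrow> \<bar>deriv ?f x\<bar> \<le> B" unfolding bounded_pos by auto
    have "\<bar>?f s - ?f t\<bar> \<le> B * \<bar>s - t\<bar>" if st: "s \<in> {a..b}" "t \<in> {a..b}" for s t
    proof -
      have "norm (?f s - ?f t) \<le> B * norm (s - t)"
        by (rule field_differentiable_bound[where S = "{a..b}" and f' = "deriv ?f"])
          (use st B(2) C1 in \<open>auto intro: has_field_derivative_at_within\<close>)
      then show ?thesis by simp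
    qed
    then show ?thesis using B(1) by (intro exI[of _ B]) auto
  qed
  then obtain B where B: "\<And>i. B i \<ge> 0" "\<And>i s t. s \<in> {a..b} \<Longrightarrow> t \<in> {a..b} \<Longrightarrow> \<bar>g s \<bullet> i - g t \<bullet> i\<bar> \<le> B i * \<bar>s - t\<bar>"
    by metis
  have "norm (g s - g t) \<le> (\<Sum>i\<in>Basis. B i) * \<bar>s - t\<bar>" if "s \<in> {a..b}" "t \<in> {a..b}" for s t
  proof -
    have "norm (g s - g t) \<le> (\<Sum>i\<in>Basis. \<bar>(g s - g t) \<bullet> i\<bar>)" by (rule norm_le_l1)
    also have "\<dots> \<le> (\<Sum>i\<in>Basis. B i * \<bar>s - t\<bar>)"
      using B(2)[OF that] by (intro sum_mono) (simp add: inner_diff_left)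
    finally show ?thesis by (simp add: sum_distrib_right)
  qed
  then show ?thesis using that[of "\<Sum>i\<in>Basis. B i"] B(1) by (simp add: sum_nonneg)
qed

text \<open>The mean value theorem along \<open>v\<close> turns the second difference into an
  increment of the \<open>v\<close>-derivative, which is differentiable at \<open>y\<close>. Since
  the second difference is symmetric in \<open>v\<close> and \<open>w\<close>, symmetry of the
  second derivative follows from uniqueness of the limit.\<close>

lemma second_difference_tendsto:
  fixes f :: "'a::real_normed_vector \<Rightarrow> real"
  assumes S: "open S" "y \<in> S" and f: "\<And>x. x \<in> S \<Longrightarrow> f differentiable (at x)"
    and D: "(\<lambda>x. frechet_derivative f (at x) v) differentiable (at y)"
  shows "((\<lambda>h. (f (y + h *\<^sub>R v + h *\<^sub>R w) - f (y + h *\<^sub>R v) - f (y + h *\<^sub>R w) + f y) / h\<^sup>2)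
    \<longlongrightarrow> frechet_derivative (\<lambda>x. frechet_derivative f (at x) v) (at y) w) (at_right 0)"
proof (rule tendstoI)
  fix e :: real assume e: "e > 0"
  define Dv where "Dv x = frechet_derivative f (at x) v" for x
  define A where "A = frechet_derivative Dv (at y)"
  have A: "(Dv has_derivative A) (at y)"
    using D frechet_derivative_works[of Dv "at y"] unfolding A_def Dv_def[abs_def] by blast
  interpret A: bounded_linear A using A by (rule has_derivative_bounded_linear)
  \<comment> \<open>\<open>h * N\<close> bounds all displacements in the second difference. With the
    following \<open>e'\<close>, two errors of size \<open>e' * (h * N)\<close> divided by
    \<open>h\<close> add up to \<open>e / 2\<close>.\<close>
  define N where "N = norm v + norm w + 1"
  define e' where "e' = e / (4 * N)"
  have N0: "N > 0" by (simp add: N_def add_nonneg_pos)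
  have e'0: "e' > 0" using e N0 by (simp add: e'_def)
  obtain d1 where d1: "d1 > 0" "\<And>x. norm (x - y) < d1 \<Longrightarrow> norm (Dv x - Dv y - A (x - y)) \<le> e' * norm (x - y)"
    using A e'0 unfolding has_derivative_at_alt by blast
  obtain d2 where d2: "d2 > 0" "ball y d2 \<subseteq> S" using S open_contains_ball by blast
  define d where "d = min d1 d2 / N"
  have d0: "d > 0" using d1 d2 N0 by (simp add: d_def)
  have main: "dist ((f (y + h *\<^sub>R v + h *\<^sub>R w) - f (y + h *\<^sub>R v) - f (y + h *\<^sub>R w) + f y) / h\<^sup>2) (A w) < e"
    if h: "0 < h" "h < d" for h
  proof -
    have near: "norm (s *\<^sub>R v + t *\<^sub>R w) \<le> h * N" "norm (s *\<^sub>R v + t *\<^sub>R w) < d1" "y + s *\<^sub>R v + t *\<^sub>R w \<in> S"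
      if st: "0 \<le> s" "s \<le> h" "0 \<le> t" "t \<le> h" for s t
    proof -
      have "norm (s *\<^sub>R v + t *\<^sub>R w) \<le> s * norm v + t * norm w"
        using norm_triangle_ineq[of "s *\<^sub>R v" "t *\<^sub>R w"] st by simp
      also have "\<dots> \<le> h * norm v + h * norm w" using st by (intro add_mono mult_right_mono) auto
      also have "\<dots> \<le> h * N" using h by (simp add: N_def algebra_simps)
      finally show *: "norm (s *\<^sub>R v + t *\<^sub>R w) \<le> h * N" .
      have "h * N < min d1 d2" using h N0 by (simp add: d_def field_simps)
      then show "norm (s *\<^sub>R v + t *\<^sub>R w) < d1" using * by simp
      have "dist y (y + z) = norm z" for z by (simp add: dist_norm)
      then have "dist y (y + (s *\<^sub>R v + t *\<^sub>R w)) < d2" using * \<open>h * N < min d1 d2\<close> by simp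
      then show "y + s *\<^sub>R v + t *\<^sub>R w \<in> S" using d2(2) by (auto simp: add.assoc)
    qed
    define G where "G s = f (y + s *\<^sub>R v + h *\<^sub>R w) - f (y + s *\<^sub>R v)" for s
    have DG: "(G has_real_derivative Dv (y + s *\<^sub>R v + h *\<^sub>R w) - Dv (y + s *\<^sub>R v)) (at s)" if s: "0 \<le> s" "s \<le> h" for s
    proof -
      have D1: "((\<lambda>s. f (y + s *\<^sub>R v + z)) has_real_derivative Dv (y + s *\<^sub>R v + z)) (at s)"
        if "y + s *\<^sub>R v + z \<in> S" for z
      proof -
        have 1: "(f has_derivative frechet_derivative f (at (y + s *\<^sub>R v + z))) (at (y + s *\<^sub>R v + z))"
          using f[OF that] frechet_derivative_works by blast
        have 2: "((\<lambda>s. y + s *\<^sub>R v + z) has_derivative (\<lambda>r. r *\<^sub>R v)) (at s)"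
          by (auto intro!: derivative_eq_intros)
        have "((\<lambda>s. f (y + s *\<^sub>R v + z)) has_derivative (\<lambda>r. frechet_derivative f (at (y + s *\<^sub>R v + z)) (r *\<^sub>R v))) (at s)"
          using diff_chain_at[OF 2 1] by (simp add: o_def)
        moreover have "frechet_derivative f (at (y + s *\<^sub>R v + z)) (r *\<^sub>R v) = Dv (y + s *\<^sub>R v + z) * r" for r
          using linear_scale[OF has_derivative_linear[OF 1]] by (simp add: Dv_def mult.commute)
        ultimately show ?thesis by (simp add: has_field_derivative_def)
      qed
      show ?thesis unfolding G_def[abs_def]
        using D1[of "h *\<^sub>R w"] D1[of 0] near(3)[OF s, of h] near(3)[OF s, of 0] h
        by (auto intro!: DERIV_diff)
    qed
    obtain \<xi> where \<xi>: "0 < \<xi>" "\<xi> < h" "G h - G 0 = (h - 0) * (Dv (y + \<xi> *\<^sub>R v + h *\<^sub>R w) - Dv (y + \<xi> *\<^sub>R v))"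
      using MVT2[OF h(1), of G "\<lambda>s. Dv (y + s *\<^sub>R v + h *\<^sub>R w) - Dv (y + s *\<^sub>R v)"] DG by blast
    let ?z1 = "\<xi> *\<^sub>R v + h *\<^sub>R w" and ?z2 = "\<xi> *\<^sub>R v + 0 *\<^sub>R w"
    have b1: "\<bar>Dv (y + ?z1) - Dv y - A ?z1\<bar> \<le> e' * (h * N)" "\<bar>Dv (y + ?z2) - Dv y - A ?z2\<bar> \<le> e' * (h * N)"
    proof -
      have *: "\<bar>Dv (y + z) - Dv y - A z\<bar> \<le> e' * (h * N)" if "norm z < d1" "norm z \<le> h * N" for z
      proof -
        have "\<bar>Dv (y + z) - Dv y - A z\<bar> \<le> e' * norm z" using d1(2)[of "y + z"] that(1) by simp
        also have "\<dots> \<le> e' * (h * N)" using that(2) e'0 by (intro mult_left_mono) auto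
        finally show ?thesis .
      qed
      show "\<bar>Dv (y + ?z1) - Dv y - A ?z1\<bar> \<le> e' * (h * N)" "\<bar>Dv (y + ?z2) - Dv y - A ?z2\<bar> \<le> e' * (h * N)"
        using \<xi> h by (auto intro!: * near simp del: scaleR_zero_left)
    qed
    have Aw: "A ?z1 - A ?z2 = h * A w" by (simp add: A.add A.scaleR A.zero)
    have X: "\<bar>(Dv (y + \<xi> *\<^sub>R v + h *\<^sub>R w) - Dv (y + \<xi> *\<^sub>R v)) - h * A w\<bar> \<le> 2 * (e' * (h * N))"
      using b1 Aw by (simp add: add.assoc)
    have "(f (y + h *\<^sub>R v + h *\<^sub>R w) - f (y + h *\<^sub>R v) - f (y + h *\<^sub>R w) + f y) / h\<^sup>2
      = (Dv (y + \<xi> *\<^sub>R v + h *\<^sub>R w) - Dv (y + \<xi> *\<^sub>R v)) / h"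
    proof -
      have "f (y + h *\<^sub>R v + h *\<^sub>R w) - f (y + h *\<^sub>R v) - f (y + h *\<^sub>R w) + f y
        = h * (Dv (y + \<xi> *\<^sub>R v + h *\<^sub>R w) - Dv (y + \<xi> *\<^sub>R v))"
        using \<xi>(3) by (simp add: G_def)
      then show ?thesis using h by (simp only:) (simp add: power2_eq_square)
    qed
    moreover have "x / h - A w = (x - h * A w) / h" for x using h by (simp add: diff_divide_distrib)
    ultimately have "dist ((f (y + h *\<^sub>R v + h *\<^sub>R w) - f (y + h *\<^sub>R v) - f (y + h *\<^sub>R w) + f y) / h\<^sup>2) (A w)
      = \<bar>(Dv (y + \<xi> *\<^sub>R v + h *\<^sub>R w) - Dv (y + \<xi> *\<^sub>R v)) - h * A w\<bar> / h"
      using h by (simp add: dist_real_def)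
    also have "\<dots> \<le> 2 * (e' * (h * N)) / h" using X h by (intro divide_right_mono) auto
    also have "\<dots> = e / 2" using h N0 by (simp add: e'_def)
    finally show ?thesis using e by simp
  qed
  have "frechet_derivative (\<lambda>x. frechet_derivative f (at x) v) (at y) w = A w"
    unfolding A_def Dv_def[abs_def] ..
  then show "\<forall>\<^sub>F h in at_right 0. dist ((f (y + h *\<^sub>R v + h *\<^sub>R w) - f (y + h *\<^sub>R v) - f (y + h *\<^sub>R w) + f y) / h\<^sup>2)
      (frechet_derivative (\<lambda>x. frechet_derivative f (at x) v) (at y) w) < e"
    unfolding eventually_at_right_field using main d0 by auto
qed

lemma second_derivative_symmetric:
  fixes f :: "'a::real_normed_vector \<Rightarrow> real"
  assumes S: "open S" "y \<in> S" and f: "\<And>x. x \<in> S \<Longrightarrow> f differentiable (at x)"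
    and D: "\<And>v. (\<lambda>x. frechet_derivative f (at x) v) differentiable (at y)"
  shows "iter_deriv [v, w] f y = iter_deriv [w, v] f y"
proof -
  have "((\<lambda>h. (f (y + h *\<^sub>R v + h *\<^sub>R w) - f (y + h *\<^sub>R v) - f (y + h *\<^sub>R w) + f y) / h\<^sup>2)
    \<longlongrightarrow> frechet_derivative (\<lambda>x. frechet_derivative f (at x) w) (at y) v) (at_right 0)"
  proof -
    have eq: "f (y + h *\<^sub>R w + h *\<^sub>R v) - f (y + h *\<^sub>R w) - f (y + h *\<^sub>R v) + f y
      = f (y + h *\<^sub>R v + h *\<^sub>R w) - f (y + h *\<^sub>R v) - f (y + h *\<^sub>R w) + f y" for h
    proof -
      have "y + h *\<^sub>R w + h *\<^sub>R v = y + h *\<^sub>R v + h *\<^sub>R w" by (simp add: add_ac)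
      then show ?thesis by (simp only:)
    qed
    show ?thesis using second_difference_tendsto[OF S f D, where v = w and w = v] by (simp only: eq)
  qed
  from tendsto_unique[OF _ second_difference_tendsto[OF S f D, of v w] this]
  show ?thesis by simp
qed

text \<open>Cauchy-Schwarz for the form of \<open>- H\<close> is applied to \<open>v\<close> and
  \<open>w = inv H v\<close>: then \<open>H v \<bullet> w\<close> is the squared norm of
  \<open>v\<close>, while the bound on the inverse controls
  \<open>- (H w \<bullet> w)\<close>.\<close>

lemma inverse_bound_imp_coercive:
  fixes H :: "'k::euclidean_space \<Rightarrow> 'k"
  assumes lin: "linear H" and bij: "bij H" and sym: "\<And>v w. H v \<bullet> w = H w \<bullet> v"
    and neg: "\<And>v. v \<noteq> 0 \<Longrightarrow> H v \<bullet> v < 0" and B: "\<And>w. norm (inv H w) \<le> B * norm w" "B > 0"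
  shows "(norm v)\<^sup>2 / B \<le> - (H v \<bullet> v)"
proof (cases "v = 0")
  case True
  then show ?thesis using linear_0[OF lin] by simp
next
  case False
  interpret H: linear H by fact
  define w where "w = inv H v"
  have Hw: "H w = v" using bij by (simp add: w_def bij_is_surj surj_f_inv_f)
  have pos: "0 \<le> - (H u \<bullet> u)" for u using neg[of u] by (cases "u = 0") auto
  have "(H v \<bullet> w)\<^sup>2 \<le> (- (H v \<bullet> v)) * (- (H w \<bullet> w))"
  proof -
    have "(- (H v \<bullet> w))\<^sup>2 \<le> (- (H v \<bullet> v)) * (- (H w \<bullet> w))"
    proof (rule quadratic_nonneg_discriminant[OF _ pos])
      fix t :: real
      have "- (H (v + t *\<^sub>R w) \<bullet> (v + t *\<^sub>R w)) = - (H v \<bullet> v) + 2 * t * - (H v \<bullet> w) + t\<^sup>2 * - (H w \<bullet> w)"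
        using sym[of w v] by (simp add: H.add H.scaleR inner_add_left inner_add_right power2_eq_square algebra_simps)
      then show "0 \<le> - (H v \<bullet> v) + 2 * t * - (H v \<bullet> w) + t\<^sup>2 * - (H w \<bullet> w)" using pos[of "v + t *\<^sub>R w"] by simp
    qed
    then show ?thesis by simp
  qed
  moreover have "H v \<bullet> w = (norm v)\<^sup>2" using sym[of v w] Hw by (simp add: power2_norm_eq_inner)
  moreover have "- (H w \<bullet> w) \<le> B * (norm v)\<^sup>2"
  proof -
    have "- (H w \<bullet> w) \<le> norm v * norm w" using Cauchy_Schwarz_ineq2[of v w] by (simp add: Hw)
    also have "\<dots> \<le> norm v * (B * norm v)" using B(1)[of v] by (intro mult_left_mono) (auto simp: w_def)
    finally show ?thesis by (simp add: power2_eq_square mult_ac)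
  qed
  ultimately have "((norm v)\<^sup>2)\<^sup>2 \<le> (- (H v \<bullet> v)) * (B * (norm v)\<^sup>2)"
    using pos[of v] by (metis mult_left_mono order_trans)
  then have "(norm v)\<^sup>2 * (norm v)\<^sup>2 \<le> (- (H v \<bullet> v) * B) * (norm v)\<^sup>2" by (simp add: power2_eq_square mult_ac)
  then have "(norm v)\<^sup>2 \<le> - (H v \<bullet> v) * B" by (rule mult_right_le_imp_le) (use False in simp)
  then show ?thesis using B(2) by (simp add: pos_divide_le_eq)
qed

section \<open>The Hamiltonian as a function of the control and its Hessian\<close>

lemma smooth_slice:
  fixes F :: "'e::euclidean_space \<times> 'k::euclidean_space \<Rightarrow> 'b::real_normed_vector"
  assumes F: "smooth_on (U \<times> T) F" and x: "x \<in> U" and y: "y \<in> T"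
  shows "((\<lambda>y. F (x, y)) has_derivative (\<lambda>b. iter_deriv [(0, b)] F (x, y))) (at y)"
    and "(\<lambda>y. iter_deriv [(0, b)] F (x, y)) differentiable (at y)"
proof -
  have xy: "(x, y) \<in> U \<times> T" using x y by simp
  have pair: "((\<lambda>y. (x, y)) has_derivative (\<lambda>b. (0, b))) (at y)" by (auto intro!: derivative_eq_intros)
  have "iter_deriv [] F differentiable (at (x, y))" using F xy unfolding smooth_on_def by blast
  then have "(F has_derivative frechet_derivative F (at (x, y))) (at (x, y))"
    by (simp add: frechet_derivative_works)
  from diff_chain_at[OF pair this]
  show "((\<lambda>y. F (x, y)) has_derivative (\<lambda>b. iter_deriv [(0, b)] F (x, y))) (at y)"
    by (simp add: o_def)
  have "iter_deriv [(0, b)] F differentiable (at (x, y))" using F xy unfolding smooth_on_def by blast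
  then obtain D where "(iter_deriv [(0, b)] F has_derivative D) (at (x, y))" unfolding differentiable_def by blast
  from diff_chain_at[OF pair this]
  show "(\<lambda>y. iter_deriv [(0, b)] F (x, y)) differentiable (at y)"
    unfolding o_def by (rule differentiableI)
qed

lemma ham_partial_derivatives:
  fixes S :: "('m, 'e::euclidean_space, 'u, 'k::euclidean_space) control_system"
    and p :: "('m, 'e) chart \<Rightarrow> 'e"
  assumes S: "smooth_control_system S" and t: "t \<in> {0..1}" and d: "d \<in> control_atlas S"
    and c: "c \<in> state_atlas S" "q \<in> cdom c"
  defines "f \<equiv> \<lambda>y. ham S t (cinv d y) (q, p)"
  shows "\<And>y. y \<in> cimg d \<Longrightarrow> f differentiable (at y)"
    and "\<And>y v. y \<in> cimg d \<Longrightarrow> (\<lambda>y. frechet_derivative f (at y) v) differentiable (at y)"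
    and "open (cimg d)"
proof -
  \<comment> \<open>This is the chart in which \<open>pairing\<close> is evaluated; in it
    \<open>f\<close> becomes an explicit expression in the smooth local data.\<close>
  define c' where "c' = (SOME c. c \<in> state_atlas S \<and> q \<in> cdom c)"
  have c': "c' \<in> state_atlas S" "q \<in> cdom c'"
    using someI[of "\<lambda>c. c \<in> state_atlas S \<and> q \<in> cdom c" c] c by (auto simp: c'_def)
  have mf: "smooth_manifold (state_atlas S)" "smooth_manifold (control_atlas S)"
    using S unfolding smooth_control_system_def by auto
  show op: "open (cimg d)" using mf(2) d unfolding smooth_manifold_def by blast
  have inj: "inj_on (cmap c') (cdom c')" using mf(1) c'(1) unfolding smooth_manifold_def by blast
  define x where "x = cmap c' q"
  have x: "x \<in> cimg c'" using c' by (simp add: x_def cimg_def)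
  have cinv: "cinv c' x = q" using inj c' by (simp add: cinv_def x_def)
  define F where "F = local_dyn S c' d t"
  define L where "L = (\<lambda>(x, y). cost S (cinv c' x) (cinv d y))"
  have sm: "smooth_on (cimg c' \<times> cimg d) F" "smooth_on (cimg c' \<times> cimg d) L"
    using S c'(1) d t unfolding smooth_control_system_def F_def L_def by blast+
  have f: "f = (\<lambda>y. p c' \<bullet> F (x, y) - L (x, y))"
    unfolding f_def ham_def pairing_def F_def L_def local_dyn_def
    by (simp add: cinv Let_def flip: c'_def)
  have Df: "(f has_derivative (\<lambda>b. p c' \<bullet> iter_deriv [(0, b)] F (x, y) - iter_deriv [(0, b)] L (x, y))) (at y)"
    if y: "y \<in> cimg d" for y
    unfolding f by (intro has_derivative_diff has_derivative_inner_right smooth_slice[OF _ x y] sm)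
  show "f differentiable (at y)" if "y \<in> cimg d" for y using Df[OF that] differentiableI by blast
  show "(\<lambda>y. frechet_derivative f (at y) v) differentiable (at y)" if y: "y \<in> cimg d" for y v
  proof -
    have "(\<lambda>y. p c' \<bullet> iter_deriv [(0, v)] F (x, y) - iter_deriv [(0, v)] L (x, y)) differentiable (at y)"
      by (intro differentiable_diff differentiable_inner differentiable_const smooth_slice(2)[OF _ x y] sm)
    then obtain D where "((\<lambda>y. p c' \<bullet> iter_deriv [(0, v)] F (x, y) - iter_deriv [(0, v)] L (x, y)) has_derivative D) (at y)"
      unfolding differentiable_def by blast
    then have "((\<lambda>y. frechet_derivative f (at y) v) has_derivative D) (at y)"
    proof (rule has_derivative_transform_within_open[OF _ op y])
      fix z assume "z \<in> cimg d"
      from fun_cong[OF frechet_derivative_at[OF Df[OF this]], of v]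
      show "p c' \<bullet> iter_deriv [(0, v)] F (x, z) - iter_deriv [(0, v)] L (x, z) = frechet_derivative f (at z) v" .
    qed
    then show ?thesis by (rule differentiableI)
  qed
qed

lemma topspace_mtop_subset: "topspace (mtop A) \<subseteq> points A"
  unfolding mtop_def topology_generated_by_topspace points_def by blast

lemma Hop_symmetric:
  fixes S :: "('m, 'e::euclidean_space, 'u, 'k::euclidean_space) control_system"
  assumes S: "smooth_control_system S" and lam: "normal_extremal S u lam"
    and \<kappa>: "chart_field (control_atlas S) u \<kappa>" and t: "t \<in> {0..1}"
  shows "Hop S u lam \<kappa> t v \<bullet> w = Hop S u lam \<kappa> t w \<bullet> v"
proof -
  let ?d = "\<kappa> t"
  have d: "?d \<in> control_atlas S" using \<kappa> t unfolding chart_field_def by blast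
  have ut: "u t \<in> cdom ?d" using \<kappa> d t unfolding chart_field_def by blast
  obtain q p where qp: "lam t = (q, p)" by (cases "lam t") auto
  \<comment> \<open>A chart around the foot point comes from continuity: a continuous curve takes
    values in the underlying space of the topology, which is covered by chart domains.\<close>
  have "continuous_map (top_of_set {0..1}) (mtop (coatlas (state_atlas S))) lam"
    using lam unfolding normal_extremal_def trajectory_def by blast
  then have "lam t \<in> topspace (mtop (coatlas (state_atlas S)))"
    using t continuous_map_image_subset_topspace[of "top_of_set {0..1}"] by fastforce
  then have "lam t \<in> points (coatlas (state_atlas S))" using topspace_mtop_subset[of "coatlas (state_atlas S)"] by (rule subsetD[rotated])
  then obtain c where c: "c \<in> state_atlas S" "q \<in> cdom c"
    by (auto simp: points_def coatlas_def cochart_def qp)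
  define f where "f = (\<lambda>y. ham S t (cinv ?d y) (lam t))"
  define y where "y = cmap ?d (u t)"
  have y: "y \<in> cimg ?d" using ut by (simp add: y_def cimg_def)
  note hp = ham_partial_derivatives(1,2)[OF S t d c, where p = p, folded qp, folded f_def]
  note op = ham_partial_derivatives(3)[OF S t d c]
  have sym: "iter_deriv [a, b] f y = iter_deriv [b, a] f y" for a b
    by (rule second_derivative_symmetric[OF op y hp(1) hp(2)[OF y]])
  have lin: "linear (\<lambda>a. iter_deriv [a, b] f y)" for b
  proof -
    have "((\<lambda>y. frechet_derivative f (at y) b) has_derivative frechet_derivative (\<lambda>y. frechet_derivative f (at y) b) (at y)) (at y)"
      using hp(2)[OF y] by (simp add: frechet_derivative_works)
    from has_derivative_linear[OF this] show ?thesis by simp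
  qed
  have Hop: "Hop S u lam \<kappa> t v = (\<Sum>b\<in>Basis. iter_deriv [v, b] f y *\<^sub>R b)" for v
    by (simp add: Hop_def f_def y_def)
  have "Hop S u lam \<kappa> t v \<bullet> w = iter_deriv [w, v] f y" for v w
  proof -
    have "Hop S u lam \<kappa> t v \<bullet> w = (\<Sum>b\<in>Basis. iter_deriv [v, b] f y * (b \<bullet> w))"
      unfolding Hop by (simp only: inner_sum_left inner_scaleR_left)
    also have "\<dots> = (\<Sum>b\<in>Basis. (w \<bullet> b) *\<^sub>R iter_deriv [b, v] f y)"
      by (rule sum.cong) (simp_all only: sym[of v] inner_commute[of w] real_scaleR_def mult.commute)
    also have "\<dots> = iter_deriv [\<Sum>b\<in>Basis. (w \<bullet> b) *\<^sub>R b, v] f y"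
      by (simp only: linear_sum[OF lin] linear_scale[OF lin])
    finally show ?thesis by (simp only: euclidean_representation)
  qed
  then show ?thesis by (simp only: sym)
qed

section \<open>Measurable trivializations and piecewise Lipschitz families\<close>

lemma trivialization_families:
  fixes \<Psi> :: "real \<Rightarrow> 'k::euclidean_space \<Rightarrow> 'k"
  assumes \<Psi>: "trivialization \<Psi>"
  obtains B where "B > 0" "linear_family 0 1 B \<Psi>" "linear_family 0 1 B (\<lambda>t. inv (\<Psi> t))"
proof -
  obtain B0 where B0: "\<And>t w. t \<in> {0..1} \<Longrightarrow> norm (\<Psi> t w) \<le> B0 * norm w \<and> norm (inv (\<Psi> t) w) \<le> B0 * norm w"
    using \<Psi> unfolding trivialization_def by blast
  define B where "B = max B0 1"
  have B: "norm (\<Psi> t w) \<le> B * norm w" "norm (inv (\<Psi> t) w) \<le> B * norm w" if "t \<in> {0..1}" for t w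
  proof -
    have "B0 * norm w \<le> B * norm w" by (intro mult_right_mono) (auto simp: B_def)
    then show "norm (\<Psi> t w) \<le> B * norm w" "norm (inv (\<Psi> t) w) \<le> B * norm w" using B0[OF that, of w] by auto
  qed
  have Bpos: "B > 0" by (simp add: B_def)
  have lb: "linear (\<Psi> t)" "bij (\<Psi> t)" if "t \<in> {0..1}" for t using \<Psi> that unfolding trivialization_def by auto
  have meas: "(\<lambda>t. \<Psi> t w) \<in> borel_measurable (lebesgue_on {0..1})" for w
    using \<Psi> unfolding trivialization_def by blast
  have linv: "linear (inv (\<Psi> t))" if "t \<in> {0..1}" for t
  proof -
    have "inv (\<Psi> t) \<circ> \<Psi> t = id" using lb(2)[OF that] by (simp add: bij_is_inj)
    then show ?thesis using left_inverse_linear[OF lb(1)[OF that]] by blast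
  qed
  \<comment> \<open>Measurable selection: along a dense sequence, the first index whose image under
    \<open>\<Psi> t\<close> lies within 1/(m+1) of \<open>x\<close> depends measurably on
    \<open>t\<close>. The uniform bound on the inverses makes the selected points converge to the
    inverse image.\<close>
  have "(\<lambda>t. inv (\<Psi> t) x) \<in> borel_measurable (lebesgue_on {0..1})" for x
  proof -
    obtain D :: "'k set" where D: "countable D" "\<And>X. open X \<Longrightarrow> X \<noteq> {} \<Longrightarrow> \<exists>d\<in>D. d \<in> X"
      using countable_dense_setE by blast
    have "D \<noteq> {}" using D(2)[of UNIV] by auto
    then obtain e :: "nat \<Rightarrow> 'k" where e: "range e = D" using D(1) by (metis range_from_nat_into)
    define N where "N m t = (LEAST n. norm (\<Psi> t (e n) - x) < 1 / real (Suc m))" for m t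
    have N: "norm (\<Psi> t (e (N m t)) - x) < 1 / real (Suc m)" if t: "t \<in> {0..1}" for m t
      unfolding N_def
    proof (rule LeastI_ex)
      let ?X = "{y. norm (\<Psi> t y - x) < 1 / real (Suc m)}"
      have "continuous_on UNIV (\<Psi> t)" using lb(1)[OF t] by (simp add: linear_continuous_on linear_conv_bounded_linear)
      then have "open ?X" by (intro open_Collect_less continuous_intros) auto
      moreover have "inv (\<Psi> t) x \<in> ?X" using lb(2)[OF t] by (simp add: bij_is_surj surj_f_inv_f)
      ultimately show "\<exists>n. norm (\<Psi> t (e n) - x) < 1 / real (Suc m)" using D(2)[of ?X] e by blast
    qed
    have Nm: "N m \<in> measurable (lebesgue_on {0..1}) (count_space UNIV)" for m
      unfolding N_def[abs_def]
    proof (rule measurable_Least)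
      fix n
      have "(\<lambda>t. norm (\<Psi> t (e n) - x)) \<in> borel_measurable (lebesgue_on {0..1})"
        using meas by (intro borel_measurable_norm[THEN measurable_compose[rotated]] borel_measurable_diff) auto
      then show "Measurable.pred (lebesgue_on {0..1}) (\<lambda>t. norm (\<Psi> t (e n) - x) < 1 / real (Suc m))"
        by (simp only: pred_def borel_measurable_iff_less)
    qed
    show ?thesis
    proof (rule borel_measurable_LIMSEQ_metric)
      show "(\<lambda>t. e (N m t)) \<in> borel_measurable (lebesgue_on {0..1})" for m
        by (rule measurable_compose[OF Nm]) simp
      fix t assume "t \<in> space (lebesgue_on {0..1::real})"
      then have t: "t \<in> {0..1}" by simp
      have "(\<lambda>m. e (N m t) - inv (\<Psi> t) x) \<longlonglongrightarrow> 0"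
      proof (rule Lim_null_comparison)
        have "norm (e (N m t) - inv (\<Psi> t) x) \<le> B * (1 / real (Suc m))" for m
        proof -
          have "e (N m t) - inv (\<Psi> t) x = inv (\<Psi> t) (\<Psi> t (e (N m t)) - x)"
            using linear_diff[OF linv[OF t]] lb(2)[OF t] by (simp add: bij_is_inj)
          then have "norm (e (N m t) - inv (\<Psi> t) x) \<le> B * norm (\<Psi> t (e (N m t)) - x)" using B(2)[OF t] by simp
          also have "\<dots> \<le> B * (1 / real (Suc m))" using N[OF t, of m] Bpos by (intro mult_left_mono) auto
          finally show ?thesis .
        qed
        then show "\<forall>\<^sub>F m in sequentially. norm (e (N m t) - inv (\<Psi> t) x) \<le> B * (1 / real (Suc m))" by simp
        show "(\<lambda>m. B * (1 / real (Suc m))) \<longlonglongrightarrow> 0"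
          using LIMSEQ_Suc[OF lim_1_over_n] by (intro tendsto_mult_right_zero) simp
      qed
      then show "(\<lambda>m. e (N m t)) \<longlonglongrightarrow> inv (\<Psi> t) x" by (rule LIM_zero_cancel)
    qed
  qed
  then show thesis
    using that[OF Bpos] lb linv B meas Bpos unfolding linear_family_def by (simp add: less_imp_le)
qed

text \<open>An exceptional set is used instead of a subdivision because the exceptional sets of
  several functions can simply be united.\<close>

definition piecewise_Lipschitz :: "real set \<Rightarrow> real \<Rightarrow> (real \<Rightarrow> 'b::real_normed_vector) \<Rightarrow> bool" where
  "piecewise_Lipschitz F L f \<longleftrightarrow> finite F \<and> L \<ge> 0 \<and>
     (\<forall>s t. 0 \<le> s \<and> s \<le> t \<and> t \<le> 1 \<and> {s..t} \<inter> F = {} \<longrightarrow> norm (f s - f t) \<le> L * (t - s))"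

text \<open>An interval avoiding the subdivision points lies inside one piece, where
  \<open>f\<close> agrees with a function that is Lipschitz on the closed piece. The values at the
  subdivision points are arbitrary but finitely many, which affects neither boundedness nor
  measurability.\<close>

lemma piecewise_analytic_Lipschitz:
  fixes f :: "real \<Rightarrow> 'b::euclidean_space"
  assumes "piecewise_analytic f"
  shows "(\<exists>F L. piecewise_Lipschitz F L f) \<and> bounded (f ` {0..1}) \<and> f \<in> borel_measurable (lebesgue_on {0..1})"
proof -
  obtain n :: nat and p where p: "p 0 = 0" "p n = 1" "\<And>i. i < n \<Longrightarrow> p i < p (Suc i)"
    and "\<And>i. i < n \<Longrightarrow> \<exists>g. real_analytic_on {p i..p (Suc i)} g \<and> (\<forall>t\<in>{p i<..<p (Suc i)}. f t = g t)"
    using assms unfolding piecewise_analytic_def by blast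
  then obtain g where g: "\<And>i. i < n \<Longrightarrow> real_analytic_on {p i..p (Suc i)} (g i)"
    "\<And>i t. i < n \<Longrightarrow> t \<in> {p i<..<p (Suc i)} \<Longrightarrow> f t = g i t" by metis
  have "\<forall>i\<in>{..<n}. \<exists>L\<ge>0. \<forall>s\<in>{p i..p (Suc i)}. \<forall>t\<in>{p i..p (Suc i)}. norm (g i s - g i t) \<le> L * \<bar>s - t\<bar>"
    using real_analytic_on_Lipschitz[OF g(1)] by (metis lessThan_iff)
  from bchoice[OF this] obtain L where
    "\<forall>i\<in>{..<n}. L i \<ge> 0 \<and> (\<forall>s\<in>{p i..p (Suc i)}. \<forall>t\<in>{p i..p (Suc i)}. norm (g i s - g i t) \<le> L i * \<bar>s - t\<bar>)"
    by (rule exE)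
  then have L: "\<And>i. i < n \<Longrightarrow> L i \<ge> 0"
    "\<And>i s t. i < n \<Longrightarrow> s \<in> {p i..p (Suc i)} \<Longrightarrow> t \<in> {p i..p (Suc i)} \<Longrightarrow> norm (g i s - g i t) \<le> L i * \<bar>s - t\<bar>" by simp_all
  have find: "\<exists>i<k. p i < x \<and> x < p (Suc i)" if "k \<le> n" "0 \<le> x" "x \<le> p k" "x \<notin> p ` {..n}" for k x
    using that
  proof (induction k)
    case 0
    then have "x = p 0" using p(1) by simp
    then show ?case using 0 by blast
  next
    case (Suc k)
    have "x \<noteq> p k" "x \<noteq> p (Suc k)" using Suc.prems by auto
    then show ?case using Suc by (cases "x < p k") (auto intro: less_SucI)
  qed
  let ?F = "p ` {..n}" and ?L = "\<Sum>i<n. L i"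
  have L_le: "L i \<le> ?L" if "i < n" for i using that L(1) by (intro member_le_sum) auto
  have "norm (f s - f t) \<le> ?L * (t - s)" if st: "0 \<le> s" "s \<le> t" "t \<le> 1" "{s..t} \<inter> ?F = {}" for s t
  proof -
    have "s \<notin> ?F" using st by auto
    then obtain i where i: "i < n" "p i < s" "s < p (Suc i)" using find[of n s] st p(2) by auto
    have "p (Suc i) \<in> ?F" using i(1) by simp
    then have "p (Suc i) \<notin> {s..t}" using st(4) by blast
    then have "t < p (Suc i)" using i by auto
    then have "norm (f s - f t) = norm (g i s - g i t)" using g(2)[OF i(1)] i st by simp
    also have "\<dots> \<le> L i * \<bar>s - t\<bar>" using L(2)[OF i(1), of s t] i st \<open>t < p (Suc i)\<close> by auto
    also have "\<dots> \<le> ?L * (t - s)" using L_le[OF i(1)] st by (simp add: mult_right_mono)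
    finally show ?thesis .
  qed
  moreover have "0 \<le> ?L" using L(1) by (intro sum_nonneg) auto
  ultimately have lip: "piecewise_Lipschitz ?F ?L f" unfolding piecewise_Lipschitz_def by blast
  have cont: "continuous_on {p i..p (Suc i)} (g i)" if i: "i < n" for i
  proof -
    have "(L i)-lipschitz_on {p i..p (Suc i)} (g i)"
      using L[OF i] by (intro lipschitz_onI) (auto simp: dist_norm)
    then show ?thesis by (rule lipschitz_on_continuous_on)
  qed
  have "bounded (f ` ?F \<union> (\<Union>i<n. g i ` {p i..p (Suc i)}))"
    using cont by (intro bounded_Un[THEN iffD2] conjI finite_imp_bounded bounded_UN ballI compact_imp_bounded compact_continuous_image) auto
  moreover have "f ` {0..1} \<subseteq> f ` ?F \<union> (\<Union>i<n. g i ` {p i..p (Suc i)})"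
  proof
    fix z assume "z \<in> f ` {0..1}"
    then obtain x where x: "x \<in> {0..1}" "z = f x" by blast
    show "z \<in> f ` ?F \<union> (\<Union>i<n. g i ` {p i..p (Suc i)})"
    proof (cases "x \<in> ?F")
      case False
      then obtain i where i: "i < n" "p i < x" "x < p (Suc i)" using find[of n x] x p(2) by auto
      then have "z = g i x" "x \<in> {p i..p (Suc i)}" using g(2)[OF i(1), of x] x by auto
      then show ?thesis using i(1) by blast
    qed (use x in auto)
  qed
  ultimately have bd: "bounded (f ` {0..1})" by (rule bounded_subset)
  have "0 \<le> p k \<and> f \<in> borel_measurable (lebesgue_on {0..p k})" if "k \<le> n" for k
    using that
  proof (induction k)
    case 0
    have "(\<lambda>_. 0) \<in> borel_measurable (lebesgue_on {0..0::real})" by simp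
    then have "f \<in> borel_measurable (lebesgue_on {0..0})" by (rule measurable_cong_interior) auto
    then show ?case using p(1) by simp
  next
    case (Suc k)
    then have k: "k < n" by simp
    have "g k \<in> borel_measurable (lebesgue_on {p k..p (Suc k)})"
      using cont[OF k] by (intro continuous_imp_measurable_on_sets_lebesgue) auto
    then have m: "f \<in> borel_measurable (lebesgue_on {p k..p (Suc k)})"
      by (rule measurable_cong_interior) (use g(2)[OF k] in auto)
    have IH: "0 \<le> p k" "f \<in> borel_measurable (lebesgue_on {0..p k})" using Suc by simp_all
    have "p k \<le> p (Suc k)" using p(3)[OF k] by simp
    then show ?case using measurable_combine[OF IH(2) m IH(1)] IH(1) by simp
  qed
  from this[of n] show ?thesis using lip bd p(2) by auto
qed

lemma piecewise_analytic_matrix_family: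
  fixes T :: "real \<Rightarrow> 'k::euclidean_space \<Rightarrow> 'b::euclidean_space"
  assumes "piecewise_analytic_matrix T"
  obtains F L c where "finite F" "L \<ge> 0" "linear_family 0 1 c T"
    "\<And>s t x. 0 \<le> s \<Longrightarrow> s \<le> t \<Longrightarrow> t \<le> 1 \<Longrightarrow> {s..t} \<inter> F = {} \<Longrightarrow> norm (T s x - T t x) \<le> L * (t - s) * norm x"
proof -
  obtain a where a: "\<And>b. b \<in> Basis \<Longrightarrow> piecewise_analytic (a b)"
    and T: "\<And>t w. t \<in> {0..1} \<Longrightarrow> T t w = (\<Sum>b\<in>Basis. (w \<bullet> b) *\<^sub>R a b t)"
    using assms unfolding piecewise_analytic_matrix_def by blast
  note A = piecewise_analytic_Lipschitz[OF a]
  have "\<forall>b\<in>Basis. \<exists>FL. piecewise_Lipschitz (fst FL) (snd FL) (a b)" using A by auto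
  from bchoice[OF this] obtain FL where FL: "\<And>b. b \<in> Basis \<Longrightarrow> piecewise_Lipschitz (fst (FL b)) (snd (FL b)) (a b)" by blast
  have "\<forall>b\<in>Basis. \<exists>C. \<forall>t\<in>{0..1}. norm (a b t) \<le> C" using A unfolding bounded_iff by blast
  from bchoice[OF this] obtain C where C: "\<And>b t. b \<in> Basis \<Longrightarrow> t \<in> {0..1} \<Longrightarrow> norm (a b t) \<le> C b" by blast
  let ?F = "\<Union>b\<in>Basis. fst (FL b)" and ?L = "\<Sum>b\<in>Basis. snd (FL b)" and ?c = "\<Sum>b\<in>Basis. C b"
  have C0: "C b \<ge> 0" if "b \<in> Basis" for b using C[OF that, of 0] norm_ge_zero[of "a b 0"] by (simp del: norm_ge_zero)
  show thesis
  proof (rule that[of ?F ?L ?c])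
    show "finite ?F" using FL by (auto simp: piecewise_Lipschitz_def)
    show "0 \<le> ?L" using FL by (intro sum_nonneg) (auto simp: piecewise_Lipschitz_def)
    show "linear_family 0 1 ?c T"
      unfolding linear_family_def
    proof (intro conjI ballI allI)
      show "0 \<le> ?c" using C0 by (intro sum_nonneg) auto
      fix t :: real assume t: "t \<in> {0..1}"
      show "linear (T t)"
        by (rule linearI) (simp_all add: T[OF t] inner_add_left scaleR_add_left sum.distrib scaleR_sum_right)
      show "norm (T t x) \<le> ?c * norm x" for x
      proof -
        have "norm (T t x) \<le> (\<Sum>b\<in>Basis. norm ((x \<bullet> b) *\<^sub>R a b t))" unfolding T[OF t] by (rule norm_sum)
        also have "\<dots> \<le> (\<Sum>b\<in>Basis. norm x * C b)"
          using C[OF _ t] by (intro sum_mono) (auto simp: Basis_le_norm intro!: mult_mono)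
        also have "\<dots> = ?c * norm x" by (simp add: sum_distrib_left mult.commute[of _ "norm x"])
        finally show ?thesis .
      qed
    next
      fix x
      have "(\<lambda>t. \<Sum>b\<in>Basis. (x \<bullet> b) *\<^sub>R a b t) \<in> borel_measurable (lebesgue_on {0..1})"
        using A by (intro borel_measurable_sum borel_measurable_scaleR) auto
      then show "(\<lambda>t. T t x) \<in> borel_measurable (lebesgue_on {0..1})"
        by (subst measurable_cong[of _ _ "\<lambda>t. \<Sum>b\<in>Basis. (x \<bullet> b) *\<^sub>R a b t"]) (use T in auto)
    qed
    fix s t :: real and x assume st: "0 \<le> s" "s \<le> t" "t \<le> 1" "{s..t} \<inter> ?F = {}"
    have "T s x - T t x = (\<Sum>b\<in>Basis. (x \<bullet> b) *\<^sub>R (a b s - a b t))"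
      using st by (simp add: T sum_subtractf scaleR_diff_right)
    also have "norm \<dots> \<le> (\<Sum>b\<in>Basis. norm ((x \<bullet> b) *\<^sub>R (a b s - a b t)))" by (rule norm_sum)
    also have "\<dots> \<le> (\<Sum>b\<in>Basis. norm x * (snd (FL b) * (t - s)))"
    proof (rule sum_mono)
      fix b :: 'k assume b: "b \<in> Basis"
      have "{s..t} \<inter> fst (FL b) = {}" using st(4) b by blast
      then have "norm (a b s - a b t) \<le> snd (FL b) * (t - s)"
        using FL[OF b] st unfolding piecewise_Lipschitz_def by blast
      then show "norm ((x \<bullet> b) *\<^sub>R (a b s - a b t)) \<le> norm x * (snd (FL b) * (t - s))"
        using b by (auto simp: Basis_le_norm intro!: mult_mono)
    qed
    also have "\<dots> = ?L * (t - s) * norm x" by (simp add: sum_distrib_right sum_distrib_left mult_ac)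
    finally show "norm (T s x - T t x) \<le> ?L * (t - s) * norm x" .
  qed
qed

lemma exists_subdivision:
  fixes F :: "real set"
  assumes "finite F"
  obtains q :: "nat \<Rightarrow> real" and n where "q 0 = 0" "q n = 1"
    "\<And>i. i < n \<Longrightarrow> q i < q (Suc i) \<and> {q i<..<q (Suc i)} \<inter> F = {} \<and> 0 \<le> q i \<and> q (Suc i) \<le> 1"
proof -
  let ?A = "(F \<inter> {0..1}) \<union> {0, 1}"
  define l where "l = sorted_list_of_set ?A"
  have A: "finite ?A" using assms by simp
  have set: "set l = ?A" unfolding l_def using A by (rule set_sorted_list_of_set)
  have sm: "l ! i < l ! j" if "i < j" "j < length l" for i j
    using strict_sorted_list_of_set[of ?A] that unfolding l_def by (rule sorted_wrt_nth_less)
  have len: "length l > 0" using set by (cases l) auto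
  have rng: "0 \<le> l ! i" "l ! i \<le> 1" if "i < length l" for i
    using nth_mem[OF that] unfolding set by auto
  show thesis
  proof (rule that[of "\<lambda>i. l ! i" "length l - 1"])
    obtain i where i: "i < length l" "l ! i = 0" using set in_set_conv_nth[of 0 l] by auto
    then show "l ! 0 = 0" using sm[of 0 i] rng[of 0] len by (cases "i = 0") auto
    obtain j where j: "j < length l" "l ! j = 1" using set in_set_conv_nth[of 1 l] by auto
    then consider "j = length l - 1" | "j < length l - 1" by linarith
    then show "l ! (length l - 1) = 1" using sm[of j "length l - 1"] rng[of "length l - 1"] len j
      by cases auto
    fix i assume i: "i < length l - 1"
    have "x \<notin> F" if x: "l ! i < x" "x < l ! Suc i" for x
    proof
      assume "x \<in> F"
      have "0 \<le> l ! i" "l ! Suc i \<le> 1" using rng(1)[of i] rng(2)[of "Suc i"] i by auto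
      then have "x \<in> set l" using x \<open>x \<in> F\<close> unfolding set by auto
      then obtain k where k: "k < length l" "l ! k = x" using in_set_conv_nth[of x l] by auto
      have i': "i < length l" "Suc i < length l" using i by auto
      have "i < k" using x(1) k i' sm[of k i] by (cases i k rule: linorder_cases) auto
      moreover have "k < Suc i" using x(2) k i' sm[of "Suc i" k] by (cases k "Suc i" rule: linorder_cases) auto
      ultimately show False by simp
    qed
    then show "l ! i < l ! Suc i \<and> {l ! i<..<l ! Suc i} \<inter> F = {} \<and> 0 \<le> l ! i \<and> l ! Suc i \<le> 1"
      using sm[of i "Suc i"] rng[of i] rng[of "Suc i"] i by auto
  qed
qed

section \<open>The second variation in a trivialization\<close>

lemma ae_eq_cong: "(\<And>t. t \<in> {0..1} \<Longrightarrow> f t = g t) \<Longrightarrow> ae_eq f g"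
  unfolding ae_eq_def by (intro exI[of _ "{}"]) auto

lemma ae_eq_trans: "ae_eq f g \<Longrightarrow> ae_eq g h \<Longrightarrow> ae_eq f h"
  using eventually_elim2[of "\<lambda>t. f t = g t" "ae_filter (lebesgue_on {0..1})" "\<lambda>t. g t = h t" "\<lambda>t. f t = h t"]
    ae_eq_AE[of f g] ae_eq_AE[of g h] AE_imp_ae_eq[of f h] by auto

lemma linear_family_mono: "linear_family a b c A \<Longrightarrow> c \<le> d \<Longrightarrow> linear_family a b d A"
  unfolding linear_family_def by (auto intro!: order_trans[OF _ mult_right_mono[of c d "norm _"]])

lemma sqi_linear_family:
  assumes A: "linear_family 0 1 c A" and f: "sqi 0 1 f"
  shows "sqi 0 1 (\<lambda>t. A t (f t))" and "energy 0 1 (\<lambda>t. A t (f t)) \<le> c\<^sup>2 * energy 0 1 f"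
proof -
  have I: "(\<lambda>t. c\<^sup>2 * (norm (f t))\<^sup>2) integrable_on {0..1}"
    using f by (intro integrable_on_mult_right) (simp add: sqi_def)
  have m: "(\<lambda>t. A t (f t)) \<in> borel_measurable (lebesgue_on {0..1})"
    using linear_family_measurable[OF A] f by (simp add: sqi_def)
  have le: "(norm (A t (f t)))\<^sup>2 \<le> c\<^sup>2 * (norm (f t))\<^sup>2" if "t \<in> {0..1}" for t
  proof -
    have "norm (A t (f t)) \<le> c * norm (f t)" using A that by (auto simp: linear_family_def)
    then have "(norm (A t (f t)))\<^sup>2 \<le> (c * norm (f t))\<^sup>2" by (intro power_mono) auto
    then show ?thesis by (simp add: power_mult_distrib)
  qed
  have "(\<lambda>t. (norm (A t (f t)))\<^sup>2) absolutely_integrable_on {0..1}"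
    by (rule measurable_bounded_by_integrable_imp_absolutely_integrable[OF _ _ I]) (use m le in auto)
  then have J: "(\<lambda>t. (norm (A t (f t)))\<^sup>2) integrable_on {0..1}"
    using set_lebesgue_integral_eq_integral(1) by blast
  show "sqi 0 1 (\<lambda>t. A t (f t))" using m J by (simp add: sqi_def)
  have "energy 0 1 (\<lambda>t. A t (f t)) \<le> integral {0..1} (\<lambda>t. c\<^sup>2 * (norm (f t))\<^sup>2)"
    unfolding energy_def by (intro integral_le J I le)
  then show "energy 0 1 (\<lambda>t. A t (f t)) \<le> c\<^sup>2 * energy 0 1 f" by (simp add: energy_def)
qed

definition mult_L2 :: "(real \<Rightarrow> 'k::euclidean_space \<Rightarrow> 'k) \<Rightarrow> 'k L2 \<Rightarrow> 'k L2" where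
  "mult_L2 A v = abs_L2 (\<lambda>t. A t (rep_L2 v t))"

lemma mult_L2_abs:
  assumes "linear_family 0 1 c A" "sqi 0 1 f"
  shows "mult_L2 A (abs_L2 f) = abs_L2 (\<lambda>t. A t (f t))"
  unfolding mult_L2_def
  by (rule abs_L2_eqI[OF sqi_linear_family(1)[OF assms(1) sqi_rep] sqi_linear_family(1)[OF assms]
      ae_eq_compose[OF rep_abs_L2[OF assms(2)]]])

lemma norm_mult_L2:
  assumes A: "linear_family 0 1 c A"
  shows "norm (mult_L2 A v) \<le> c * norm v"
proof -
  have c: "c \<ge> 0" using A by (simp add: linear_family_def)
  have "(norm (mult_L2 A v))\<^sup>2 = energy 0 1 (\<lambda>t. A t (rep_L2 v t))"
    unfolding mult_L2_def by (rule energy_abs_L2[OF sqi_linear_family(1)[OF A sqi_rep]])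
  also have "\<dots> \<le> c\<^sup>2 * energy 0 1 (rep_L2 v)" by (rule sqi_linear_family(2)[OF A sqi_rep])
  also have "\<dots> = (c * norm v)\<^sup>2" by (simp add: power_mult_distrib norm_L2_energy)
  finally have "(norm (mult_L2 A v))\<^sup>2 \<le> (c * norm v)\<^sup>2" .
  then show ?thesis by (rule power2_le_imp_le) (simp add: c)
qed

lemma bounded_linear_mult_L2:
  assumes A: "linear_family 0 1 c A"
  shows "bounded_linear (mult_L2 A)"
proof (rule bounded_linear_intro[of _ c])
  note m = sqi_linear_family(1)[OF A]
  have lin: "linear (A t)" if "t \<in> {0..1}" for t using A that by (simp add: linear_family_def)
  fix v w :: "'a L2" and r :: real
  have "abs_L2 (\<lambda>t. A t (rep_L2 (v + w) t)) = abs_L2 (\<lambda>t. A t (rep_L2 v t) + A t (rep_L2 w t))"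
  proof (rule abs_L2_eqI[OF m[OF sqi_rep] sqi_add[OF m[OF sqi_rep] m[OF sqi_rep]]])
    show "ae_eq (\<lambda>t. A t (rep_L2 (v + w) t)) (\<lambda>t. A t (rep_L2 v t) + A t (rep_L2 w t))"
      by (rule ae_eq_trans[OF ae_eq_compose[OF rep_L2_add] ae_eq_cong]) (rule linear_add[OF lin])
  qed
  then show "mult_L2 A (v + w) = mult_L2 A v + mult_L2 A w"
    by (simp add: mult_L2_def abs_L2_add[OF m[OF sqi_rep] m[OF sqi_rep]])
  have "abs_L2 (\<lambda>t. A t (rep_L2 (r *\<^sub>R v) t)) = abs_L2 (\<lambda>t. r *\<^sub>R A t (rep_L2 v t))"
  proof (rule abs_L2_eqI[OF m[OF sqi_rep] sqi_scaleR[OF m[OF sqi_rep]]])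
    show "ae_eq (\<lambda>t. A t (rep_L2 (r *\<^sub>R v) t)) (\<lambda>t. r *\<^sub>R A t (rep_L2 v t))"
      by (rule ae_eq_trans[OF ae_eq_compose[OF rep_L2_scaleR] ae_eq_cong]) (rule linear_scale[OF lin])
  qed
  then show "mult_L2 A (r *\<^sub>R v) = r *\<^sub>R mult_L2 A v"
    by (simp add: mult_L2_def abs_L2_scaleR[OF m[OF sqi_rep]])
  show "norm (mult_L2 A v) \<le> norm v * c" using norm_mult_L2[OF A, of v] by (simp add: mult.commute)
qed

lemma inner_abs_L2: "sqi 0 1 f \<Longrightarrow> sqi 0 1 g \<Longrightarrow> abs_L2 f \<bullet> abs_L2 g = (LINT t|lebesgue_on {0..1}. f t \<bullet> g t)"
  by (rule inner_L2.abs_eq) (simp_all add: sq_int_rel_def sq_int_sqi)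

text \<open>Expressing the weight through a bounded operator exhibits it as the diagonal of a
  bounded bilinear form.\<close>

lemma weight_eq_inner:
  assumes G: "linear_family 0 1 c G"
  shows "mult_L2 G v \<bullet> v = weight 0 1 G (rep_L2 v)"
proof -
  note m = sqi_linear_family(1)[OF G sqi_rep, of v]
  have "mult_L2 G v \<bullet> abs_L2 (rep_L2 v) = (LINT t|lebesgue_on {0..1}. G t (rep_L2 v t) \<bullet> rep_L2 v t)"
    unfolding mult_L2_def by (rule inner_abs_L2[OF m sqi_rep])
  moreover have "integrable (lebesgue_on {0..1}) (\<lambda>t. G t (rep_L2 v t) \<bullet> rep_L2 v t)"
    using m sqi_rep[of v] by (intro sq_int_inner) (simp_all add: sq_int_sqi)
  ultimately show ?thesis by (simp add: abs_rep_L2 weight_def lebesgue_integral_eq_integral)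
qed

text \<open>Boundedness makes the space of variations, being a kernel, closed.\<close>

lemma bounded_linear_integral_L2:
  assumes A: "linear_family 0 1 c A"
  shows "bounded_linear (\<lambda>v. integral {0..1} (\<lambda>t. A t (rep_L2 v t)))"
proof -
  have lin: "linear (\<lambda>v. integral {0..1} (\<lambda>t. A t (rep_L2 v t)))" by (rule linear_integral_L2[OF A]) auto
  have c: "c \<ge> 0" using A by (simp add: linear_family_def)
  have "norm (integral {0..1} (\<lambda>t. A t (rep_L2 v t))) \<le> norm v * c" for v
  proof -
    let ?N = "integral {0..1} (\<lambda>t. norm (rep_L2 v t))"
    have "?N\<^sup>2 \<le> (norm v)\<^sup>2"
      using integral_norm_square_le[OF sqi_rep[of v]] by (simp add: norm_L2_energy)
    then have "?N \<le> norm v" by (rule power2_le_imp_le) simp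
    then have "c * ?N \<le> norm v * c" using c by (subst mult.commute[of "norm v"]) (rule mult_left_mono)
    then show ?thesis using norm_integral_linear_family_le[OF A sqi_rep[of v], of 0 1] by simp
  qed
  then show ?thesis
    by (rule bounded_linear_intro[OF linear_add[OF lin] linear_scale[OF lin]])
qed

text \<open>Both signs are provided because \<open>K\<close> and its negative are treated by the
  same argument with opposite forms.\<close>

lemma alternating_form_sigma:
  "alternating_form (sigma z) 2" "alternating_form (\<lambda>a b. - sigma z a b) 2"
proof -
  have s: "sigma z = (\<lambda>a b. snd a \<bullet> fst b - snd b \<bullet> fst a)" by (intro ext) (rule sigma_eq)
  have bil: "bilinear (sigma z)"
    unfolding s bilinear_def by (intro conjI allI linearI) (simp_all add: inner_add_left inner_add_right algebra_simps)
  have bound: "\<bar>sigma z a b\<bar> \<le> 2 * norm a * norm b" for a b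
  proof -
    have "\<bar>snd a \<bullet> fst b\<bar> \<le> norm (snd a) * norm (fst b)" "\<bar>snd b \<bullet> fst a\<bar> \<le> norm (snd b) * norm (fst a)"
      by (rule Cauchy_Schwarz_ineq2)+
    moreover have "norm (snd a) * norm (fst b) \<le> norm a * norm b" "norm (snd b) * norm (fst a) \<le> norm b * norm a"
      using norm_fst_le[of "fst a" "snd a"] norm_snd_le[of "snd a" "fst a"]
        norm_fst_le[of "fst b" "snd b"] norm_snd_le[of "snd b" "fst b"] by (auto intro!: mult_mono)
    ultimately show ?thesis unfolding s by (simp add: mult_ac)
  qed
  show "alternating_form (sigma z) 2"
    by (rule alternating_form.intro[OF bil bound]) (simp_all add: s)
  have "bilinear (\<lambda>a b. - sigma z a b)" using bil unfolding bilinear_def by (auto intro: linear_compose_neg)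
  then show "alternating_form (\<lambda>a b. - sigma z a b) 2"
    by (rule alternating_form.intro) (simp_all add: bound, simp add: s)
qed

lemma LINT_fst_linear_family:
  assumes Z: "linear_family 0 1 c Z"
    and eq: "\<And>t. t \<in> {0..1} \<Longrightarrow> X t = fst (Z t (f t))" and f: "sqi 0 1 f"
  shows "(LINT t|lebesgue_on {0..1}. X t) = fst (integral {0..1} (\<lambda>t. Z t (f t)))"
proof -
  have A: "(\<lambda>t. Z t (f t)) absolutely_integrable_on {0..1}" by (rule linear_family_absolutely_integrable[OF Z f])
  have "(LINT t|lebesgue_on {0..1}. X t) = (LINT t|lebesgue_on {0..1}. fst (Z t (f t)))"
    by (rule Bochner_Integration.integral_cong) (use eq in auto)
  also have "\<dots> = fst (LINT t|lebesgue_on {0..1}. Z t (f t))"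
    by (rule integral_bounded_linear[OF bounded_linear_fst absolutely_integrable_imp_integrable[OF A]]) simp
  also have "\<dots> = fst (integral {0..1} (\<lambda>t. Z t (f t)))" by (simp add: LINT_eq_integral[OF A])
  finally show ?thesis .
qed

lemma (in alternating_form) LINT_eq_causal:
  assumes Z: "linear_family 0 1 c Z"
    and eq: "\<And>t. t \<in> {0..1} \<Longrightarrow> Y t = Z t (f t)" and f: "sqi 0 1 f"
  shows "(LINT t|lebesgue_on {0..1}. \<sigma> (LINT \<tau>|lebesgue_on {0..t}. Y \<tau>) (Y t)) = causal 0 1 Z Z f"
proof -
  have "(LINT \<tau>|lebesgue_on {0..t}. Y \<tau>) = integral {0..t} (\<lambda>r. Z r (f r))" if t: "t \<in> {0..1}" for t
  proof -
    have s: "{0..t} \<subseteq> {0..1}" using t by auto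
    have "(LINT \<tau>|lebesgue_on {0..t}. Y \<tau>) = (LINT \<tau>|lebesgue_on {0..t}. Z \<tau> (f \<tau>))"
      by (rule Bochner_Integration.integral_cong) (use eq t in auto)
    also have "\<dots> = integral {0..t} (\<lambda>r. Z r (f r))"
      by (rule LINT_eq_integral[OF linear_family_absolutely_integrable[OF linear_family_subinterval[OF Z s] sqi_subinterval[OF f s]]])
    finally show ?thesis .
  qed
  then have "(LINT t|lebesgue_on {0..1}. \<sigma> (LINT \<tau>|lebesgue_on {0..t}. Y \<tau>) (Y t))
    = (LINT t|lebesgue_on {0..1}. \<sigma> (integral {0..t} (\<lambda>r. Z r (f r))) (Z t (f t)))"
    using eq by (intro Bochner_Integration.integral_cong) auto
  also have "\<dots> = causal 0 1 Z Z f"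
    unfolding causal_def by (rule LINT_eq_integral[OF causal_absolutely_integrable[OF Z Z f]])
  finally show ?thesis .
qed

text \<open>Quantification over \<open>\<sigma>\<close> lets one choice of constants and pieces
  serve both signs of the form. Coercivity of the weight comes from the uniform bound on the inverse
  of \<open>H\<close>, transported by \<open>\<Psi>\<close>.\<close>

lemma trivialized_data:
  fixes S :: "('m, 'e::euclidean_space, 'u, 'k::euclidean_space) control_system"
  assumes S: "smooth_control_system S" and lam: "normal_extremal S u lam"
    and \<kappa>: "chart_field (control_atlas S) u \<kappa>" and reg: "regular_extremal S u lam \<kappa>"
    and neg: "\<And>t v. t \<in> {0..1} \<Longrightarrow> v \<noteq> 0 \<Longrightarrow> Hop S u lam \<kappa> t v \<bullet> v < 0"
    and data: "piecewise_analytic_data S u lam \<kappa> c"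
  obtains \<Psi> B Cz Cg g\<^sub>0 L q n where "B > 0" "linear_family 0 1 B \<Psi>" "linear_family 0 1 B (\<lambda>t. inv (\<Psi> t))"
    "\<And>t x. t \<in> {0..1} \<Longrightarrow> \<Psi> t (inv (\<Psi> t) x) = x \<and> inv (\<Psi> t) (\<Psi> t x) = x"
    "\<And>\<sigma>. alternating_form \<sigma> 2 \<Longrightarrow> second_variation_data \<sigma> 2 (\<lambda>t x. Zop S u lam \<kappa> c t (\<Psi> t x))
       (\<lambda>t x. - adjoint (\<Psi> t) (Hop S u lam \<kappa> t (\<Psi> t x))) Cz Cg g\<^sub>0 L"
    "second_variation_data.pieces (\<lambda>t x. Zop S u lam \<kappa> c t (\<Psi> t x))
       (\<lambda>t x. - adjoint (\<Psi> t) (Hop S u lam \<kappa> t (\<Psi> t x))) L q n"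
    "\<And>t x y. t \<in> {0..1} \<Longrightarrow> - adjoint (\<Psi> t) (Hop S u lam \<kappa> t (\<Psi> t x)) \<bullet> y = - (Hop S u lam \<kappa> t (\<Psi> t x) \<bullet> \<Psi> t y)"
proof -
  let ?H = "Hop S u lam \<kappa>"
  obtain \<Psi> where \<Psi>: "trivialization \<Psi>"
    and pH: "piecewise_analytic_matrix (\<lambda>t w. adjoint (\<Psi> t) (?H t (\<Psi> t w)))"
    and pZ: "piecewise_analytic_matrix (\<lambda>t w. Zop S u lam \<kappa> c t (\<Psi> t w))"
    using data unfolding piecewise_analytic_data_def by blast
  obtain B where B: "B > 0" "linear_family 0 1 B \<Psi>" "linear_family 0 1 B (\<lambda>t. inv (\<Psi> t))"
    using trivialization_families[OF \<Psi>] .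
  have lb: "linear (\<Psi> t)" "bij (\<Psi> t)" if "t \<in> {0..1}" for t
    using \<Psi> that unfolding trivialization_def by auto
  have inv: "\<Psi> t (inv (\<Psi> t) x) = x \<and> inv (\<Psi> t) (\<Psi> t x) = x" if "t \<in> {0..1}" for t x
    using lb(2)[OF that] by (simp add: bij_is_surj surj_f_inv_f bij_is_inj)
  let ?G = "\<lambda>t x. - adjoint (\<Psi> t) (?H t (\<Psi> t x))" and ?Z = "\<lambda>t x. Zop S u lam \<kappa> c t (\<Psi> t x)"
  obtain F1 L1 Cg where H: "finite F1" "L1 \<ge> 0" "linear_family 0 1 Cg (\<lambda>t w. adjoint (\<Psi> t) (?H t (\<Psi> t w)))"
    "\<And>s t x. 0 \<le> s \<Longrightarrow> s \<le> t \<Longrightarrow> t \<le> 1 \<Longrightarrow> {s..t} \<inter> F1 = {} \<Longrightarrow>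
      norm (adjoint (\<Psi> s) (?H s (\<Psi> s x)) - adjoint (\<Psi> t) (?H t (\<Psi> t x))) \<le> L1 * (t - s) * norm x"
    by (rule piecewise_analytic_matrix_family[OF pH]) (rule that)
  obtain F2 L2 Cz0 where Z: "finite F2" "L2 \<ge> 0" "linear_family 0 1 Cz0 ?Z"
    "\<And>s t x. 0 \<le> s \<Longrightarrow> s \<le> t \<Longrightarrow> t \<le> 1 \<Longrightarrow> {s..t} \<inter> F2 = {} \<Longrightarrow> norm (?Z s x - ?Z t x) \<le> L2 * (t - s) * norm x"
    by (rule piecewise_analytic_matrix_family[OF pZ]) (rule that)
  define L where "L = L1 + L2"
  define Cz where "Cz = max Cz0 1"
  have Z': "linear_family 0 1 Cz ?Z" by (rule linear_family_mono[OF Z(3)]) (simp add: Cz_def)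
  have G': "linear_family 0 1 Cg ?G"
    using H(3) unfolding linear_family_def by (auto intro: linear_compose_neg borel_measurable_uminus)
  have Gin: "?G t x \<bullet> y = - (?H t (\<Psi> t x) \<bullet> \<Psi> t y)" if "t \<in> {0..1}" for t x y
    using adjoint_works[OF lb(1)[OF that], of y "?H t (\<Psi> t x)"] by (simp add: inner_commute)
  obtain B0 where B0: "\<And>t w. t \<in> {0..1} \<Longrightarrow> norm (inv (?H t) w) \<le> B0 * norm w"
    using reg unfolding regular_extremal_def by blast
  define Bh where "Bh = max B0 1"
  have Bh: "norm (inv (?H t) w) \<le> Bh * norm w" if "t \<in> {0..1}" for t w
  proof -
    have "B0 * norm w \<le> Bh * norm w" by (intro mult_right_mono) (auto simp: Bh_def)
    then show ?thesis using B0[OF that, of w] by linarith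
  qed
  have Bh0: "Bh > 0" by (simp add: Bh_def)
  have sym: "?H t v \<bullet> w = ?H t w \<bullet> v" if "t \<in> {0..1}" for t v w by (rule Hop_symmetric[OF S lam \<kappa> that])
  \<comment> \<open>Symmetry of \<open>Hop\<close> moves sums and multiples into the second argument
    of the inner product, where linearity is plain.\<close>
  have linH: "linear (?H t)" if t: "t \<in> {0..1}" for t
  proof (rule linearI)
    fix v w and r :: real
    have "?H t (v + w) \<bullet> z = (?H t v + ?H t w) \<bullet> z" "?H t (r *\<^sub>R v) \<bullet> z = (r *\<^sub>R ?H t v) \<bullet> z" for z
      using sym[OF t, of _ z] by (simp_all add: inner_add_right inner_add_left)
    then show "?H t (v + w) = ?H t v + ?H t w" "?H t (r *\<^sub>R v) = r *\<^sub>R ?H t v"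
      by (metis vector_eq_rdot)+
  qed
  \<comment> \<open>The coercivity constant \<open>1 / Bh\<close> of minus \<open>H\<close> is
    divided by \<open>B\<^sup>2\<close>, since \<open>norm x\<close> is at most \<open>B\<close>
    times the norm of \<open>\<Psi> t x\<close>.\<close>
  define g\<^sub>0 where "g\<^sub>0 = 1 / (Bh * B\<^sup>2)"
  have g0: "g\<^sub>0 > 0" using Bh0 B(1) by (simp add: g\<^sub>0_def)
  have low: "g\<^sub>0 * (norm x)\<^sup>2 \<le> ?G t x \<bullet> x" if t: "t \<in> {0..1}" for t x
  proof -
    have bij: "bij (?H t)" using reg t unfolding regular_extremal_def by blast
    have "norm (inv (\<Psi> t) (\<Psi> t x)) \<le> B * norm (\<Psi> t x)" using B(3) t by (simp add: linear_family_def)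
    then have "norm x \<le> B * norm (\<Psi> t x)" using inv[OF t] by simp
    then have "(norm x)\<^sup>2 \<le> (B * norm (\<Psi> t x))\<^sup>2" by (intro power_mono) auto
    then have "g\<^sub>0 * (norm x)\<^sup>2 \<le> g\<^sub>0 * (B * norm (\<Psi> t x))\<^sup>2" using g0 by (intro mult_left_mono) auto
    also have "\<dots> = (norm (\<Psi> t x))\<^sup>2 / Bh" using B(1) by (simp add: g\<^sub>0_def power_mult_distrib)
    also have "\<dots> \<le> - (?H t (\<Psi> t x) \<bullet> \<Psi> t x)"
      by (rule inverse_bound_imp_coercive[OF linH[OF t] bij sym[OF t] neg[OF t] Bh[OF t] Bh0])
    finally show ?thesis using Gin[OF t] by simp
  qed
  have data': "second_variation_data \<sigma> 2 ?Z ?G Cz Cg g\<^sub>0 L" if "alternating_form \<sigma> 2" for \<sigma>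
    using that unfolding second_variation_data_def second_variation_data_axioms_def
    using Z' G' g0 low H(2) Z(2) by (auto simp: Cz_def L_def)
  obtain q :: "nat \<Rightarrow> real" and n where q: "q 0 = 0" "q n = 1"
    "\<And>i. i < n \<Longrightarrow> q i < q (Suc i) \<and> {q i<..<q (Suc i)} \<inter> (F1 \<union> F2) = {} \<and> 0 \<le> q i \<and> q (Suc i) \<le> 1"
    using exists_subdivision[of "F1 \<union> F2"] H(1) Z(1) by auto
  \<comment> \<open>\<open>pieces\<close> depends on \<open>Z\<close>, \<open>G\<close> and
    \<open>L\<close> but not on the form, so any instance gives access to its definition.\<close>
  interpret D: second_variation_data "sigma undefined" 2 ?Z ?G Cz Cg g\<^sub>0 L
    by (rule data'[OF alternating_form_sigma(1)])
  have "D.pieces q n"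
    unfolding D.pieces_def D.lipschitz_between_def
  proof (intro conjI allI impI q(1,2))
    fix i assume i: "i < n"
    show "q i < q (Suc i)" using q(3)[OF i] by blast
    fix t s :: real and x :: 'k assume ts: "q i < t \<and> t < q (Suc i) \<and> q i < s \<and> s < q (Suc i)"
    define a where "a = min s t"
    define b where "b = max s t"
    have ab: "0 \<le> a" "a \<le> b" "b \<le> 1" using ts q(3)[OF i] by (auto simp: a_def b_def)
    have "{a..b} \<subseteq> {q i<..<q (Suc i)}" using ts by (auto simp: a_def b_def)
    then have e: "{a..b} \<inter> F1 = {}" "{a..b} \<inter> F2 = {}" using q(3)[OF i] by blast+
    have st: "b - a = \<bar>t - s\<bar>" by (auto simp: a_def b_def)
    have L12: "L1 * (b - a) * norm x \<le> L * \<bar>t - s\<bar> * norm x" "L2 * (b - a) * norm x \<le> L * \<bar>t - s\<bar> * norm x"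
      using H(2) Z(2) unfolding st by (auto simp: L_def intro!: mult_right_mono)
    have "norm (?Z t x - ?Z s x) = norm (?Z a x - ?Z b x)"
      by (cases "s \<le> t") (auto simp: a_def b_def norm_minus_commute)
    then show "norm (?Z t x - ?Z s x) \<le> L * \<bar>t - s\<bar> * norm x" using Z(4)[OF ab e(2), of x] L12(2) by linarith
    have "norm (?G t x - ?G s x) = norm (?G b x - ?G a x)"
      by (cases "s \<le> t") (auto simp: a_def b_def norm_minus_commute)
    also have "\<dots> = norm (adjoint (\<Psi> a) (?H a (\<Psi> a x)) - adjoint (\<Psi> b) (?H b (\<Psi> b x)))" by simp
    finally show "norm (?G t x - ?G s x) \<le> L * \<bar>t - s\<bar> * norm x" using H(4)[OF ab e(1), of x] L12(1) by linarith
  qed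
  then show thesis using that[OF B inv data' _ Gin] by blast
qed

section \<open>Transport from the trivialization to the control problem\<close>

theorem corollary1:
  fixes S :: "('m, 'e::euclidean_space, 'u, 'k::euclidean_space) control_system"
    and u :: "real \<Rightarrow> 'u"
    and lam :: "real \<Rightarrow> ('m, 'e) cobundle"
    and \<kappa> :: "real \<Rightarrow> ('u, 'k) chart"
    and c :: "('m, 'e) chart"
    and K :: "'k L2 \<Rightarrow> 'k L2"
    and V :: "'k L2 set"
  assumes "smooth_control_system S"
    and "normal_extremal_control S u"
    and "regular_point S u"
    and "normal_extremal S u lam"
    and "chart_field (control_atlas S) u \<kappa>"
    and "c \<in> state_atlas S" and "start S \<in> cdom c"
    and "regular_extremal S u lam \<kappa>"
    and "\<And>t v. t \<in> {0..1} \<Longrightarrow> v \<noteq> 0 \<Longrightarrow> Hop S u lam \<kappa> t v \<bullet> v < 0"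
    and "piecewise_analytic_data S u lam \<kappa> c"
    and "V = variations S u lam \<kappa> c"
    and "second_variation_operator S u lam \<kappa> c K"
  shows "(\<exists>l. ((\<lambda>\<epsilon>. \<Sum>\<alpha> | \<alpha> \<in> spectrum_on V K \<and> \<bar>\<alpha>\<bar> \<ge> \<epsilon>.
                    real (multiplicity_on V K \<alpha>) * \<alpha>) \<longlongrightarrow> l) (at_right 0)) \<and>
         (\<exists>l. ((\<lambda>\<epsilon>. \<Prod>\<alpha> | \<alpha> \<in> spectrum_on V K \<and> \<bar>\<alpha>\<bar> \<ge> \<epsilon>.
                    (1 + \<alpha>) ^ multiplicity_on V K \<alpha>) \<longlongrightarrow> l) (at_right 0))"
proof -
  let ?H = "Hop S u lam \<kappa>"
  obtain \<Psi> B Cz Cg g\<^sub>0 L q n where B: "B > 0" "linear_family 0 1 B \<Psi>" "linear_family 0 1 B (\<lambda>t. inv (\<Psi> t))"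
    and inv: "\<And>t x. t \<in> {0..1} \<Longrightarrow> \<Psi> t (inv (\<Psi> t) x) = x \<and> inv (\<Psi> t) (\<Psi> t x) = x"
    and data: "\<And>\<sigma>. alternating_form \<sigma> 2 \<Longrightarrow> second_variation_data \<sigma> 2 (\<lambda>t x. Zop S u lam \<kappa> c t (\<Psi> t x))
       (\<lambda>t x. - adjoint (\<Psi> t) (?H t (\<Psi> t x))) Cz Cg g\<^sub>0 L"
    and pieces: "second_variation_data.pieces (\<lambda>t x. Zop S u lam \<kappa> c t (\<Psi> t x))
       (\<lambda>t x. - adjoint (\<Psi> t) (?H t (\<Psi> t x))) L q n"
    and Gin: "\<And>t x y. t \<in> {0..1} \<Longrightarrow> - adjoint (\<Psi> t) (?H t (\<Psi> t x)) \<bullet> y = - (?H t (\<Psi> t x) \<bullet> \<Psi> t y)"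
    by (rule trivialized_data[OF assms(1,4,5,8) _ assms(10)]) (erule (1) assms(9), rule that)
  define Z where "Z t x = Zop S u lam \<kappa> c t (\<Psi> t x)" for t x
  define G where "G t x = - adjoint (\<Psi> t) (?H t (\<Psi> t x))" for t x
  define z0 where "z0 = cmap (cochart (state_atlas S) c) (lam 0)"
  note data = data[folded Z_def[abs_def] G_def[abs_def]]
  note pieces = pieces[folded Z_def[abs_def] G_def[abs_def]]
  note Gin = Gin[folded G_def]
  interpret D: second_variation_data "sigma z0" 2 Z G Cz Cg g\<^sub>0 L
    by (rule data[OF alternating_form_sigma(1)])
  \<comment> \<open>On variations \<open>D'.Q\<close> represents \<open>K\<close> and
    \<open>D.Q\<close> its negative; a swap in one interpretation yields a dominating set for the
    other operator.\<close>
  interpret D': second_variation_data "\<lambda>a b. - sigma z0 a b" 2 Z G Cz Cg g\<^sub>0 L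
    by (rule data[OF alternating_form_sigma(2)])
  have Q': "D'.Q v = - D.Q v" for v
    unfolding D'.Q_def D.Q_def D'.causal_def D.causal_def by (simp add: integral_neg)
  \<comment> \<open>\<open>K\<close> acts in the coordinates of the chart field, while the Lipschitz
    data live in the trivialization; multiplication by \<open>\<Psi>\<close> and by its inverse
    passes between the two.\<close>
  define U where "U = mult_L2 \<Psi>"
  define Ui where "Ui = mult_L2 (\<lambda>t. inv (\<Psi> t))"
  have blU: "bounded_linear U" and blUi: "bounded_linear Ui"
    unfolding U_def Ui_def by (rule bounded_linear_mult_L2[OF B(2)], rule bounded_linear_mult_L2[OF B(3)])
  have UUi: "U (Ui v) = v" and UiU: "Ui (U v) = v" for v
  proof -
    note m = sqi_linear_family(1)[OF B(2) sqi_rep, of v] sqi_linear_family(1)[OF B(3) sqi_rep, of v]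
    have "U (Ui v) = abs_L2 (\<lambda>t. \<Psi> t (inv (\<Psi> t) (rep_L2 v t)))"
      unfolding U_def Ui_def mult_L2_def[of "\<lambda>t. inv (\<Psi> t)"] by (rule mult_L2_abs[OF B(2) m(2)])
    also have "\<dots> = abs_L2 (rep_L2 v)"
      by (rule abs_L2_eqI[OF sqi_linear_family(1)[OF B(2) m(2)] sqi_rep ae_eq_cong]) (simp add: inv)
    finally show "U (Ui v) = v" by (simp add: abs_rep_L2)
    have "Ui (U v) = abs_L2 (\<lambda>t. inv (\<Psi> t) (\<Psi> t (rep_L2 v t)))"
      unfolding U_def Ui_def mult_L2_def[of \<Psi>] by (rule mult_L2_abs[OF B(3) m(1)])
    also have "\<dots> = abs_L2 (rep_L2 v)"
      by (rule abs_L2_eqI[OF sqi_linear_family(1)[OF B(3) m(1)] sqi_rep ae_eq_cong]) (simp add: inv)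
    finally show "Ui (U v) = v" by (simp add: abs_rep_L2)
  qed
  have linU: "linear U" "linear Ui" using blU blUi bounded_linear.linear by auto
  have injU: "inj U" "inj Ui" using UUi UiU by (metis injI)+
  have Ui_abs: "Ui v = abs_L2 (\<lambda>t. inv (\<Psi> t) (rep_L2 v t))" for v by (simp add: Ui_def mult_L2_def)
  note sUi = sqi_linear_family(1)[OF B(3) sqi_rep]
  define ip where "ip = variation_inner S u lam \<kappa>"
  have ip: "ip v w = mult_L2 G (Ui v) \<bullet> Ui w" for v w
  proof -
    have "mult_L2 G (Ui v) \<bullet> Ui w = (LINT t|lebesgue_on {0..1}. G t (inv (\<Psi> t) (rep_L2 v t)) \<bullet> inv (\<Psi> t) (rep_L2 w t))"
      unfolding Ui_abs mult_L2_abs[OF D.G sUi] by (rule inner_abs_L2[OF sqi_linear_family(1)[OF D.G sUi] sUi])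
    also have "\<dots> = ip v w"
      unfolding ip_def variation_inner_def
      by (rule Bochner_Integration.integral_cong) (simp_all add: Gin inv)
    finally show ?thesis ..
  qed
  have ip_sym: "ip v w = ip w v" for v w
    unfolding ip_def variation_inner_def
    by (rule Bochner_Integration.integral_cong) (simp_all add: Hop_symmetric[OF assms(1,4,5)])
  have ip_W: "ip v v = D.W (Ui v)" for v
    unfolding ip weight_eq_inner[OF D.G] D.W_def ..
  have bil: "bounded_bilinear ip"
  proof -
    have "bounded_bilinear (\<lambda>v w. mult_L2 G (Ui v) \<bullet> Ui w)"
      by (rule bounded_bilinear.comp[OF bounded_bilinear_inner
        bounded_linear_compose[OF bounded_linear_mult_L2[OF D.G] blUi] blUi])
    then show ?thesis by (simp add: ip[abs_def])
  qed
  obtain C where C: "C > 0" "\<And>v w. norm (ip v w) \<le> norm v * norm w * C"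
    using bounded_bilinear.pos_bounded[OF bil] by blast
  have lower: "(g\<^sub>0 / B\<^sup>2) * (norm v)\<^sup>2 \<le> ip v v" for v
  proof -
    have "norm (U (Ui v)) \<le> B * norm (Ui v)" unfolding U_def by (rule norm_mult_L2[OF B(2)])
    then have "(norm v)\<^sup>2 \<le> (B * norm (Ui v))\<^sup>2" unfolding UUi by (intro power_mono) auto
    then have "(g\<^sub>0 / B\<^sup>2) * (norm v)\<^sup>2 \<le> (g\<^sub>0 / B\<^sup>2) * (B * norm (Ui v))\<^sup>2"
      using D.g0 by (intro mult_left_mono) auto
    also have "\<dots> = g\<^sub>0 * energy 0 1 (rep_L2 (Ui v))" using B(1) by (simp add: power_mult_distrib norm_L2_energy)
    also have "\<dots> \<le> D.W (Ui v)" unfolding D.W_def by (rule weight_lower[OF D.G sqi_rep D.G_lower])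
    finally show ?thesis by (simp add: ip_W)
  qed
  define I where "I v = integral {0..1} (\<lambda>t. Z t (rep_L2 v t))" for v
  have blI: "bounded_linear I" unfolding I_def[abs_def] by (rule bounded_linear_integral_L2[OF D.Z])
  have I_Ui: "I (Ui v) = integral {0..1} (\<lambda>t. Z t (inv (\<Psi> t) (rep_L2 v t)))" for v
    unfolding I_def Ui_abs by (rule integral_ae_eq[OF ae_eq_compose[OF rep_abs_L2[OF sUi]]]) auto
  have V: "V = {v. fst (I (Ui v)) = 0}"
  proof -
    have "(LINT t|lebesgue_on {0..1}. Xop S u lam \<kappa> c t (rep_L2 v t)) = fst (I (Ui v))" for v
      unfolding I_Ui by (rule LINT_fst_linear_family[OF D.Z _ sUi]) (simp add: Xop_def Z_def inv)
    then show ?thesis unfolding assms(11) variations_def by simp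
  qed
  have blfst: "bounded_linear (\<lambda>v. fst (I (Ui v)))"
    by (rule bounded_linear_compose[OF bounded_linear_fst bounded_linear_compose[OF blI blUi]])
  have subV: "subspace V" unfolding V by (rule linear_subspace_kernel[OF bounded_linear.linear[OF blfst]])
  have closedV: "closed V" unfolding V
    by (intro closed_Collect_eq continuous_on_const bounded_linear.continuous_on[OF blfst] continuous_on_id)
  have svo: "compact_operator_on V K" "\<And>v w. v \<in> V \<Longrightarrow> w \<in> V \<Longrightarrow> ip (K v) w = ip v (K w)"
    and KQ: "\<And>v. v \<in> V \<Longrightarrow> ip (K v) v = D'.Q (Ui v)"
  proof -
    note a = assms(12)[unfolded second_variation_operator_def Let_def, folded assms(11) ip_def z0_def]
    show "compact_operator_on V K" "\<And>v w. v \<in> V \<Longrightarrow> w \<in> V \<Longrightarrow> ip (K v) w = ip v (K w)" using a by blast+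
    fix v assume "v \<in> V"
    then have "ip (K v) v = - (LINT t|lebesgue_on {0..1}. sigma z0
        (LINT \<tau>|lebesgue_on {0..t}. Zop S u lam \<kappa> c \<tau> (rep_L2 v \<tau>)) (Zop S u lam \<kappa> c t (rep_L2 v t)))"
      using a by blast
    also have "\<dots> = - D.causal 0 1 Z Z (\<lambda>t. inv (\<Psi> t) (rep_L2 v t))"
      by (subst D.LINT_eq_causal[OF D.Z _ sUi]) (simp_all add: Z_def inv)
    also have "\<dots> = D'.Q (Ui v)" unfolding Q' Ui_abs D.Q_abs[OF sUi] ..
    finally show "ip (K v) v = D'.Q (Ui v)" .
  qed
  interpret CS: compact_symmetric V ip K "g\<^sub>0 / B\<^sup>2" C
  proof (rule compact_symmetric.intro)
    show "0 < g\<^sub>0 / B\<^sup>2" using D.g0 B(1) by simp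
    show "\<bar>ip v w\<bar> \<le> C * norm v * norm w" for v w using C(2)[of v w] by (simp add: mult_ac)
  qed (fact subV closedV bil ip_sym lower C(1) svo(1) | rule svo(2); assumption)+
  interpret neg: compact_symmetric V ip "\<lambda>v. - K v" "g\<^sub>0 / B\<^sup>2" C by (rule CS.compact_symmetric_uminus)
  have negK: "ip (- K v) v = - ip (K v) v" for v by (rule CS.g.minus_left)
  have image: "finite (f ` B) \<and> independent (f ` B) \<and> card (f ` B) = card B \<and> span (f ` B) = f ` span B"
    if f: "linear f" "inj f" and B: "finite B" "independent B" for f :: "'k L2 \<Rightarrow> 'k L2" and B
  proof (intro conjI)
    have inj: "inj_on f A" for A using f(2) by (rule inj_on_subset) simp
    show "finite (f ` B)" using B(1) by simp
    show "independent (f ` B)" by (rule linear_independent_injective_image[OF f(1) B(2) inj])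
    show "card (f ` B) = card B" by (rule card_image[OF inj])
    show "span (f ` B) = f ` span B" by (rule linear_span_image[OF f(1)])
  qed
  note to_w = image[OF linU(2) injU(2)] and from_w = image[OF linU(1) injU(1)]
  have dom: "D'.W_dominated s (Ui ` B)" if B: "CS.dominating s B" for s B
  proof -
    have "span B \<subseteq> V" using B subV by (simp add: CS.dominating_def span_minimal)
    then show ?thesis using B to_w[of B] unfolding CS.dominating_def D'.W_dominated_def
      by (auto simp: ip_W KQ subset_iff)
  qed
  have ndom: "D.W_dominated s (Ui ` B)" if B: "neg.dominating s B" for s B
  proof -
    have "span B \<subseteq> V" using B subV by (simp add: neg.dominating_def span_minimal)
    then show ?thesis using B to_w[of B] unfolding neg.dominating_def D.W_dominated_def
      by (auto simp: ip_W KQ negK Q' subset_iff)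
  qed
  \<comment> \<open>For a variation the base component of the integral of \<open>Z\<close> has to
    vanish; the swap delivers the vanishing of the whole vector.\<close>
  have inV: "U ` B' \<subseteq> V" if "\<forall>v\<in>span B'. integral {0..1} (\<lambda>t. Z t (rep_L2 v t)) = 0" for B'
    using that span_base[of _ B'] by (auto simp: V UiU I_def)
  have neg_from: "neg.dominating s (U ` B')"
    if "finite B'" "independent B'" "\<forall>v\<in>span B'. s * D'.W v \<le> - D'.Q v" "\<forall>v\<in>span B'. integral {0..1} (\<lambda>t. Z t (rep_L2 v t)) = 0" for s B'
  proof -
    have "span (U ` B') \<subseteq> V" using inV[OF that(4)] subV by (simp add: span_minimal)
    then show ?thesis using that from_w[of B'] inV[OF that(4)] unfolding neg.dominating_def
      by (auto simp: ip_W KQ negK UiU subset_iff)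
  qed
  have pos_from: "CS.dominating s (U ` B')"
    if "finite B'" "independent B'" "\<forall>v\<in>span B'. s * D.W v \<le> - D.Q v" "\<forall>v\<in>span B'. integral {0..1} (\<lambda>t. Z t (rep_L2 v t)) = 0" for s B'
  proof -
    have "span (U ` B') \<subseteq> V" using inV[OF that(4)] subV by (simp add: span_minimal)
    then show ?thesis using that from_w[of B'] inV[OF that(4)] unfolding CS.dominating_def
      by (auto simp: ip_W KQ Q' UiU subset_iff)
  qed
  obtain M1 where M1: "M1 \<ge> 0" "\<And>s B. 0 < s \<Longrightarrow> s \<le> 1 \<Longrightarrow> D.W_dominated s B \<Longrightarrow> real (card B) \<le> M1 / s"
    using D.W_dominated_card_bound[OF pieces] by blast
  obtain M2 where M2: "M2 \<ge> 0" "\<And>s B. 0 < s \<Longrightarrow> s \<le> 1 \<Longrightarrow> D'.W_dominated s B \<Longrightarrow> real (card B) \<le> M2 / s"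
    using D'.W_dominated_card_bound[OF pieces] by blast
  obtain M3 s3 where M3: "M3 \<ge> 0" "0 < s3" "s3 \<le> 1/2" "\<And>s B. 0 < s \<Longrightarrow> s \<le> s3 \<Longrightarrow> D.W_dominated s B \<Longrightarrow>
    (\<exists>B'. finite B' \<and> independent B' \<and> (\<forall>v\<in>span B'. s * D.W v \<le> - D.Q v) \<and>
    (\<forall>v\<in>span B'. integral {0..1} (\<lambda>t. Z t (rep_L2 v t)) = 0) \<and> real (card B) \<le> real (card B') + M3 * s powr (-2/3))"
    using D.W_dominated_swap_bound[OF pieces] by blast
  obtain M4 s4 where M4: "M4 \<ge> 0" "0 < s4" "s4 \<le> 1/2" "\<And>s B. 0 < s \<Longrightarrow> s \<le> s4 \<Longrightarrow> D'.W_dominated s B \<Longrightarrow>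
    (\<exists>B'. finite B' \<and> independent B' \<and> (\<forall>v\<in>span B'. s * D'.W v \<le> - D'.Q v) \<and>
    (\<forall>v\<in>span B'. integral {0..1} (\<lambda>t. Z t (rep_L2 v t)) = 0) \<and> real (card B) \<le> real (card B') + M4 * s powr (-2/3))"
    using D'.W_dominated_swap_bound[OF pieces] by blast
  define M where "M = M1 + M2 + M3 + M4"
  have M: "M1 \<le> M" "M2 \<le> M" "M3 \<le> M" "M4 \<le> M" "0 \<le> M" using M1(1) M2(1) M3(1) M4(1) by (auto simp: M_def)
  show ?thesis
  proof (rule CS.balanced_counting_limits[of "min s3 s4" M])
    show "0 < min s3 s4" "min s3 s4 \<le> 1/2" "0 \<le> M" using M3 M4 M by auto
    fix s :: real and B assume s: "0 < s" "s \<le> min s3 s4"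
    have s1: "s \<le> 1" using s M3(3) by auto
    have powr: "0 \<le> s powr (-2/3)" by simp
    {
      assume B: "CS.dominating s B"
      have c: "card (Ui ` B) = card B" using B to_w[of B] by (auto simp: CS.dominating_def)
      have "real (card B) \<le> M2 / s" using M2(2)[OF s(1) s1 dom[OF B]] c by simp
      also have "\<dots> \<le> M / s" using M s by (simp add: divide_right_mono)
      finally show "real (card B) \<le> M / s" .
      obtain B' where B': "finite B'" "independent B'" "\<forall>v\<in>span B'. s * D'.W v \<le> - D'.Q v"
        "\<forall>v\<in>span B'. integral {0..1} (\<lambda>t. Z t (rep_L2 v t)) = 0" "real (card (Ui ` B)) \<le> real (card B') + M4 * s powr (-2/3)"
        using M4(4)[OF s(1) _ dom[OF B]] s by auto
      have "M4 * s powr (-2/3) \<le> M * s powr (-2/3)" using M powr by (intro mult_right_mono) auto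
      then have "real (card B) \<le> real (card (U ` B')) + M * s powr (-2/3)"
        using B'(5) c from_w[OF B'(1,2)] by simp
      then show "\<exists>B'. neg.dominating s B' \<and> real (card B) \<le> real (card B') + M * s powr (-2/3)"
        using neg_from[OF B'(1-4)] by blast
    next
      assume B: "neg.dominating s B"
      have c: "card (Ui ` B) = card B" using B to_w[of B] by (auto simp: neg.dominating_def)
      have "real (card B) \<le> M1 / s" using M1(2)[OF s(1) s1 ndom[OF B]] c by simp
      also have "\<dots> \<le> M / s" using M s by (simp add: divide_right_mono)
      finally show "real (card B) \<le> M / s" .
      obtain B' where B': "finite B'" "independent B'" "\<forall>v\<in>span B'. s * D.W v \<le> - D.Q v"
        "\<forall>v\<in>span B'. integral {0..1} (\<lambda>t. Z t (rep_L2 v t)) = 0" "real (card (Ui ` B)) \<le> real (card B') + M3 * s powr (-2/3)"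
        using M3(4)[OF s(1) _ ndom[OF B]] s by auto
      have "M3 * s powr (-2/3) \<le> M * s powr (-2/3)" using M powr by (intro mult_right_mono) auto
      then have "real (card B) \<le> real (card (U ` B')) + M * s powr (-2/3)"
        using B'(5) c from_w[OF B'(1,2)] by simp
      then show "\<exists>B'. CS.dominating s B' \<and> real (card B) \<le> real (card B') + M * s powr (-2/3)"
        using pos_from[OF B'(1-4)] by blast
    }
  qed
qed

end
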